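(* Let $G=\langle g_0\rangle$ be a finite cyclic group, $\chi$ a character of $G$ with $\chi_0=\chi(g_0)$ of order $p^m$ ($p$ prime, $m\ge1$), and let $K\supseteq\mathbb{Q}(\chi_0)$ be a number field with ring of integers $\mathcal{O}_K$. Let $\rho_\chi:G\to\mathrm{GL}_2(K)$, $\rho_\chi(g)=\begin{pmatrix}1&0\\0&\chi(g)\end{pmatrix}$. Write $(1-\chi_0)\mathcal{O}_K=P_1^{e_1}\cdots P_r^{e_r}$ with distinct primes $P_i$. For each $i$, let $\mathfrak{t}_i$ be the Bruhat–Tits tree of $\mathrm{SL}_2$ over the completion $K_{P_i}$, $\mathfrak{a}_i$ its standard apartment, $s_i\in\mathfrak{a}_i$ the vertex of the lattice $\mathcal{O}_{P_i}^2$, and let the side branch $S_i$ be the set of vertices $v$ of $\mathfrak{t}_i$ whose distance to $\mathfrak{a}_i$ is at most $e_i$ and whose nearest vertex in $\mathfrak{a}_i$ is $s_i$. Let $\mathbb{B}=S_1\times\cdots\times S_r$, on which $\mathcal{O}_K^*$ acts coordinatewise via $u\mapsto\begin{pmatrix}1&0\\0&u\end{pmatrix}$ (acting on each tree in the natural way), and let $\mathbf{O}$ be the number of orbits of this action. Then the number of $\mathrm{GL}_2(\mathcal{O}_K)$-conjugacy classes of homomorphisms $G\to\mathrm{GL}_2(\mathcal{O}_K)$ that are $\mathrm{GL}_2(K)$-conjugate to $\rho_\chi$ is $\mathbf{O}\,h_K$.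
   Context: For a non-archimedean completion $K_\nu$ with ring of integers $\mathcal{O}_\nu$, the Bruhat–Tits tree has as vertices the homothety classes of $\mathcal{O}_\nu$-lattices in $K_\nu^2$ (equivalently, maximal orders $\mathrm{End}_{\mathcal{O}_\nu}(\Lambda)$ in $\mathbb{M}_2(K_\nu)$), two vertices adjacent when representatives $\Lambda'\subsetneq\Lambda$ satisfy $\pi_\nu\Lambda\subsetneq\Lambda'$; $\mathrm{GL}_2(K_\nu)$ acts by $\mathtt{g}\cdot[\Lambda]=[\mathtt{g}\Lambda]$. The standard apartment is the bi-infinite path consisting of classes of lattices $\mathcal{O}_\nu\oplus\pi_\nu^k\mathcal{O}_\nu$, $k\in\mathbb{Z}$ (vertices fixed by all diagonal matrices with unit entries). Distances are graph distances. $h_K$ is the class number of $K$. *)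

theory Defs
  imports
    "HOL-Analysis.Analysis"
    "HOL-Algebra.Algebra"
    "HOL-Decision_Procs.Algebra_Aux"
begin

definition number_field :: "'k::field_char_0 itself \<Rightarrow> bool" where
  "number_field _ \<longleftrightarrow>
     (\<exists>B. finite_dimensional_vector_space (\<lambda>(q::rat) (x::'k). of_rat q * x) B)"

definition int_ring_of :: "'k::field_char_0 ring" (\<open>\<O>\<close>) where
  "\<O> = cring_class_ops\<lparr>carrier := {x. algebraic_int x}\<rparr>"

definition nonzero_ideals :: "'k::field_char_0 set set" where
  "nonzero_ideals = {I. ideal I \<O> \<and> I \<noteq> {0}}"

text \<open>Every ideal class of fractional ideals contains integral ideals, so the class group is
  represented by nonzero integral ideals modulo scaling by the field.\<close>

definition ideal_class_rel :: "('k::field_char_0 set \<times> 'k set) set" where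
  "ideal_class_rel = {(I, J). I \<in> nonzero_ideals \<and> J \<in> nonzero_ideals \<and>
     (\<exists>a\<in>carrier \<O> - {0}. \<exists>b\<in>carrier \<O> - {0}. (*) a ` I = (*) b ` J)}"

definition class_number :: "'k::field_char_0 itself \<Rightarrow> nat" where
  "class_number _ = card ((nonzero_ideals :: 'k set set) // ideal_class_rel)"

definition GL2 :: "'k::field_char_0 set \<Rightarrow> ('k^2^2) monoid" where
  "GL2 S = \<lparr>carrier = {A. (\<forall>i j. A $ i $ j \<in> S) \<and>
                         (\<exists>B. (\<forall>i j. B $ i $ j \<in> S) \<and> A ** B = mat 1 \<and> B ** A = mat 1)},
            mult = (**), one = mat 1\<rparr>"

definition diag2 :: "'k::field_char_0 \<Rightarrow> 'k \<Rightarrow> 'k^2^2" where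
  "diag2 a b = vector [vector [a, 0], vector [0, b]]"

definition conj_hom :: "('g, 'm) monoid_scheme \<Rightarrow> 'k::field_char_0^2^2 \<Rightarrow> ('g \<Rightarrow> 'k^2^2) \<Rightarrow> 'g \<Rightarrow> 'k^2^2" where
  "conj_hom G A \<rho> = (\<lambda>g\<in>carrier G. A ** \<rho> g ** matrix_inv A)"

definition rep_of_char :: "('g, 'm) monoid_scheme \<Rightarrow> ('g \<Rightarrow> 'k::field_char_0) \<Rightarrow> 'g \<Rightarrow> 'k^2^2" where
  "rep_of_char G chi = (\<lambda>g\<in>carrier G. diag2 1 (chi g))"

text \<open>Homomorphisms into \<open>GL2(\<O>)\<close> that are conjugate over the field to \<open>\<rho>\<close>; being values of
  \<^const>\<open>conj_hom\<close>, they are extensional on the carrier of the group, so that distinct elements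
  are distinct homomorphisms.\<close>

definition integral_forms :: "('g, 'm) monoid_scheme \<Rightarrow> ('g \<Rightarrow> 'k::field_char_0^2^2) \<Rightarrow> ('g \<Rightarrow> 'k^2^2) set" where
  "integral_forms G \<rho> = {\<sigma> \<in> hom G (GL2 (carrier \<O>)). \<exists>A\<in>carrier (GL2 UNIV). \<sigma> = conj_hom G A \<rho>}"

definition integral_conj_classes :: "('g, 'm) monoid_scheme \<Rightarrow> ('g \<Rightarrow> 'k::field_char_0^2^2) \<Rightarrow> ('g \<Rightarrow> 'k^2^2) set set" where
  "integral_conj_classes G \<rho> =
     orbits (GL2 (carrier \<O>)) (integral_forms G \<rho>) (\<lambda>A. \<lambda>\<sigma>\<in>integral_forms G \<rho>. conj_hom G A \<sigma>)"

text \<open>Below, \<open>P\<close> is a nonzero prime ideal of \<open>\<O>\<close>. The base \<open>2\<close> of the absolute value is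
  arbitrary: another base gives an equivalent absolute value, hence the same completion and the
  same unit ball.\<close>

definition ideal_ord :: "'k::field_char_0 set \<Rightarrow> 'k \<Rightarrow> nat" where
  "ideal_ord P a = (GREATEST n. a \<in> P [^]\<^bsub>ideals_set \<O>\<^esub> n)"

definition padic_ord :: "'k::field_char_0 set \<Rightarrow> 'k \<Rightarrow> int" where
  "padic_ord P x = (THE k. \<exists>a\<in>carrier \<O> - {0}. \<exists>b\<in>carrier \<O> - {0}.
      x = a / b \<and> k = int (ideal_ord P a) - int (ideal_ord P b))"

definition padic_abs :: "'k::field_char_0 set \<Rightarrow> 'k \<Rightarrow> real" where
  "padic_abs P x = (if x = 0 then 0 else 2 powi (- padic_ord P x))"

definition cauchy_ring :: "'k::field_char_0 set \<Rightarrow> (nat \<Rightarrow> 'k) ring" where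
  "cauchy_ring P =
     \<lparr>carrier = {s. \<forall>\<epsilon>>0. \<exists>N. \<forall>i\<ge>N. \<forall>j\<ge>N. padic_abs P (s i - s j) < \<epsilon>},
      mult = (\<lambda>s t n. s n * t n), one = (\<lambda>_. 1),
      ring.zero = (\<lambda>_. 0), add = (\<lambda>s t n. s n + t n)\<rparr>"

definition null_seqs :: "'k::field_char_0 set \<Rightarrow> (nat \<Rightarrow> 'k) set" where
  "null_seqs P = {s. (\<lambda>n. padic_abs P (s n)) \<longlonglongrightarrow> 0}"

definition completion :: "'k::field_char_0 set \<Rightarrow> (nat \<Rightarrow> 'k) set ring" where
  "completion P = cauchy_ring P Quot null_seqs P"

definition completion_embed :: "'k::field_char_0 set \<Rightarrow> 'k \<Rightarrow> (nat \<Rightarrow> 'k) set" where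
  "completion_embed P x = null_seqs P +>\<^bsub>cauchy_ring P\<^esub> (\<lambda>_. x)"

definition completion_abs :: "'k::field_char_0 set \<Rightarrow> (nat \<Rightarrow> 'k) set \<Rightarrow> real" where
  "completion_abs P c = (THE l. \<exists>s\<in>c. (\<lambda>n. padic_abs P (s n)) \<longlonglongrightarrow> l)"

definition completion_int :: "'k::field_char_0 set \<Rightarrow> (nat \<Rightarrow> 'k) set ring" where
  "completion_int P =
     (completion P)\<lparr>carrier := {c \<in> carrier (completion P). completion_abs P c \<le> 1}\<rparr>"

definition uniformizer :: "'k::field_char_0 set \<Rightarrow> (nat \<Rightarrow> 'k) set \<Rightarrow> bool" where
  "uniformizer P \<pi> \<longleftrightarrow> \<pi> \<in> carrier (completion_int P) \<and>
     PIdl\<^bsub>completion_int P\<^esub> \<pi> = {c \<in> carrier (completion P). completion_abs P c < 1}"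

type_synonym 'k compl_vec = "(nat \<Rightarrow> 'k) set \<times> (nat \<Rightarrow> 'k) set"
type_synonym 'k bt_vertex = "'k compl_vec set set"

definition vec_scale :: "'k::field_char_0 set \<Rightarrow> (nat \<Rightarrow> 'k) set \<Rightarrow> 'k compl_vec \<Rightarrow> 'k compl_vec" where
  "vec_scale P c = (\<lambda>(x, y). (c \<otimes>\<^bsub>completion P\<^esub> x, c \<otimes>\<^bsub>completion P\<^esub> y))"

definition vec_add :: "'k::field_char_0 set \<Rightarrow> 'k compl_vec \<Rightarrow> 'k compl_vec \<Rightarrow> 'k compl_vec" where
  "vec_add P = (\<lambda>(x, y) (x', y'). (x \<oplus>\<^bsub>completion P\<^esub> x', y \<oplus>\<^bsub>completion P\<^esub> y'))"

definition lin_indep2 :: "'k::field_char_0 set \<Rightarrow> 'k compl_vec \<Rightarrow> 'k compl_vec \<Rightarrow> bool" where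
  "lin_indep2 P v w \<longleftrightarrow>
     (\<forall>a\<in>carrier (completion P). \<forall>b\<in>carrier (completion P).
        vec_add P (vec_scale P a v) (vec_scale P b w) = (\<zero>\<^bsub>completion P\<^esub>, \<zero>\<^bsub>completion P\<^esub>) \<longrightarrow>
        a = \<zero>\<^bsub>completion P\<^esub> \<and> b = \<zero>\<^bsub>completion P\<^esub>)"

definition bt_lattices :: "'k::field_char_0 set \<Rightarrow> 'k compl_vec set set" where
  "bt_lattices P =
     {{vec_add P (vec_scale P a v) (vec_scale P b w) | a b.
         a \<in> carrier (completion_int P) \<and> b \<in> carrier (completion_int P)} | v w.
       v \<in> carrier (completion P) \<times> carrier (completion P) \<and>
       w \<in> carrier (completion P) \<times> carrier (completion P) \<and> lin_indep2 P v w}"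

definition homothety_class :: "'k::field_char_0 set \<Rightarrow> 'k compl_vec set \<Rightarrow> 'k bt_vertex" where
  "homothety_class P L =
     {vec_scale P c ` L | c. c \<in> carrier (completion P) - {\<zero>\<^bsub>completion P\<^esub>}}"

definition bt_vertices :: "'k::field_char_0 set \<Rightarrow> 'k bt_vertex set" where
  "bt_vertices P = homothety_class P ` bt_lattices P"

text \<open>The adjacency relation is symmetric: \<open>\<pi>L \<subset> L' \<subset> L\<close> implies \<open>\<pi>L' \<subset> \<pi>L \<subset> L'\<close>.\<close>

definition bt_adj :: "'k::field_char_0 set \<Rightarrow> 'k bt_vertex rel" where
  "bt_adj P = {(v, w). v \<in> bt_vertices P \<and> w \<in> bt_vertices P \<and>
     (\<exists>L\<in>v. \<exists>L'\<in>w. \<exists>\<pi>. uniformizer P \<pi> \<and> vec_scale P \<pi> ` L \<subset> L' \<and> L' \<subset> L)}"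

text \<open>The infimum of the empty set is \<open>\<infinity>\<close> in \<^typ>\<open>enat\<close>.\<close>

definition bt_dist :: "'k::field_char_0 set \<Rightarrow> 'k bt_vertex \<Rightarrow> 'k bt_vertex \<Rightarrow> enat" where
  "bt_dist P v w = (INF n\<in>{n. (v, w) \<in> bt_adj P ^^ n}. enat n)"

definition standard_apartment :: "'k::field_char_0 set \<Rightarrow> 'k bt_vertex set" where
  "standard_apartment P =
     {homothety_class P
        (carrier (completion_int P) \<times>
         (\<lambda>y. \<pi> [^]\<^bsub>completion P\<^esub> k \<otimes>\<^bsub>completion P\<^esub> y) ` carrier (completion_int P)) | \<pi> (k::int).
       uniformizer P \<pi>}"

definition standard_vertex :: "'k::field_char_0 set \<Rightarrow> 'k bt_vertex" where
  "standard_vertex P =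
     homothety_class P (carrier (completion_int P) \<times> carrier (completion_int P))"

definition side_branch :: "'k::field_char_0 set \<Rightarrow> nat \<Rightarrow> 'k bt_vertex set" where
  "side_branch P e = {v \<in> bt_vertices P.
     (INF a\<in>standard_apartment P. bt_dist P v a) \<le> enat e \<and>
     (\<forall>a\<in>standard_apartment P. a \<noteq> standard_vertex P \<longrightarrow>
        bt_dist P v (standard_vertex P) < bt_dist P v a)}"

text \<open>Matrices over the number field act on column vectors over the completion through
  \<^const>\<open>completion_embed\<close>.\<close>

definition mat_act :: "'k::field_char_0 set \<Rightarrow> 'k^2^2 \<Rightarrow> 'k compl_vec \<Rightarrow> 'k compl_vec" where
  "mat_act P A = (\<lambda>(x, y).
     (completion_embed P (A $ 1 $ 1) \<otimes>\<^bsub>completion P\<^esub> x \<oplus>\<^bsub>completion P\<^esub> completion_embed P (A $ 1 $ 2) \<otimes>\<^bsub>completion P\<^esub> y,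
      completion_embed P (A $ 2 $ 1) \<otimes>\<^bsub>completion P\<^esub> x \<oplus>\<^bsub>completion P\<^esub> completion_embed P (A $ 2 $ 2) \<otimes>\<^bsub>completion P\<^esub> y))"

definition vertex_act :: "'k::field_char_0 set \<Rightarrow> 'k^2^2 \<Rightarrow> 'k bt_vertex \<Rightarrow> 'k bt_vertex" where
  "vertex_act P A v = (`) (mat_act P A) ` v"

definition branch_product :: "nat \<Rightarrow> (nat \<Rightarrow> 'k::field_char_0 set) \<Rightarrow> (nat \<Rightarrow> nat) \<Rightarrow> (nat \<Rightarrow> 'k bt_vertex) set" where
  "branch_product r P e = (\<Pi>\<^sub>E i\<in>{1..r}. side_branch (P i) (e i))"

definition branch_orbits :: "nat \<Rightarrow> (nat \<Rightarrow> 'k::field_char_0 set) \<Rightarrow> (nat \<Rightarrow> nat) \<Rightarrow> (nat \<Rightarrow> 'k bt_vertex) set set" where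
  "branch_orbits r P e =
     orbits (units_of \<O>) (branch_product r P e)
       (\<lambda>u. \<lambda>x\<in>branch_product r P e. \<lambda>i\<in>{1..r}. vertex_act (P i) (diag2 1 u) (x i))"

end

theory Submission
  imports Defs
begin

text \<open>
  Write \<open>a = 1 - \<chi>(g\<^sub>0)\<close>. A form of \<open>\<rho>\<close> over \<open>\<O>\<close> is a free rank two lattice \<open>L\<close> in \<open>K\<^sup>2\<close> stable
  under \<open>\<rho>\<close>, and conjugacy over \<open>\<O>\<close> amounts to acting on \<open>L\<close> by diagonal matrices. Every \<open>L\<close> has the
  form \<open>{(x, y). x \<in> J, y - z x \<in> I}\<close>; it is free iff \<open>I J\<close> is principal, so after scaling
  \<open>I = J\<^sup>-\<^sup>1\<close>, where \<open>z\<close> only matters modulo \<open>J\<^sup>-\<^sup>2\<close>, and stability means \<open>a z \<in> J\<^sup>-\<^sup>2\<close>. Fixing \<open>J\<close> in its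
  ideal class, what remains is \<open>a\<^sup>-\<^sup>1 J\<^sup>-\<^sup>2 / J\<^sup>-\<^sup>2\<close>, which is isomorphic to \<open>\<O> / a\<close>, modulo the units. On the
  other side the vertices of a side branch are the classes of \<open>{(x, y). x \<in> \<O>\<^sub>P, y - z x \<in> P\<^sup>k}\<close>
  with \<open>0 \<le> k \<le> e\<close> and \<open>z\<close> a unit modulo \<open>P\<^sup>k\<close>; sending such a vertex to \<open>\<pi>\<^bsup>e - k\<^esup> z\<close> identifies
  the branch with \<open>\<O> / P\<^sup>e\<close>, so by the Chinese remainder theorem the product of the branches is
  \<open>\<O> / a\<close> as well, compatibly with the units.
\<close>

section \<open>Algebraic integers\<close>

text \<open>The arithmetic of O has one source: any d + 1 elements of K, with d the degree of K,
  satisfy a primitive integer linear relation. For the powers of one element x this makes the local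
  rings of O valuation rings; modulo a prime number it makes residue rings finite. Together they
  yield maximal ideals, invertibility and valuations.

  The obstacle in the counting is that neither side has a canonical coordinate: J is known only up
  to scaling, z only modulo J^-2, and the identification with O/a depends on an element generating
  J^-2 modulo a J^-2. So one representative and one such element are fixed per ideal class, and the
  two sides are compared through a relation, a shared residue c. Rescaling J by s divides z by s^2,
  up to a unit; once J is the fixed representative, s J = J makes s itself a unit, so the squares
  are absorbed and every class contributes the same orbits, those of the units on O/a.

  On the tree, 0 in O/P^e belongs to the standard vertex, and a nonzero residue of valuation e - k
  to a vertex at distance k from it.\<close>

interpretation Zmod: Modules.module "\<lambda>(n::int) (x::'k::field_char_0). of_int n * x"
  by unfold_locales (simp_all add: algebra_simps)

lemma int_subgroup_principal:
  fixes H :: "int set"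
  assumes "0 \<in> H" and diff: "\<And>x y. x \<in> H \<Longrightarrow> y \<in> H \<Longrightarrow> x - y \<in> H"
  shows "\<exists>h\<in>H. \<forall>x\<in>H. h dvd x"
proof (cases "H = {0}")
  case False
  have minus: "- x \<in> H" if "x \<in> H" for x
    using diff[OF assms(1) that] by simp
  have plus: "x + y \<in> H" if "x \<in> H" "y \<in> H" for x y
    using diff[OF that(1) minus[OF that(2)]] by simp
  have mult_nat: "int n * x \<in> H" if "x \<in> H" for n x
    by (induction n) (use assms(1) plus that in \<open>auto simp: algebra_simps\<close>)
  have mult: "n * x \<in> H" if "x \<in> H" for n x
    using mult_nat[OF that, of "nat n"] minus[OF mult_nat[OF that, of "nat (-n)"]]
    by (cases "n \<ge> 0") auto
  from False assms(1) obtain x where "x \<in> H" "x \<noteq> 0" by auto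
  then have "\<exists>n. n > 0 \<and> int n \<in> H"
    using minus[of x] by (intro exI[of _ "nat \<bar>x\<bar>"]) (auto simp: abs_if)
  then obtain n where n: "n > 0" "int n \<in> H" and least: "\<And>m. m < n \<Longrightarrow> \<not> (m > 0 \<and> int m \<in> H)"
    using exists_least_iff[of "\<lambda>n. n > 0 \<and> int n \<in> H"] by auto
  have "int n dvd x" if "x \<in> H" for x
  proof -
    have "x mod int n = x - x div int n * int n" by (simp add: minus_div_mult_eq_mod)
    then have "x mod int n \<in> H" using diff[OF that mult[OF n(2)]] by simp
    moreover have "0 \<le> x mod int n" "x mod int n < int n" using n by auto
    ultimately have "nat (x mod int n) = 0"
      using least[of "nat (x mod int n)"] by (metis int_nat_eq not_gr_zero zless_nat_conj nat_int nat_less_iff)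
    then show ?thesis using \<open>0 \<le> x mod int n\<close> by auto
  qed
  then show ?thesis using n by auto
qed auto

text \<open>Noetherianity of the integers, by induction on the generators: the coefficients that
  elements of G have at the new generator form a subgroup of the integers, and after adjoining an
  element with the generating coefficient only the part of G in the smaller span is left.\<close>

lemma Zmod_subspace_fg:
  fixes G :: "'k::field_char_0 set"
  assumes "finite B" "Zmod.subspace G" "G \<subseteq> Zmod.span B"
  shows "\<exists>S. finite S \<and> G = Zmod.span S"
  using assms
proof (induction B arbitrary: G rule: finite_induct)
  case empty
  then show ?case
    by (intro exI[of _ "{}"]) (use Zmod.subspace_0 in auto)
next
  case (insert b B)
  \<comment> \<open>Coefficients need not be unique when b depends on B; all possible ones are
    collected, which still gives a subgroup.\<close>
  define H where "H = {n. \<exists>g\<in>G. g - of_int n * b \<in> Zmod.span B}"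
  have "\<exists>h\<in>H. \<forall>n\<in>H. h dvd n"
  proof (rule int_subgroup_principal)
    show "0 \<in> H"
      using Zmod.subspace_0[OF insert.prems(1)] Zmod.span_zero by (auto simp: H_def)
    fix m n assume "m \<in> H" "n \<in> H"
    then obtain g g' where g: "g \<in> G" "g - of_int m * b \<in> Zmod.span B"
      "g' \<in> G" "g' - of_int n * b \<in> Zmod.span B" by (auto simp: H_def)
    have "(g - g') - of_int (m - n) * b \<in> Zmod.span B"
      using Zmod.span_diff[OF g(2) g(4)] by (simp add: algebra_simps)
    then show "m - n \<in> H"
      using Zmod.subspace_diff[OF insert.prems(1) g(1) g(3)] unfolding H_def by blast
  qed
  then obtain h where h: "h \<in> H" "\<And>n. n \<in> H \<Longrightarrow> h dvd n" by blast
  then obtain g0 where g0: "g0 \<in> G" "g0 - of_int h * b \<in> Zmod.span B"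
    by (auto simp: H_def)
  have "\<exists>S. finite S \<and> G \<inter> Zmod.span B = Zmod.span S"
    by (rule insert.IH) (auto intro: Zmod.subspace_inter insert.prems)
  then obtain S where S: "finite S" "G \<inter> Zmod.span B = Zmod.span S" by blast
  have "G = Zmod.span (insert g0 S)"
  proof
    show "Zmod.span (insert g0 S) \<subseteq> G"
      using S(2) Zmod.span_superset[of S] g0(1) insert.prems(1)
      by (intro Zmod.span_minimal) auto
    show "G \<subseteq> Zmod.span (insert g0 S)"
    proof
      fix g assume "g \<in> G"
      then have "g \<in> Zmod.span (insert b B)" using insert.prems(2) by auto
      then obtain n where n: "g - of_int n * b \<in> Zmod.span B"
        unfolding Zmod.span_breakdown_eq by blast
      then have "n \<in> H" using \<open>g \<in> G\<close> by (auto simp: H_def)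
      then obtain k where k: "n = h * k" using h(2) by (auto elim: dvdE)
      have "g - of_int k * g0 \<in> Zmod.span B"
        using Zmod.span_diff[OF n Zmod.span_scale[OF g0(2), of k]]
        by (simp add: k algebra_simps)
      moreover have "g - of_int k * g0 \<in> G"
        using \<open>g \<in> G\<close> g0(1) insert.prems(1)
        by (intro Zmod.subspace_diff Zmod.subspace_scale) auto
      ultimately show "g \<in> Zmod.span (insert g0 S)"
        using S(2) by (auto simp: Zmod.span_breakdown_eq)
    qed
  qed
  then show ?case using S(1) by blast
qed

lemma powers_span_subset:
  fixes x :: "'k::field_char_0"
  assumes "m \<le> n"
  shows "Zmod.span ((\<lambda>i. x ^ i) ` {..<m}) \<subseteq> Zmod.span ((\<lambda>i. x ^ i) ` {..<n})"
  using assms by (intro Zmod.span_mono) auto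

lemma power_in_span_imp_algebraic_int:
  fixes x :: "'k::field_char_0"
  assumes "x ^ n \<in> Zmod.span ((\<lambda>i. x ^ i) ` {..<n})"
  shows "algebraic_int x"
proof -
  \<comment> \<open>Members of the span are values at x of integer polynomials of degree below n;
    subtracting one from X^n leaves a monic polynomial.\<close>
  have "\<exists>p. (\<forall>i. poly.coeff p i \<in> \<int>) \<and> (\<forall>i\<ge>n. poly.coeff p i = 0) \<and> poly p x = y"
    if "y \<in> Zmod.span ((\<lambda>i. x ^ i) ` {..<n})" for y
    using that
  proof (induction rule: Zmod.span_induct_alt)
    case base
    show ?case by (intro exI[of _ 0]) simp
  next
    case (step c y z)
    then obtain p i where "\<forall>i. poly.coeff p i \<in> \<int>" "\<forall>i\<ge>n. poly.coeff p i = 0" "poly p x = z" 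
      and i: "i < n" "y = x ^ i" by auto
    then show ?case
      by (intro exI[of _ "Polynomial.monom (of_int c) i + p"]) (auto simp: poly_monom)
  qed
  from this[OF assms] obtain p where p: "\<forall>i. poly.coeff p i \<in> \<int>" "\<forall>i\<ge>n. poly.coeff p i = 0" "poly p x = x ^ n"
    by blast
  define q where "q = Polynomial.monom 1 n - p"
  have cq: "poly.coeff q i = (if i = n then 1 else - poly.coeff p i)" for i
    using p(2) by (auto simp: q_def)
  have "Polynomial.degree q = n"
  proof (rule antisym)
    show "Polynomial.degree q \<le> n" by (rule degree_le) (use p(2) in \<open>auto simp: cq\<close>)
    show "n \<le> Polynomial.degree q" by (rule le_degree) (simp add: cq)
  qed
  then have "poly.coeff q (Polynomial.degree q) = 1" by (simp add: cq)
  moreover have "poly q x = 0" using p(3) by (simp add: q_def poly_monom)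
  moreover have "\<forall>i. poly.coeff q i \<in> \<int>" using p(1) by (auto simp: cq)
  ultimately show ?thesis by (intro algebraic_int.intros[of q])
qed

lemma algebraic_int_imp_power_in_span:
  fixes x :: "'k::field_char_0"
  assumes "algebraic_int x"
  obtains n where "n > 0" "x ^ n \<in> Zmod.span ((\<lambda>i. x ^ i) ` {..<n})"
proof -
  from assms obtain p where p: "poly.coeff p (Polynomial.degree p) = 1" "\<forall>i. poly.coeff p i \<in> \<int>" "poly p x = 0"
    by (auto elim: algebraic_int.cases)
  define n where "n = Polynomial.degree p"
  \<comment> \<open>A monic constant polynomial is 1 and has no root. Positivity of n is what later
    puts 1 = x^0 among the lower powers.\<close>
  have n: "n > 0"
  proof (rule ccontr)
    assume "\<not> n > 0"
    then have "p = [:poly.coeff p 0:]" by (auto simp: n_def elim: degree_eq_zeroE)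
    then show False using p(1,3) by (metis poly_0 poly_pCons degree_pCons_0 coeff_pCons_0 one_neq_zero mult_zero_right add.right_neutral)
  qed
  have "0 = (\<Sum>i\<le>n. poly.coeff p i * x ^ i)" using p(3) by (simp add: poly_altdef n_def)
  also have "\<dots> = (\<Sum>i<n. poly.coeff p i * x ^ i) + x ^ n"
    using p(1) by (simp add: n_def lessThan_Suc_atMost[symmetric])
  finally have "x ^ n = - (\<Sum>i<n. poly.coeff p i * x ^ i)" by (simp add: eq_neg_iff_add_eq_0 add.commute)
  moreover have "poly.coeff p i * x ^ i \<in> Zmod.span ((\<lambda>i. x ^ i) ` {..<n})" if "i < n" for i
  proof -
    from p(2) obtain c where "poly.coeff p i = of_int c" by (metis Ints_cases)
    then show ?thesis using that Zmod.span_scale[OF Zmod.span_base, of "x ^ i" _ c] by auto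
  qed
  ultimately show ?thesis
    using that[OF n] by (auto intro!: Zmod.span_neg Zmod.span_sum)
qed

text \<open>Noetherianity takes the place of the usual determinant argument: all powers of x lie in
  \<open>Zmod.span B\<close>, so their span is finitely generated, its generators involve only
  powers below some n, and then x^n is a combination of lower powers.\<close>

lemma stable_imp_algebraic_int:
  fixes x :: "'k::field_char_0"
  assumes "finite B" "1 \<in> Zmod.span B" and stab: "\<And>b. b \<in> B \<Longrightarrow> x * b \<in> Zmod.span B"
  shows "algebraic_int x"
proof -
  have mult: "x * y \<in> Zmod.span B" if "y \<in> Zmod.span B" for y
    using that
  proof (induction rule: Zmod.span_induct_alt)
    case (step c y z)
    then show ?case
      using Zmod.span_add[OF Zmod.span_scale[OF stab[OF step(1)], of c] step(2)]
      by (simp add: algebra_simps)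
  qed (simp add: Zmod.span_zero)
  have pow: "x ^ i \<in> Zmod.span B" for i
    by (induction i) (use assms(2) mult in auto)
  have "\<exists>S. finite S \<and> Zmod.span (range (\<lambda>i. x ^ i)) = Zmod.span S"
    using pow by (intro Zmod_subspace_fg[OF assms(1)] Zmod.span_minimal) auto
  then obtain S where S: "finite S" "Zmod.span (range (\<lambda>i. x ^ i)) = Zmod.span S" by blast
  have ex: "\<exists>n. y \<in> Zmod.span ((\<lambda>i. x ^ i) ` {..<n})" if "y \<in> Zmod.span (range (\<lambda>i. x ^ i))" for y
    using that
  proof (induction rule: Zmod.span_induct_alt)
    case (step c y z)
    then obtain i n where "y = x ^ i" "z \<in> Zmod.span ((\<lambda>i. x ^ i) ` {..<n})" by auto
    then show ?case
      using powers_span_subset[of n "max n (Suc i)" x]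
      by (intro exI[of _ "max n (Suc i)"] Zmod.span_add Zmod.span_scale)
         (auto intro: Zmod.span_base)
  qed (auto intro: Zmod.span_zero)
  have "\<exists>n. S \<subseteq> Zmod.span ((\<lambda>i. x ^ i) ` {..<n})"
  proof -
    have "\<forall>s\<in>S. \<exists>n. s \<in> Zmod.span ((\<lambda>i. x ^ i) ` {..<n})"
      using ex S(2) Zmod.span_superset[of S] by auto
    then obtain f where f: "\<And>s. s \<in> S \<Longrightarrow> s \<in> Zmod.span ((\<lambda>i. x ^ i) ` {..<f s})" by metis
    have "s \<in> Zmod.span ((\<lambda>i. x ^ i) ` {..<Max (f ` S)})" if "s \<in> S" for s
      using f[OF that] powers_span_subset[of "f s" "Max (f ` S)" x] that S(1) by auto
    then show ?thesis by blast
  qed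
  then obtain n where "S \<subseteq> Zmod.span ((\<lambda>i. x ^ i) ` {..<n})" by blast
  then have "Zmod.span S \<subseteq> Zmod.span ((\<lambda>i. x ^ i) ` {..<n})" by (intro Zmod.span_minimal) auto
  moreover have "x ^ n \<in> Zmod.span S" unfolding S(2)[symmetric] by (intro Zmod.span_base) auto
  ultimately show ?thesis by (intro power_in_span_imp_algebraic_int) auto
qed

text \<open>The finitely many products x^i y^j below the degrees of the two relations span a group
  stable under x and under y, hence under x + y and x y.\<close>

lemma
  fixes x y :: "'k::field_char_0"
  assumes "algebraic_int x" "algebraic_int y"
  shows algebraic_int_add: "algebraic_int (x + y)" and algebraic_int_mult: "algebraic_int (x * y)"
proof -
  obtain m where m: "m > 0" "x ^ m \<in> Zmod.span ((\<lambda>i. x ^ i) ` {..<m})"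
    using algebraic_int_imp_power_in_span[OF assms(1)] by blast
  obtain n where n: "n > 0" "y ^ n \<in> Zmod.span ((\<lambda>i. y ^ i) ` {..<n})"
    using algebraic_int_imp_power_in_span[OF assms(2)] by blast
  define B where "B = (\<lambda>(i, j). x ^ i * y ^ j) ` ({..<m} \<times> {..<n})"
  have B: "x ^ i * y ^ j \<in> Zmod.span B" if "i < m" "j < n" for i j
    using that by (intro Zmod.span_base) (auto simp: B_def image_iff)
  have 1: "z * y ^ j \<in> Zmod.span B" if "z \<in> Zmod.span ((\<lambda>i. x ^ i) ` {..<m})" "j < n" for z j
    using that(1)
  proof (induction rule: Zmod.span_induct_alt)
    case (step c u w)
    then obtain i where i: "i < m" "u = x ^ i" by auto
    show ?case
      using Zmod.span_add[OF Zmod.span_scale[OF B[OF i(1) that(2)], of c] step(2)] i(2)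
      by (simp add: algebra_simps)
  qed (simp add: Zmod.span_zero)
  have 2: "x ^ i * z \<in> Zmod.span B" if "z \<in> Zmod.span ((\<lambda>i. y ^ i) ` {..<n})" "i < m" for z i
    using that(1)
  proof (induction rule: Zmod.span_induct_alt)
    case (step c u w)
    then obtain j where j: "j < n" "u = y ^ j" by auto
    show ?case
      using Zmod.span_add[OF Zmod.span_scale[OF B[OF that(2) j(1)], of c] step(2)] j(2)
      by (simp add: algebra_simps)
  qed (simp add: Zmod.span_zero)
  have x: "x * b \<in> Zmod.span B" if "b \<in> B" for b
  proof -
    from that obtain i j where ij: "i < m" "j < n" "b = x ^ i * y ^ j" by (auto simp: B_def)
    have "x ^ Suc i * y ^ j \<in> Zmod.span B"
    proof (cases "Suc i = m")
      case False
      then show ?thesis using ij by (intro B) auto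
    qed (use 1 m ij in auto)
    then show ?thesis by (simp add: ij mult_ac)
  qed
  have y: "y * b \<in> Zmod.span B" if "b \<in> B" for b
  proof -
    from that obtain i j where ij: "i < m" "j < n" "b = x ^ i * y ^ j" by (auto simp: B_def)
    have "x ^ i * y ^ Suc j \<in> Zmod.span B"
    proof (cases "Suc j = n")
      case False
      then show ?thesis using ij by (intro B) auto
    qed (use 2 n ij in auto)
    then show ?thesis by (simp add: ij mult_ac)
  qed
  have xx: "x * z \<in> Zmod.span B" if "z \<in> Zmod.span B" for z
    using that
  proof (induction rule: Zmod.span_induct_alt)
    case (step c u w)
    show ?case using Zmod.span_add[OF Zmod.span_scale[OF x[OF step(1)], of c] step(2)]
      by (simp add: algebra_simps)
  qed (simp add: Zmod.span_zero)
  have fin: "finite B" and one: "1 \<in> Zmod.span B" using B[of 0 0] m n by (auto simp: B_def)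
  show "algebraic_int (x + y)"
    by (rule stable_imp_algebraic_int[OF fin one])
       (use Zmod.span_add[OF x y] in \<open>simp add: algebra_simps\<close>)
  show "algebraic_int (x * y)"
    by (rule stable_imp_algebraic_int[OF fin one]) (use xx[OF y] in \<open>simp add: mult_ac\<close>)
qed

lemma algebraic_int_of_int_field [simp]: "algebraic_int (of_int n :: 'k::field_char_0)"
  by (rule int_imp_algebraic_int) auto

lemma algebraic_int_one_field [simp]: "algebraic_int (1 :: 'k::field_char_0)"
  by (rule int_imp_algebraic_int) auto

lemma algebraic_int_diff:
  fixes x y :: "'k::field_char_0"
  shows "algebraic_int x \<Longrightarrow> algebraic_int y \<Longrightarrow> algebraic_int (x - y)"
  using algebraic_int_add[of x "- y"] by simp

lemma algebraic_int_power:
  fixes x :: "'k::field_char_0"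
  shows "algebraic_int x \<Longrightarrow> algebraic_int (x ^ n)"
  by (induction n) (auto intro: algebraic_int_mult)

lemma algebraic_int_sum:
  fixes f :: "'i \<Rightarrow> 'k::field_char_0"
  shows "(\<And>i. i \<in> A \<Longrightarrow> algebraic_int (f i)) \<Longrightarrow> algebraic_int (sum f A)"
  by (induction A rule: infinite_finite_induct) (auto intro: algebraic_int_add)

lemma algebraic_int_prod:
  fixes f :: "'i \<Rightarrow> 'k::field_char_0"
  shows "(\<And>i. i \<in> A \<Longrightarrow> algebraic_int (f i)) \<Longrightarrow> algebraic_int (prod f A)"
  by (induction A rule: infinite_finite_induct) (auto intro: algebraic_int_mult)

text \<open>The Horner sums of a relation c_n x^n + ... + c_0 = 0 are integral even though x need
  not be. Multiplication by such a sum maps the span of 1, ..., x^(n-1) into itself: for i < j the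
  exponents stay below n, and for i \<ge> j the relation trades the upper part of the sum for minus
  the lower part, whose exponents are again small.\<close>

lemma algebraic_int_partial_relation:
  fixes x :: "'k::field_char_0"
  assumes rel: "(\<Sum>i\<le>n. of_int (c i) * x ^ i) = 0" and "j \<le> n"
  shows "algebraic_int (\<Sum>l=j..n. of_int (c l) * x ^ (l - j))" (is "algebraic_int ?b")
proof (cases "n = 0")
  case True
  then show ?thesis using assms by simp
next
  case False
  define B where "B = (\<lambda>i. x ^ i) ` {..<n}"
  have B: "of_int k * x ^ i \<in> Zmod.span B" if "i < n" for k i
    using that by (intro Zmod.span_scale Zmod.span_base) (auto simp: B_def)
  have "?b * x ^ i \<in> Zmod.span B" if "i < n" for i
  proof (cases "i < j")
    case True
    have "?b * x ^ i = (\<Sum>l=j..n. of_int (c l) * x ^ (l - j + i))"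
      unfolding sum_distrib_right power_add by (simp add: mult.assoc)
    also have "\<dots> \<in> Zmod.span B" using True assms(2) by (intro Zmod.span_sum B) auto
    finally show ?thesis .
  next
    case False
    have "?b * x ^ i = x ^ (i - j) * (\<Sum>l=j..n. of_int (c l) * x ^ l)"
      unfolding sum_distrib_left sum_distrib_right
    proof (rule sum.cong)
      fix l assume "l \<in> {j..n}"
      then have "x ^ (l - j) * x ^ i = x ^ (i - j) * x ^ l"
        using False by (simp flip: power_add add: add.commute)
      then show "of_int (c l) * x ^ (l - j) * x ^ i = x ^ (i - j) * (of_int (c l) * x ^ l)"
        by (simp add: mult_ac)
    qed auto
    also have "(\<Sum>l=j..n. of_int (c l) * x ^ l) = - (\<Sum>l<j. of_int (c l) * x ^ l)"
    proof -
      have "{..n} = {..<j} \<union> {j..n}" using assms(2) by auto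
      then have "(\<Sum>i\<le>n. of_int (c i) * x ^ i) = (\<Sum>l<j. of_int (c l) * x ^ l) + (\<Sum>l=j..n. of_int (c l) * x ^ l)"
        by (simp add: sum.union_disjoint ivl_disj_int)
      then show ?thesis using rel by (simp add: eq_neg_iff_add_eq_0 add.commute)
    qed
    also have "x ^ (i - j) * - (\<Sum>l<j. of_int (c l) * x ^ l) = (\<Sum>l<j. of_int (- c l) * x ^ (i - j + l))"
      by (simp add: sum_distrib_left sum_negf power_add mult_ac)
    also have "\<dots> \<in> Zmod.span B" using False that by (intro Zmod.span_sum B) auto
    finally show ?thesis .
  qed
  moreover have "1 \<in> Zmod.span B" using B[of 0 1] False by simp
  ultimately show ?thesis
    by (intro stable_imp_algebraic_int[of B]) (auto simp: B_def)
qed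

section \<open>Integer relations in a number field\<close>

locale number_field_type =
  fixes K :: "'k::field_char_0 itself"
  assumes number_field: "number_field K"
begin

lemma integer_relation:
  "\<exists>d. \<forall>f::nat \<Rightarrow> 'k. \<exists>c::nat \<Rightarrow> int. (\<exists>i\<le>d. c i \<noteq> 0) \<and> (\<Sum>i\<le>d. of_int (c i) * f i) = 0"
proof -
  obtain B where "finite_dimensional_vector_space (\<lambda>(q::rat) (x::'k). of_rat q * x) B"
    using number_field unfolding number_field_def by blast
  then interpret Q: finite_dimensional_vector_space "\<lambda>(q::rat) (x::'k). of_rat q * x" B .
  show ?thesis
  proof (intro exI[of _ Q.dimension] allI)
    fix f :: "nat \<Rightarrow> 'k"
    let ?d = Q.dimension
    show "\<exists>c::nat \<Rightarrow> int. (\<exists>i\<le>?d. c i \<noteq> 0) \<and> (\<Sum>i\<le>?d. of_int (c i) * f i) = 0"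
    \<comment> \<open>Linear dependence speaks of sets, so a repeated value of f is handled apart,
      with coefficients 1 and -1.\<close>
    proof (cases "inj_on f {..?d}")
      case False
      then obtain i j where ij: "i \<le> ?d" "j \<le> ?d" "i \<noteq> j" "f i = f j"
        by (auto simp: inj_on_def)
      define c :: "nat \<Rightarrow> int" where "c = (\<lambda>k. if k = i then 1 else if k = j then -1 else 0)"
      have "(\<Sum>k\<le>?d. of_int (c k) * f k) = (\<Sum>k\<in>{i, j}. of_int (c k) * f k)"
        by (rule sum.mono_neutral_right) (use ij in \<open>auto simp: c_def\<close>)
      also have "\<dots> = 0" using ij by (simp add: c_def)
      finally show ?thesis using ij by (intro exI[of _ c]) (auto simp: c_def)
    next
      case True
      have "card (f ` {..?d}) > Q.dimension" using True by (simp add: card_image)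
      then have "Q.dependent (f ` {..?d})"
        using Q.dim_subset_UNIV[of "f ` {..?d}"] by (intro Q.dependent_biggerset_general) auto
      then obtain u where u: "\<exists>v\<in>f ` {..?d}. u v \<noteq> 0" "(\<Sum>v\<in>f ` {..?d}. of_rat (u v) * v) = 0"
        by (auto simp: Q.dependent_finite)
      define q where "q = (\<lambda>i. u (f i))"
      have q: "\<exists>i\<le>?d. q i \<noteq> 0" "(\<Sum>i\<le>?d. of_rat (q i) * f i) = 0"
        using u True by (auto simp: q_def sum.reindex)
      define D where "D = (\<Prod>i\<le>?d. snd (quotient_of (q i)))"
      have D: "D \<noteq> 0" using quotient_of_denom_pos' by (auto simp: D_def less_le)
      have "\<exists>n::int. of_int D * q i = of_int n" if "i \<le> ?d" for i
      proof -
        obtain a b where ab: "quotient_of (q i) = (a, b)" by force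
        then have "b dvd D" using that unfolding D_def by (intro dvd_prodI[of "{..?d}" i "\<lambda>i. snd (quotient_of (q i))", simplified, THEN dvd_trans[rotated]]) auto
        then obtain k where "D = b * k" by auto
        then show ?thesis
          using quotient_of_div[OF ab] quotient_of_denom_pos[OF ab]
          by (intro exI[of _ "k * a"]) simp
      qed
      then obtain c where c: "\<And>i. i \<le> ?d \<Longrightarrow> of_int D * q i = of_int (c i)" by metis
      have eq: "of_int (c i) * f i = of_int D * (of_rat (q i) * f i)" if "i \<le> ?d" for i
        using arg_cong[OF c[OF that], of "of_rat :: rat \<Rightarrow> 'k"] by (simp add: of_rat_mult)
      have "(\<Sum>i\<le>?d. of_int (c i) * f i) = of_int D * (\<Sum>i\<le>?d. of_rat (q i) * f i)"
        unfolding sum_distrib_left by (rule sum.cong) (use eq in auto)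
      moreover have "\<exists>i\<le>?d. c i \<noteq> 0"
        using q(1) c D by (metis mult_eq_0_iff of_int_0 of_int_eq_0_iff)
      ultimately show ?thesis using q(2) by auto
    qed
  qed
qed

text \<open>Primitivity is the form in which relations are used: the coefficients cannot all lie in
  a proper ideal, nor all be divisible by a prime number.\<close>

lemma primitive_integer_relation:
  "\<exists>d. \<forall>f::nat \<Rightarrow> 'k. \<exists>c::nat \<Rightarrow> int.
     (\<forall>h. (\<forall>i\<le>d. h dvd c i) \<longrightarrow> is_unit h) \<and> (\<Sum>i\<le>d. of_int (c i) * f i) = 0"
proof -
  obtain d where d: "\<And>f::nat \<Rightarrow> 'k. \<exists>c::nat \<Rightarrow> int. (\<exists>i\<le>d. c i \<noteq> 0) \<and> (\<Sum>i\<le>d. of_int (c i) * f i) = 0"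
    using integer_relation by blast
  show ?thesis
  proof (intro exI[of _ d] allI)
    fix f :: "nat \<Rightarrow> 'k"
    obtain c :: "nat \<Rightarrow> int" where c: "\<exists>i\<le>d. c i \<noteq> 0" "(\<Sum>i\<le>d. of_int (c i) * f i) = 0"
      using d by blast
    define g where "g = Gcd (c ` {..d})"
    have g: "g \<noteq> 0" using c(1) by (auto simp: g_def)
    have "g dvd c i" if "i \<le> d" for i using that by (auto simp: g_def)
    then have ci: "c i = g * (c i div g)" if "i \<le> d" for i using that by simp
    have unit: "is_unit h" if "\<forall>i\<le>d. h dvd c i div g" for h
    proof -
      have "g * h dvd c i" if "i \<le> d" for i
        using ci[OF that] \<open>\<forall>i\<le>d. h dvd c i div g\<close> that by (metis dvd_refl mult_dvd_mono)
      then have "g * h dvd g" unfolding g_def by (intro Gcd_greatest) auto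
      then show ?thesis using g by simp
    qed
    have zero: "(\<Sum>i\<le>d. of_int (c i div g) * f i) = 0"
    proof -
      have "of_int g * (\<Sum>i\<le>d. of_int (c i div g) * f i) = (\<Sum>i\<le>d. of_int (g * (c i div g)) * f i)"
        by (simp only: sum_distrib_left of_int_mult mult.assoc)
      also have "\<dots> = (\<Sum>i\<le>d. of_int (c i) * f i)"
        by (rule sum.cong[OF refl]) (simp only: ci[symmetric] atMost_iff)
      finally show ?thesis using c(2) g by simp
    qed
    show "\<exists>c::nat \<Rightarrow> int.
     (\<forall>h. (\<forall>i\<le>d. h dvd c i) \<longrightarrow> is_unit h) \<and> (\<Sum>i\<le>d. of_int (c i) * f i) = 0"
      by (intro exI[of _ "\<lambda>i. c i div g"] conjI allI impI zero) (rule unit)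
  qed
qed

end

section \<open>Ideals and their inverses\<close>

text \<open>Submodules of the whole field, so that fractional ideals are covered; finite generation
  enters through invertibility.\<close>

definition o_module :: "'k::field_char_0 set \<Rightarrow> bool" where
  "o_module M \<longleftrightarrow> 0 \<in> M \<and> (\<forall>x\<in>M. \<forall>y\<in>M. x + y \<in> M) \<and> (\<forall>c x. algebraic_int c \<longrightarrow> x \<in> M \<longrightarrow> c * x \<in> M)"

definition o_ideal :: "'k::field_char_0 set \<Rightarrow> bool" where
  "o_ideal I \<longleftrightarrow> o_module I \<and> (\<forall>x\<in>I. algebraic_int x)"

lemma o_module_0: "o_module M \<Longrightarrow> 0 \<in> M"
  and o_module_add: "o_module M \<Longrightarrow> x \<in> M \<Longrightarrow> y \<in> M \<Longrightarrow> x + y \<in> M"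
  and o_module_mult: "o_module M \<Longrightarrow> algebraic_int c \<Longrightarrow> x \<in> M \<Longrightarrow> c * x \<in> M"
  by (auto simp: o_module_def)

lemma o_module_mult': "o_module M \<Longrightarrow> algebraic_int c \<Longrightarrow> x \<in> M \<Longrightarrow> x * c \<in> M"
  using o_module_mult[of M c x] by (simp add: mult.commute)

lemma o_module_minus: "o_module M \<Longrightarrow> x \<in> M \<Longrightarrow> - x \<in> M"
  using o_module_mult[of M "-1" x] by simp

lemma o_module_diff: "o_module M \<Longrightarrow> x \<in> M \<Longrightarrow> y \<in> M \<Longrightarrow> x - y \<in> M"
  using o_module_add[of M x "- y"] o_module_minus by auto

lemma o_module_sum: "o_module M \<Longrightarrow> (\<And>i. i \<in> A \<Longrightarrow> f i \<in> M) \<Longrightarrow> sum f A \<in> M"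
  by (induction A rule: infinite_finite_induct) (auto intro: o_module_add o_module_0)

lemma o_ideal_1_eq: "o_ideal I \<Longrightarrow> 1 \<in> I \<Longrightarrow> I = {x. algebraic_int x}"
  using o_module_mult[of I _ 1] by (auto simp: o_ideal_def)

text \<open>The zero ideal counts as prime here; a place requires \<open>P_nonzero\<close> in
  addition.\<close>

definition o_prime :: "'k::field_char_0 set \<Rightarrow> bool" where
  "o_prime P \<longleftrightarrow> o_ideal P \<and> 1 \<notin> P \<and> (\<forall>x y. algebraic_int x \<longrightarrow> algebraic_int y \<longrightarrow> x * y \<in> P \<longrightarrow> x \<in> P \<or> y \<in> P)"

context number_field_type
begin

text \<open>For prime Q this says that the localization at Q is a valuation ring. In a primitive
  relation for x the Horner sums satisfy b_j = c_j + x b_(j+1), and some c_j lies outside Q. Then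
  b_j and x b_(j+1) cannot both lie in Q, and whichever of b_(j+1), x b_(j+1), b_j is found outside
  Q serves as s.\<close>

lemma locally_integral_or_inverse:
  fixes x :: 'k
  assumes "o_ideal Q" "1 \<notin> Q" "x \<noteq> 0"
  shows "\<exists>s. algebraic_int s \<and> s \<notin> Q \<and> (algebraic_int (s * x) \<or> algebraic_int (s / x))"
proof -
  obtain n and c :: "nat \<Rightarrow> int" where prim: "\<And>h. (\<And>i. i \<le> n \<Longrightarrow> h dvd c i) \<Longrightarrow> is_unit h"
    and rel: "(\<Sum>i\<le>n. of_int (c i) * x ^ i) = 0"
    using primitive_integer_relation by metis
  have Q: "o_module Q" using assms(1) by (simp add: o_ideal_def)
  define b where "b = (\<lambda>j. \<Sum>l=j..n. of_int (c l) * x ^ (l - j))"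
  have b_int: "algebraic_int (b j)" for j
    using algebraic_int_partial_relation[OF rel, of j] by (cases "j \<le> n") (auto simp: b_def)
  have b_Suc: "b j = of_int (c j) + x * b (Suc j)" if "j \<le> n" for j
  proof -
    have "{j..n} = insert j {Suc j..n}" using that by auto
    then have "b j = of_int (c j) + (\<Sum>l=Suc j..n. of_int (c l) * x ^ (l - j))"
      by (simp add: b_def)
    also have "(\<Sum>l=Suc j..n. of_int (c l) * x ^ (l - j)) = x * b (Suc j)"
      unfolding b_def sum_distrib_left
    proof (rule sum.cong[OF refl])
      fix l assume "l \<in> {Suc j..n}"
      then have "l - j = Suc (l - Suc j)" by auto
      then show "of_int (c l) * x ^ (l - j) = x * (of_int (c l) * x ^ (l - Suc j))"
        by (simp only: power_Suc mult.left_commute)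
    qed
    finally show ?thesis .
  qed
  have "\<exists>j\<le>n. of_int (c j) \<notin> Q"
  proof (rule ccontr)
    assume "\<not> ?thesis"
    then have all: "of_int (c j) \<in> Q" if "j \<le> n" for j using that by auto
    \<comment> \<open>The rational integers in Q form a principal subgroup; if it contained all
      coefficients, primitivity would put 1 into Q.\<close>
    have "\<exists>h\<in>{m. of_int m \<in> Q}. \<forall>m\<in>{m. of_int m \<in> Q}. h dvd m"
      by (rule int_subgroup_principal) (use Q in \<open>auto intro: o_module_0 o_module_diff\<close>)
    then obtain h where h: "of_int h \<in> Q" "\<And>m. of_int m \<in> Q \<Longrightarrow> h dvd m" by auto
    then have "is_unit h" using prim all by blast
    then have "of_int h * of_int h = (1::'k)" by (auto simp: zdvd1_eq abs_if split: if_splits)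
    then show False using o_module_mult[OF Q algebraic_int_of_int_field h(1), of h] assms(2) by simp
  qed
  then obtain j where j: "j \<le> n" "of_int (c j) \<notin> Q" by blast
  show ?thesis
  proof (cases "b (Suc j) \<in> Q")
    case False
    have "algebraic_int (b j - of_int (c j))" by (intro algebraic_int_diff b_int) auto
    then have "algebraic_int (b (Suc j) * x)" using b_Suc[OF j(1)] by (simp add: mult.commute)
    then show ?thesis using False b_int by blast
  next
    case True
    show ?thesis
    proof (cases "b j \<in> Q")
      case True
      have x: "x * b (Suc j) = b j - of_int (c j)" using b_Suc[OF j(1)] by simp
      have "x * b (Suc j) \<notin> Q"
        using o_module_diff[OF Q True, of "b j - of_int (c j)"] j(2) x by auto
      moreover have "algebraic_int (x * b (Suc j))"
        unfolding x by (intro algebraic_int_diff b_int) auto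
      ultimately show ?thesis using assms(3) b_int by (intro exI[of _ "x * b (Suc j)"]) auto
    next
      case F: False
      show ?thesis
      proof (cases "j = 0")
        case True
        \<comment> \<open>The full sum b_0 is the relation itself, hence 0; for j > 0 the recursion
          one step lower gives x b_j = b_(j-1) - c_(j-1).\<close>
        then have "b j = 0" using rel by (simp add: b_def atMost_atLeast0)
        then show ?thesis using F o_module_0[OF Q] by simp
      next
        case False
        have "algebraic_int (b (j - 1) - of_int (c (j - 1)))" by (intro algebraic_int_diff b_int) auto
        then have "algebraic_int (b j * x)" using b_Suc[of "j - 1"] j(1) False by (simp add: mult.commute)
        then show ?thesis using F b_int by blast
      qed
    qed
  qed
qed

end

section \<open>Finite residue rings and the ideals containing a given element\<close>

context number_field_type
begin

text \<open>O/p has dimension at most d over the field with p elements: among d + 1 integers a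
  primitive relation is already nontrivial modulo p. The residues are the combinations, with
  coefficients from 0 to p - 1, of a family of maximal length that is independent modulo p.\<close>

lemma finite_residues_prime:
  fixes p :: int
  assumes p: "Factorial_Ring.prime p"
  shows "\<exists>S::'k set. finite S \<and> (\<forall>y. algebraic_int y \<longrightarrow> (\<exists>s\<in>S. \<exists>t. algebraic_int t \<and> y - s = of_int p * t))"
proof -
  \<comment> \<open>Independence of the first k terms of f over the field with p elements, inside
    O/p.\<close>
  define indep where "indep = (\<lambda>k (f::nat \<Rightarrow> 'k). (\<forall>i<k. algebraic_int (f i)) \<and>
    (\<forall>c::nat \<Rightarrow> int. (\<exists>t. algebraic_int t \<and> (\<Sum>i<k. of_int (c i) * f i) = of_int p * t) \<longrightarrow> (\<forall>i<k. p dvd c i)))"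
  obtain d where d: "\<forall>f::nat \<Rightarrow> 'k. \<exists>c::nat \<Rightarrow> int.
     (\<forall>h. (\<forall>i\<le>d. h dvd c i) \<longrightarrow> is_unit h) \<and> (\<Sum>i\<le>d. of_int (c i) * f i) = 0"
    using primitive_integer_relation by (rule exE)
  have "\<not> indep (Suc d) f" for f
  proof
    assume ind: "indep (Suc d) f"
    obtain c :: "nat \<Rightarrow> int" where c: "\<forall>h. (\<forall>i\<le>d. h dvd c i) \<longrightarrow> is_unit h" "(\<Sum>i\<le>d. of_int (c i) * f i) = 0"
      using d[rule_format, of f] by (elim exE conjE)
    have "\<exists>t. algebraic_int t \<and> (\<Sum>i<Suc d. of_int (c i) * f i) = of_int p * t"
      by (intro exI[of _ 0]) (simp add: lessThan_Suc_atMost c(2))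
    then have "\<forall>i<Suc d. p dvd c i"
      using ind unfolding indep_def by blast
    then have "is_unit p" using c(1) by auto
    then show False using p by auto
  qed
  moreover have "indep 0 f" for f by (simp add: indep_def)
  moreover have "\<exists>f. indep k f" if "\<And>k. (\<exists>f. indep k f) \<Longrightarrow> \<exists>f. indep (Suc k) f" for k
    by (induction k) (use that \<open>\<And>f. indep 0 f\<close> in blast)+
  ultimately have "\<exists>k. (\<exists>f. indep k f) \<and> \<not> (\<exists>f. indep (Suc k) f)"
    by blast
  then obtain k f where f: "indep k f" and max: "\<And>f. \<not> indep (Suc k) f" by blast
  define S where "S = (\<lambda>g::nat \<Rightarrow> int. \<Sum>i<k. of_int (g i) * f i) ` (\<Pi>\<^sub>E i\<in>{..<k}. {0..<p})"
  have "\<exists>s\<in>S. \<exists>t. algebraic_int t \<and> y - s = of_int p * t" if y: "algebraic_int y" for y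
  proof -
    have "\<not> indep (Suc k) (f(k := y))" by (rule max)
    moreover have "\<forall>i<Suc k. algebraic_int ((f(k := y)) i)"
      using f y by (auto simp: indep_def less_Suc_eq)
    ultimately obtain c :: "nat \<Rightarrow> int" and t
      where ct: "algebraic_int t" "(\<Sum>i<k. of_int (c i) * f i) + of_int (c k) * y = of_int p * t"
        and nd: "\<not> (\<forall>i<Suc k. p dvd c i)"
      unfolding indep_def by auto
    \<comment> \<open>Otherwise the term with y could be moved to the right-hand side, and the rest
      would contradict independence of the old family.\<close>
    have "\<not> p dvd c k"
    proof
      assume "p dvd c k"
      then obtain m where m: "c k = p * m" by auto
      have "(\<Sum>i<k. of_int (c i) * f i) = of_int p * (t - of_int m * y)"
        using ct(2) by (simp add: m algebra_simps)
      moreover have "algebraic_int (t - of_int m * y)"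
        by (intro algebraic_int_diff algebraic_int_mult ct y) auto
      ultimately have "\<forall>i<k. p dvd c i" using f unfolding indep_def by blast
      then show False using nd \<open>p dvd c k\<close> by (auto simp: less_Suc_eq)
    qed
    then have "coprime p (c k)" using p by (simp add: prime_imp_coprime)
    \<comment> \<open>u inverts c_k modulo p, which solves the relation for y.\<close>
    then obtain u w where uw: "u * c k + w * p = 1"
      by (metis bezout_int coprime_iff_gcd_eq_1 gcd.commute)
    define g where "g = (\<lambda>i\<in>{..<k}. (- u * c i) mod p)"
    define s where "s = (\<Sum>i<k. of_int (g i) * f i)"
    have "p > 0" using p by (simp add: prime_gt_0_int)
    then have "s \<in> S" unfolding S_def s_def by (intro imageI) (auto simp: g_def)
    have "y = of_int (u * c k + w * p) * y" by (simp add: uw)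
    also have "\<dots> = of_int u * (of_int (c k) * y) + of_int p * (of_int w * y)"
      by (simp add: algebra_simps)
    also have "of_int (c k) * y = of_int p * t - (\<Sum>i<k. of_int (c i) * f i)"
      using ct(2) by (simp add: algebra_simps)
    finally have y': "y = of_int p * (of_int u * t + of_int w * y) + (\<Sum>i<k. of_int (- u * c i) * f i)"
      by (simp add: algebra_simps sum_distrib_left sum_negf)
    have "(\<Sum>i<k. of_int (- u * c i) * f i) = (\<Sum>i<k. of_int (p * ((- u * c i) div p) + g i) * f i)"
      by (rule sum.cong) (auto simp: g_def)
    also have "\<dots> = s + of_int p * (\<Sum>i<k. of_int ((- u * c i) div p) * f i)"
      by (simp add: s_def algebra_simps sum.distrib sum_distrib_left)
    finally have "y - s = of_int p * (of_int u * t + of_int w * y + (\<Sum>i<k. of_int ((- u * c i) div p) * f i))"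
      using y' by (simp add: algebra_simps)
    moreover have "algebraic_int (of_int u * t + of_int w * y + (\<Sum>i<k. of_int ((- u * c i) div p) * f i))"
      using f by (intro algebraic_int_add algebraic_int_mult algebraic_int_sum ct y) (auto simp: indep_def)
    ultimately show ?thesis using \<open>s \<in> S\<close> by blast
  qed
  moreover have "finite S" unfolding S_def by (intro finite_imageI finite_PiE) auto
  ultimately show ?thesis by blast
qed

text \<open>Residues modulo p n are t + p s, with t a residue modulo p and s one modulo n.\<close>

lemma finite_residues_int:
  fixes n :: nat
  assumes "n > 0"
  shows "\<exists>S::'k set. finite S \<and> (\<forall>y. algebraic_int y \<longrightarrow> (\<exists>s\<in>S. \<exists>t. algebraic_int t \<and> y - s = of_nat n * t))"
  using assms
proof (induction n rule: prime_divisors_induct)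
  case zero
  then show ?case by simp
next
  case (unit n)
  then show ?case by (intro exI[of _ "{0}"]) auto
next
  case (factor p n)
  then obtain S where S: "finite S" "\<And>y::'k. algebraic_int y \<Longrightarrow> \<exists>s\<in>S. \<exists>t. algebraic_int t \<and> y - s = of_nat n * t"
    by auto
  obtain T where T: "finite T" "\<And>y::'k. algebraic_int y \<Longrightarrow> \<exists>s\<in>T. \<exists>t. algebraic_int t \<and> y - s = of_nat p * t"
    using finite_residues_prime[of "int p"] factor(1) by auto
  have "\<exists>r\<in>(\<lambda>(s, t). t + of_nat p * s) ` (S \<times> T). \<exists>t. algebraic_int t \<and> y - r = of_nat (p * n) * t" if "algebraic_int y" for y
  proof -
    obtain t y' where 1: "t \<in> T" "algebraic_int y'" "y - t = of_nat p * y'" using T(2)[OF \<open>algebraic_int y\<close>] by auto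
    obtain s y'' where 2: "s \<in> S" "algebraic_int y''" "y' - s = of_nat n * y''" using S(2)[OF 1(2)] by auto
    have "y - (t + of_nat p * s) = of_nat p * (y' - s)" using 1(3) by (simp add: algebra_simps)
    then show ?thesis using 1 2 by (intro bexI[of _ "t + of_nat p * s"] exI[of _ y'']) (auto intro: rev_image_eqI[of "(s,t)"])
  qed
  then show ?case using S(1) T(1) by (intro exI[of _ "(\<lambda>(s, t). t + of_nat p * s) ` (S \<times> T)"]) auto
qed

text \<open>A substitute for the norm. In an integer relation for a, the lowest nonzero term c_j a^j
  is a^j times a multiple of a; cancelling a^j shows that a divides c_j.\<close>

lemma divides_integer:
  fixes a :: 'k
  assumes "algebraic_int a" "a \<noteq> 0"
  shows "\<exists>n>0. \<exists>t. algebraic_int t \<and> of_nat n = a * t"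
proof -
  obtain n and c :: "nat \<Rightarrow> int" where c: "\<exists>i\<le>n. c i \<noteq> 0" and rel: "(\<Sum>i\<le>n. of_int (c i) * a ^ i) = 0"
    using integer_relation by metis
  define j where "j = (LEAST i. c i \<noteq> 0)"
  have j: "c j \<noteq> 0" "\<And>i. i < j \<Longrightarrow> c i = 0" "j \<le> n"
  proof -
    obtain i where i: "i \<le> n" "c i \<noteq> 0" using c by blast
    show "c j \<noteq> 0" unfolding j_def using i(2) by (rule LeastI)
    show "c i = 0" if "i < j" for i using not_less_Least[OF that[unfolded j_def]] by simp
    have "j \<le> i" unfolding j_def using i(2) by (rule Least_le)
    then show "j \<le> n" using i(1) by simp
  qed
  define t where "t = - (\<Sum>i=Suc j..n. of_int (c i) * a ^ (i - Suc j))"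
  have t: "algebraic_int t"
    unfolding t_def by (intro algebraic_int_minus algebraic_int_sum algebraic_int_mult algebraic_int_power assms) auto
  have "{..n} = {..<j} \<union> {j} \<union> {Suc j..n}" using j(3) by auto
  then have "0 = (\<Sum>i\<in>{..<j} \<union> {j} \<union> {Suc j..n}. of_int (c i) * a ^ i)" using rel by simp
  also have "\<dots> = of_int (c j) * a ^ j + (\<Sum>i=Suc j..n. of_int (c i) * a ^ i)"
  proof -
    have "(\<Sum>i\<in>{..<j} \<union> {j} \<union> {Suc j..n}. of_int (c i) * a ^ i) = (\<Sum>i\<in>insert j {Suc j..n}. of_int (c i) * a ^ i)"
      by (rule sum.mono_neutral_right) (auto simp: j(2))
    then show ?thesis by simp
  qed
  also have "(\<Sum>i=Suc j..n. of_int (c i) * a ^ i) = - (a ^ j * (a * t))"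
    unfolding t_def minus_mult_minus minus_mult_right[symmetric] minus_minus sum_distrib_left
  proof (rule sum.cong)
    fix i assume "i \<in> {Suc j..n}"
    then have "i = j + Suc (i - Suc j)" by auto
    then have "a ^ i = a ^ j * (a * a ^ (i - Suc j))" by (metis power_add power_Suc)
    then show "of_int (c i) * a ^ i = a ^ j * (a * (of_int (c i) * a ^ (i - Suc j)))" by (simp add: mult_ac)
  qed auto
  finally have "of_int (c j) * a ^ j - a ^ j * (a * t) = 0" by simp
  then have "a ^ j * (of_int (c j) - a * t) = 0"
    by (simp only: right_diff_distrib mult.commute[of "of_int (c j)"])
  then have cj: "of_int (c j) = a * t" using assms by simp
  show ?thesis
  proof (cases "c j > 0")
    case True
    then show ?thesis using cj t by (intro exI[of _ "nat (c j)"] exI[of _ t] conjI) auto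
  next
    case False
    then show ?thesis using cj t j(1)
      by (intro exI[of _ "nat (- c j)"] exI[of _ "- t"] conjI) (auto simp: of_nat_nat)
  qed
qed

lemma finite_residues:
  fixes a :: 'k
  assumes "algebraic_int a" "a \<noteq> 0"
  shows "\<exists>S. finite S \<and> (\<forall>s\<in>S. algebraic_int s) \<and>
    (\<forall>y. algebraic_int y \<longrightarrow> (\<exists>s\<in>S. \<exists>t. algebraic_int t \<and> y - s = a * t))"
proof -
  obtain n t0 where n: "n > 0" "algebraic_int t0" "of_nat n = a * t0"
    using divides_integer[OF assms] by blast
  obtain S :: "'k set" where S: "finite S"
    "\<And>y. algebraic_int y \<Longrightarrow> \<exists>s\<in>S. \<exists>t. algebraic_int t \<and> y - s = of_nat n * t"
    using finite_residues_int[OF n(1)] by blast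
  show ?thesis
  proof (intro exI[of _ "{s\<in>S. algebraic_int s}"] conjI allI impI)
    fix y :: 'k assume y: "algebraic_int y"
    then obtain s t where st: "s \<in> S" "algebraic_int t" "y - s = of_nat n * t" using S(2) by blast
    have "s = y - a * (t0 * t)" using st(3) n(3) by (simp add: algebra_simps)
    then show "\<exists>s\<in>{s\<in>S. algebraic_int s}. \<exists>t. algebraic_int t \<and> y - s = a * t"
      using st y n assms by (intro bexI[of _ s] exI[of _ "t0 * t"]) (auto intro: algebraic_int_mult algebraic_int_diff)
  qed (use S in auto)
qed

text \<open>An ideal containing a is a union of classes modulo a, so it is determined by its members
  in a finite residue system.\<close>

lemma finite_ideals_containing:
  fixes a :: 'k
  assumes "algebraic_int a" "a \<noteq> 0"
  shows "finite {I. o_ideal I \<and> a \<in> I}"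
proof -
  obtain S where S: "finite S" "\<forall>s\<in>S. algebraic_int s"
    "\<And>y. algebraic_int y \<Longrightarrow> \<exists>s\<in>S. \<exists>t. algebraic_int t \<and> y - s = a * t"
    using finite_residues[OF assms] by blast
  have sub: "I \<subseteq> J" if "o_ideal I" "a \<in> I" "o_ideal J" "a \<in> J" "I \<inter> S = J \<inter> S" for I J
  proof
    fix y assume "y \<in> I"
    then have "algebraic_int y" using \<open>o_ideal I\<close> by (auto simp: o_ideal_def)
    then obtain s t where s: "s \<in> S" "algebraic_int t" "y - s = a * t"
      using S(3) by blast
    have at: "a * t \<in> I" "a * t \<in> J" using that s(2) by (auto simp: o_ideal_def intro: o_module_mult')
    have "s = y - a * t" using s(3) by (simp add: algebra_simps)
    then have "s \<in> I" using \<open>y \<in> I\<close> at that(1) by (auto simp: o_ideal_def intro: o_module_diff)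
    then have "s \<in> J" using s(1) that(5) by blast
    moreover have "y = s + a * t" using s(3) by (simp add: algebra_simps)
    ultimately show "y \<in> J" using at(2) that(3) by (auto simp: o_ideal_def intro: o_module_add)
  qed
  have "inj_on (\<lambda>I. I \<inter> S) {I. o_ideal I \<and> a \<in> I}"
    by (rule inj_onI) (use sub in blast)
  then show ?thesis
    by (rule finite_imageD[rotated]) (use S(1) in \<open>auto intro: finite_subset[of _ "Pow S"]\<close>)
qed

lemma o_ideal_insert:
  fixes Q :: "'k set"
  assumes Q: "o_ideal Q" and s: "algebraic_int s"
  shows "o_ideal {q + s * t | q t. q \<in> Q \<and> algebraic_int t}" (is "o_ideal ?J")
    and "Q \<subseteq> {q + s * t | q t. q \<in> Q \<and> algebraic_int t}"
    and "s \<in> {q + s * t | q t. q \<in> Q \<and> algebraic_int t}"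
proof -
  have Q': "o_module Q" using Q by (simp add: o_ideal_def)
  show "Q \<subseteq> ?J" by (force intro: exI[of _ 0])
  show "s \<in> ?J" using o_module_0[OF Q'] by (force intro: exI[of _ 1])
  show "o_ideal ?J"
    unfolding o_ideal_def o_module_def
  proof (intro conjI ballI allI impI)
    show "0 \<in> ?J" using o_module_0[OF Q'] by force
    fix x assume "x \<in> ?J"
    then obtain q t where qt: "x = q + s * t" "q \<in> Q" "algebraic_int t" by blast
    show "algebraic_int x" using qt Q s by (auto simp: o_ideal_def intro: algebraic_int_add algebraic_int_mult)
    fix y assume "y \<in> ?J"
    then obtain q' t' where qt': "y = q' + s * t'" "q' \<in> Q" "algebraic_int t'" by blast
    have "x + y = (q + q') + s * (t + t')" by (simp add: qt qt' algebra_simps)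
    then show "x + y \<in> ?J" using qt qt' o_module_add[OF Q'] algebraic_int_add by blast
  next
    fix c x :: 'k assume c: "algebraic_int c" and "x \<in> ?J"
    then obtain q t where qt: "x = q + s * t" "q \<in> Q" "algebraic_int t" by blast
    have "c * x = c * q + s * (c * t)" by (simp add: qt algebra_simps)
    then show "c * x \<in> ?J" using qt c o_module_mult[OF Q'] algebraic_int_mult by blast
  qed
qed

text \<open>Stated as the quotient ring being a field: inverses modulo Q are what is used.\<close>

definition o_maximal :: "'k set \<Rightarrow> bool" where
  "o_maximal Q \<longleftrightarrow> o_ideal Q \<and> 1 \<notin> Q \<and>
    (\<forall>s. algebraic_int s \<longrightarrow> s \<notin> Q \<longrightarrow> (\<exists>t. algebraic_int t \<and> 1 - s * t \<in> Q))"

text \<open>Only finitely many ideals contain a, so among the proper ones above I there is a maximal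
  one.\<close>

lemma exists_maximal:
  assumes I: "o_ideal I" "1 \<notin> I" "a \<in> I" "a \<noteq> 0"
  shows "\<exists>Q. o_maximal Q \<and> I \<subseteq> Q"
proof -
  define M where "M = {J. o_ideal J \<and> a \<in> J \<and> 1 \<notin> J}"
  have "finite {J. o_ideal J \<and> a \<in> J}"
    using I by (intro finite_ideals_containing) (auto simp: o_ideal_def)
  then have "finite M" by (rule rev_finite_subset) (auto simp: M_def)
  moreover have "I \<in> M" using I by (auto simp: M_def)
  ultimately obtain Q where Q: "Q \<in> M" "I \<subseteq> Q" "\<And>J. J \<in> M \<Longrightarrow> Q \<subseteq> J \<Longrightarrow> Q = J"
    using finite_has_maximal2[of M I] by auto
  have "\<exists>t. algebraic_int t \<and> 1 - s * t \<in> Q" if s: "algebraic_int s" "s \<notin> Q" for s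
  proof -
    define J where "J = {q + s * t | q t. q \<in> Q \<and> algebraic_int t}"
    have J: "o_ideal J" "Q \<subseteq> J" "s \<in> J"
      using o_ideal_insert[of Q s] s Q(1) by (auto simp: M_def J_def)
    then have "J \<notin> M" using Q(3) s(2) by blast
    then have "1 \<in> J" using J Q(1) by (auto simp: M_def)
    then obtain q t where "1 = q + s * t" "q \<in> Q" "algebraic_int t" by (auto simp: J_def)
    then have "1 - s * t = q" by (simp add: algebra_simps)
    then show ?thesis using \<open>q \<in> Q\<close> \<open>algebraic_int t\<close> by (intro exI[of _ t]) simp
  qed
  then show ?thesis using Q by (auto simp: M_def o_maximal_def)
qed

lemma o_maximal_imp_prime:
  assumes "o_maximal Q"
  shows "o_prime Q"
  unfolding o_prime_def
proof (intro conjI allI impI)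
  have Q: "o_module Q" using assms by (auto simp: o_maximal_def o_ideal_def)
  fix x y assume xy: "algebraic_int x" "algebraic_int y" "x * y \<in> Q"
  show "x \<in> Q \<or> y \<in> Q"
  proof (rule ccontr)
    assume n: "\<not> ?thesis"
    then obtain t where t: "algebraic_int t" "1 - x * t \<in> Q"
      using xy assms by (auto simp: o_maximal_def)
    have "y * (1 - x * t) + t * (x * y) \<in> Q"
      by (rule o_module_add[OF Q o_module_mult[OF Q xy(2) t(2)] o_module_mult[OF Q t(1) xy(3)]])
    then show False using n by (simp add: algebra_simps)
  qed
qed (use assms in \<open>auto simp: o_maximal_def\<close>)

lemma o_prime_power_notin:
  assumes "o_prime P" "algebraic_int s" "s \<notin> P"
  shows "s ^ n \<notin> P"
  using assms by (induction n) (auto simp: o_prime_def intro: algebraic_int_power)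

lemma o_prime_prod_notin:
  assumes "o_prime P" "\<And>i. i \<in> A \<Longrightarrow> algebraic_int (f i) \<and> f i \<notin> P"
  shows "prod f A \<notin> P"
  using assms(2)
proof (induction A rule: infinite_finite_induct)
  case (insert x F)
  then have "algebraic_int (prod f F)" "prod f F \<notin> P" by (auto intro: algebraic_int_prod)
  then show ?case using insert assms(1) unfolding o_prime_def by (metis insertI1 prod.insert)
qed (use assms(1) in \<open>auto simp: o_prime_def\<close>)

text \<open>The argument that a finite domain is a field: the ideals P + s^n O all contain a fixed
  nonzero element, so two of them agree, and in the resulting membership of s^m in P + s^n O the
  factor s^m can be cancelled.\<close>

lemma o_prime_imp_maximal:
  assumes P: "o_prime P" "P \<noteq> {0}"
  shows "o_maximal P"
  unfolding o_maximal_def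
proof (intro conjI allI impI)
  show "o_ideal P" "1 \<notin> P" using P by (auto simp: o_prime_def)
  then have P': "o_module P" by (simp add: o_ideal_def)
  then obtain a where a: "a \<in> P" "a \<noteq> 0" using P(2) o_module_0 by blast
  fix s assume s: "algebraic_int s" "s \<notin> P"
  define J where "J = (\<lambda>n::nat. {q + s ^ n * t | q t. q \<in> P \<and> algebraic_int t})"
  have "finite {I. o_ideal I \<and> a \<in> I}"
    using a \<open>o_ideal P\<close> by (intro finite_ideals_containing) (auto simp: o_ideal_def)
  moreover have J: "o_ideal (J n)" "P \<subseteq> J n" "s ^ n \<in> J n" for n
    unfolding J_def using o_ideal_insert[OF \<open>o_ideal P\<close> algebraic_int_power[OF s(1), of n]] by auto
  then have "range J \<subseteq> {I. o_ideal I \<and> a \<in> I}" using a by auto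
  ultimately have "finite (range J)" by (rule rev_finite_subset)
  then have "\<not> inj J" using finite_imageD by auto
  then obtain m n where mn: "m < n" "J m = J n"
    by (metis injI linorder_neqE_nat)
  then have "s ^ m \<in> J n" using J by blast
  then obtain q t where qt: "q \<in> P" "algebraic_int t" "s ^ m = q + s ^ n * t" by (auto simp: J_def)
  define t' where "t' = s ^ (n - Suc m) * t"
  have t': "algebraic_int t'" using qt s by (auto simp: t'_def intro: algebraic_int_mult algebraic_int_power)
  have "s ^ n = s ^ m * (s * s ^ (n - Suc m))"
    using mn(1) by (simp flip: power_add power_Suc add: Suc_diff_Suc)
  then have "s ^ n * t = s ^ m * (s * t')" by (simp only: t'_def mult.assoc)
  then have "q = s ^ m * (1 - s * t')" using qt(3) by (simp add: right_diff_distrib)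
  then have "s ^ m * (1 - s * t') \<in> P" using qt(1) by simp
  moreover have "s ^ m \<notin> P" by (rule o_prime_power_notin[OF P(1) s])
  ultimately have "1 - s * t' \<in> P"
    using P(1) s t' unfolding o_prime_def
    by (meson algebraic_int_diff algebraic_int_mult algebraic_int_one_field algebraic_int_power)
  then show "\<exists>t. algebraic_int t \<and> 1 - s * t \<in> P" using t' by blast
qed

section \<open>Inverses of fractional ideals\<close>

definition o_inv :: "'k set \<Rightarrow> 'k set" where
  "o_inv J = {x. \<forall>y\<in>J. algebraic_int (x * y)}"

text \<open>The integer span is the full product of J with its inverse, because
  \<open>o_inv J\<close> already absorbs integral factors.\<close>

definition o_invertible :: "'k set \<Rightarrow> bool" where
  "o_invertible J \<longleftrightarrow> o_module J \<and> 1 \<in> Zmod.span {u * w | u w. u \<in> o_inv J \<and> w \<in> J}"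

lemma o_module_o_inv: "o_module (o_inv J)"
  by (auto simp: o_module_def o_inv_def algebra_simps intro: algebraic_int_add)
     (metis algebraic_int_mult mult.left_commute)

text \<open>A dual basis: x = \<Sum> (u_i x) w_i for x in J, with integral coordinates u_i
  x.\<close>

lemma o_invertibleE:
  assumes "o_invertible J"
  obtains n :: nat and u w where "\<And>i. i < n \<Longrightarrow> u i \<in> o_inv J" "\<And>i. i < n \<Longrightarrow> w i \<in> J"
    "(\<Sum>i<n. u i * w i) = 1"
proof -
  have "\<exists>n (u::nat \<Rightarrow> 'k) w. (\<forall>i<n. u i \<in> o_inv J \<and> w i \<in> J) \<and> (\<Sum>i<n. u i * w i) = z"
    if "z \<in> Zmod.span {u * w | u w. u \<in> o_inv J \<and> w \<in> J}" for z
    using that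
  proof (induction rule: Zmod.span_induct_alt)
    case base
    show ?case by (intro exI[of _ 0]) simp
  next
    case (step c x z)
    then obtain n and u w :: "nat \<Rightarrow> 'k" where h: "\<forall>i<n. u i \<in> o_inv J \<and> w i \<in> J" "(\<Sum>i<n. u i * w i) = z"
      by (elim exE conjE)
    obtain u' w' where h': "x = u' * w'" "u' \<in> o_inv J" "w' \<in> J" using step(1) by blast
    note h = h h'
    have "(\<Sum>i<n. (u(n := of_int c * u')) i * (w(n := w')) i) = z"
      unfolding h(2)[symmetric] by (rule sum.cong) auto
    then have "(\<Sum>i<Suc n. (u(n := of_int c * u')) i * (w(n := w')) i) = of_int c * x + z"
      by (simp add: h)
    moreover have "of_int c * u' \<in> o_inv J"
      using o_module_mult[OF o_module_o_inv] h by simp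
    ultimately show ?case using h
      by (intro exI[of _ "Suc n"] exI[of _ "u(n := of_int c * u')"] exI[of _ "w(n := w')"]) (auto simp: less_Suc_eq)
  qed
  then show ?thesis using assms that unfolding o_invertible_def by blast
qed

lemma o_invertibleI:
  assumes "o_module J" "finite A" "\<And>i. i \<in> A \<Longrightarrow> u i \<in> o_inv J" "\<And>i. i \<in> A \<Longrightarrow> w i \<in> J"
    "(\<Sum>i\<in>A. u i * w i) = 1"
  shows "o_invertible J"
  unfolding o_invertible_def assms(5)[symmetric]
  using assms by (intro conjI Zmod.span_sum Zmod.span_base) blast+

text \<open>Divisibility in a valuation ring is total, so one of finitely many elements divides all
  others; s is a common denominator outside Q. A new element z is compared with the current x, and
  either x keeps its role or z takes it over.\<close>

lemma locally_principal_generator: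
  fixes S :: "'k set"
  assumes Q: "o_prime Q" and "finite S" "S \<noteq> {}" "0 \<notin> S"
  shows "\<exists>x\<in>S. \<exists>s. algebraic_int s \<and> s \<notin> Q \<and> (\<forall>y\<in>S. algebraic_int (s / x * y))"
  using assms(2,3,4)
proof (induction S rule: finite_ne_induct)
  case (singleton x)
  then show ?case using Q by (intro bexI[of _ x] exI[of _ 1]) (auto simp: o_prime_def)
next
  case (insert z S)
  then obtain x s where x: "x \<in> S" and s: "algebraic_int s" "s \<notin> Q" "\<And>y. y \<in> S \<Longrightarrow> algebraic_int (s / x * y)"
    by (metis insertI2)
  have "x \<noteq> 0" using x insert.prems by auto
  note x = x this
  have "z \<noteq> 0" using insert.prems by auto
  then obtain t where t: "algebraic_int t" "t \<notin> Q" "algebraic_int (t * (z / x)) \<or> algebraic_int (t / (z / x))"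
    using locally_integral_or_inverse[of Q "z / x"] Q x by (auto simp: o_prime_def)
  have st: "algebraic_int (s * t)" "s * t \<notin> Q"
    using s t Q by (auto intro: algebraic_int_mult simp: o_prime_def)
  show ?case
    using t(3)
  proof
    assume tz: "algebraic_int (t * (z / x))"
    have "algebraic_int (s * t / x * y)" if "y \<in> insert z S" for y
    proof (cases "y = z")
      case True
      then show ?thesis using algebraic_int_mult[OF s(1) tz] by (simp add: field_simps)
    next
      case False
      then show ?thesis using algebraic_int_mult[OF t(1) s(3)[of y]] that by (simp add: field_simps)
    qed
    then show ?thesis using x st by blast
  next
    assume tz: "algebraic_int (t / (z / x))"
    have "algebraic_int (s * t / z * y)" if "y \<in> insert z S" for y
    proof (cases "y = z")
      case True
      then show ?thesis using st \<open>z \<noteq> 0\<close> by simp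
    next
      case False
      then have "algebraic_int (t / (z / x) * (s / x * y))"
        using algebraic_int_mult[OF tz s(3)[of y]] that by simp
      then show ?thesis using x by (simp add: field_simps)
    qed
    then show ?thesis using st by blast
  qed
qed

text \<open>If the product T of J with its inverse were proper, it would lie in a maximal Q. Locally
  at Q the ideal J is generated by a single x, so s / x is in \<open>o_inv J\<close> for some s
  outside Q, and then s = (s / x) x lies in T.\<close>

lemma o_ideal_invertible:
  assumes J: "o_ideal J" "J \<noteq> {0}"
  shows "o_invertible J"
proof -
  have J': "o_module J" using J by (simp add: o_ideal_def)
  then obtain a where a: "a \<in> J" "a \<noteq> 0" using J(2) o_module_0 by blast
  have a_int: "algebraic_int a" using a J by (simp add: o_ideal_def)
  define T where "T = Zmod.span {u * w | u w. u \<in> o_inv J \<and> w \<in> J}"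
  have T_base: "u * w \<in> T" if "u \<in> o_inv J" "w \<in> J" for u w
    unfolding T_def using that by (intro Zmod.span_base) blast
  have T_ideal: "o_ideal T"
    unfolding o_ideal_def o_module_def
  proof (intro conjI ballI allI impI)
    show "0 \<in> T" unfolding T_def by (rule Zmod.span_zero)
    fix x assume x: "x \<in> T"
    show "x + y \<in> T" if "y \<in> T" for y using x that unfolding T_def by (rule Zmod.span_add)
    show "algebraic_int x" using x unfolding T_def
    proof (induction rule: Zmod.span_induct_alt)
      case (step n x y)
      then have "algebraic_int x" by (auto simp: o_inv_def)
      then show ?case using step(2) by (intro algebraic_int_add algebraic_int_mult) auto
    qed simp
  next
    fix c x :: 'k assume c: "algebraic_int c" and x: "x \<in> T"
    show "c * x \<in> T" using x unfolding T_def
    proof (induction rule: Zmod.span_induct_alt)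
      case (step n x y)
      then obtain u w where uw: "x = u * w" "u \<in> o_inv J" "w \<in> J" by blast
      have "(c * u) * w \<in> T" using uw c by (intro T_base o_module_mult[OF o_module_o_inv])
      then have "of_int n * (c * u * w) + c * y \<in> T"
        using step(2) unfolding T_def by (intro Zmod.span_add Zmod.span_scale)
      then show ?case by (simp add: uw T_def algebra_simps)
    qed (simp add: Zmod.span_zero)
  qed
  have "1 \<in> o_inv J" using J by (auto simp: o_inv_def o_ideal_def)
  from T_base[OF this a(1)] have aT: "a \<in> T" by simp
  have "1 \<in> T"
  proof (rule ccontr)
    assume "1 \<notin> T"
    then obtain Q where Q: "o_maximal Q" "T \<subseteq> Q"
      using exists_maximal[OF T_ideal _ aT a(2)] by blast
    obtain S where S: "finite S" "\<forall>s\<in>S. algebraic_int s"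
      "\<And>y. algebraic_int y \<Longrightarrow> \<exists>s\<in>S. \<exists>t. algebraic_int t \<and> y - s = a * t"
      using finite_residues[OF a_int a(2)] by blast
    \<comment> \<open>Together with a, the residues modulo a that lie in J generate J, so it is
      enough that x divides these finitely many elements.\<close>
    obtain x s where x: "x \<in> insert a (S \<inter> J) - {0}" and s: "algebraic_int s" "s \<notin> Q"
      "\<And>y. y \<in> insert a (S \<inter> J) - {0} \<Longrightarrow> algebraic_int (s / x * y)"
      using locally_principal_generator[OF o_maximal_imp_prime[OF Q(1)], of "insert a (S \<inter> J) - {0}"] S(1) a(2)
      by blast
    have "algebraic_int (s / x * y)" if "y \<in> J" for y
    proof -
      have "algebraic_int y" using that J by (simp add: o_ideal_def)
      then obtain r t where r: "r \<in> S" "algebraic_int t" "y - r = a * t" using S(3) by blast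
      have "r = y - a * t" using r(3) by (simp add: algebra_simps)
      then have "r \<in> J" using that a(1) r(2) J' by (auto intro: o_module_diff o_module_mult')
      then have "algebraic_int (s / x * r)" using s(3)[of r] r(1) by (cases "r = 0") auto
      moreover have "algebraic_int (s / x * a)" using s(3)[of a] a by simp
      moreover have "y = r + a * t" using r(3) by (simp add: algebra_simps)
      ultimately have "algebraic_int (s / x * r + s / x * a * t)"
        using r(2) by (intro algebraic_int_add algebraic_int_mult[of "s / x * a"])
      then show ?thesis by (simp add: \<open>y = r + a * t\<close> algebra_simps)
    qed
    then have "s / x \<in> o_inv J" by (simp add: o_inv_def)
    from T_base[OF this, of x] have "s \<in> T" using x a by auto
    then show False using s Q by blast
  qed
  then show ?thesis using J' by (simp add: o_invertible_def T_def)
qed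

lemma o_inv_o_inv:
  assumes "o_invertible J"
  shows "o_inv (o_inv J) = J"
proof
  show "J \<subseteq> o_inv (o_inv J)" by (auto simp: o_inv_def mult.commute)
  obtain n :: nat and u w where uw: "\<And>i. i < n \<Longrightarrow> u i \<in> o_inv J" "\<And>i. i < n \<Longrightarrow> w i \<in> J"
    "(\<Sum>i<n. u i * w i) = 1" using assms by (rule o_invertibleE) blast
  have J: "o_module J" using assms by (simp add: o_invertible_def)
  show "o_inv (o_inv J) \<subseteq> J"
  proof
    fix x assume x: "x \<in> o_inv (o_inv J)"
    have "x = (\<Sum>i<n. (x * u i) * w i)"
      using uw(3) by (simp add: mult.assoc flip: sum_distrib_left)
    also have "\<dots> \<in> J"
      by (intro o_module_sum[OF J] o_module_mult[OF J]) (use x uw in \<open>auto simp: o_inv_def\<close>)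
    finally show "x \<in> J" .
  qed
qed

lemma o_invertible_o_inv:
  assumes "o_invertible J"
  shows "o_invertible (o_inv J)"
proof -
  have "{u * w |u w. u \<in> o_inv (o_inv J) \<and> w \<in> o_inv J} = {u * w |u w. u \<in> o_inv J \<and> w \<in> J}"
    unfolding o_inv_o_inv[OF assms]
  proof (rule Collect_cong)
    fix x show "(\<exists>u w. x = u * w \<and> u \<in> J \<and> w \<in> o_inv J) = (\<exists>u w. x = u * w \<and> u \<in> o_inv J \<and> w \<in> J)"
      by (metis mult.commute)
  qed
  then show ?thesis using assms by (simp add: o_invertible_def o_module_o_inv)
qed

text \<open>The fractional ideal J^-2, written as the multipliers from J into its inverse, which is
  how a change of z acts on \<open>Lam J z\<close>.\<close>

definition o_inv2 :: "'k set \<Rightarrow> 'k set" where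
  "o_inv2 J = {x. \<forall>y\<in>J. x * y \<in> o_inv J}"

lemma o_module_o_inv2: "o_module (o_inv2 J)"
  using o_module_o_inv[of J]
  by (auto simp: o_inv2_def o_module_def algebra_simps)

lemma o_invertible_o_inv2:
  assumes "o_invertible J"
  shows "o_invertible (o_inv2 J)"
proof -
  obtain n :: nat and u w where uw: "\<And>i. i < n \<Longrightarrow> u i \<in> o_inv J" "\<And>i. i < n \<Longrightarrow> w i \<in> J"
    "(\<Sum>i<n. u i * w i) = 1" using assms by (rule o_invertibleE) blast
  show ?thesis
  proof (rule o_invertibleI)
    show "o_module (o_inv2 J)" by (rule o_module_o_inv2)
    show "finite ({..<n} \<times> {..<n})" by simp
    \<comment> \<open>The dual basis for J^-2 comes from squaring the relation for J.\<close>
    have "(\<Sum>i\<in>{..<n} \<times> {..<n}. (w (fst i) * w (snd i)) * (u (fst i) * u (snd i))) = (\<Sum>i<n. u i * w i) * (\<Sum>i<n. u i * w i)"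
      unfolding sum_product by (simp add: sum.cartesian_product case_prod_unfold mult_ac)
    then show "(\<Sum>i\<in>{..<n} \<times> {..<n}. (w (fst i) * w (snd i)) * (u (fst i) * u (snd i))) = 1" using uw(3) by simp
    fix i assume "i \<in> {..<n} \<times> {..<n}"
    then obtain k l where i: "i = (k, l)" "k < n" "l < n" by auto
    show "u (fst i) * u (snd i) \<in> o_inv2 J"
      unfolding o_inv2_def o_inv_def
    proof (safe)
      fix y y' assume "y \<in> J" "y' \<in> J"
      then have "algebraic_int ((u k * y) * (u l * y'))"
        using i uw(1)[of k] uw(1)[of l] by (intro algebraic_int_mult[of "u k * y"]) (auto simp: o_inv_def)
      then show "algebraic_int (u (fst i) * u (snd i) * y * y')" by (simp add: i mult_ac)
    qed
    show "w (fst i) * w (snd i) \<in> o_inv (o_inv2 J)"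
      using i uw(2) by (auto simp: o_inv2_def o_inv_def mult_ac)
  qed
qed

lemma o_maximal_avoid:
  assumes "o_maximal Q" "o_maximal Q'" "Q \<noteq> Q'"
  shows "\<exists>x\<in>Q'. x \<notin> Q"
proof (rule ccontr)
  assume nt: "\<not> ?thesis"
  then obtain s where s: "s \<in> Q" "s \<notin> Q'" using assms(3) by blast
  have Q: "o_module Q" using assms by (auto simp: o_maximal_def o_ideal_def)
  have s_int: "algebraic_int s" using s assms by (auto simp: o_maximal_def o_ideal_def)
  then obtain t where t: "algebraic_int t" "1 - s * t \<in> Q'"
    using s assms(2) by (auto simp: o_maximal_def)
  then have "1 - s * t \<in> Q" using nt by blast
  then have "(1 - s * t) + s * t \<in> Q" using s t by (intro o_module_add[OF Q] o_module_mult'[OF Q])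
  then show False using assms(1) by (simp add: o_maximal_def)
qed

text \<open>The relation says that g generates F modulo a F. At each of the finitely many maximal Q
  containing a, some g_Q in F is not in Q F; weighting the g_Q by elements that lie in all the other
  maximal ideals but not in Q gives one g that works everywhere.\<close>

lemma generator_modulo:
  assumes F: "o_invertible F" and a: "algebraic_int a" "a \<noteq> 0"
  obtains g t s where "g \<in> F" "t \<in> o_inv F" "algebraic_int s" "g * t + a * s = 1"
proof -
  have F': "o_module F" using F by (simp add: o_invertible_def)
  define M where "M = {Q. o_maximal Q \<and> a \<in> Q}"
  have finM: "finite M"
    by (rule finite_subset[OF _ finite_ideals_containing[OF a]]) (auto simp: M_def o_maximal_def)
  have "\<exists>g\<in>F. \<exists>u\<in>o_inv F. g * u \<notin> Q" if "Q \<in> M" for Q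
  proof (rule ccontr)
    assume "\<not> ?thesis"
    then have *: "u * g \<in> Q" if "g \<in> F" "u \<in> o_inv F" for g u using that by (auto simp: mult.commute)
    have Q: "o_module Q" "1 \<notin> Q" using that by (auto simp: M_def o_maximal_def o_ideal_def)
    obtain n :: nat and u w where uw: "\<And>i. i < n \<Longrightarrow> u i \<in> o_inv F" "\<And>i. i < n \<Longrightarrow> w i \<in> F"
      "(\<Sum>i<n. u i * w i) = 1" using F by (rule o_invertibleE) blast
    have "(\<Sum>i<n. u i * w i) \<in> Q" by (intro o_module_sum[OF Q(1)] *) (use uw in auto)
    then show False using uw(3) Q(2) by simp
  qed
  then obtain g u where gu: "\<And>Q. Q \<in> M \<Longrightarrow> g Q \<in> F \<and> u Q \<in> o_inv F \<and> g Q * u Q \<notin> Q" by metis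
  have "\<exists>x. \<forall>Q\<in>M. \<forall>Q'\<in>M. Q \<noteq> Q' \<longrightarrow> x Q Q' \<in> Q' \<and> x Q Q' \<notin> Q"
    using o_maximal_avoid unfolding M_def by (intro bchoice ballI) (metis (full_types) mem_Collect_eq)
  then obtain x where x: "\<And>Q Q'. Q \<in> M \<Longrightarrow> Q' \<in> M \<Longrightarrow> Q \<noteq> Q' \<Longrightarrow> x Q Q' \<in> Q' \<and> x Q Q' \<notin> Q"
    by blast
  have int: "algebraic_int y" if "y \<in> Q" "Q \<in> M" for y Q using that by (auto simp: M_def o_maximal_def o_ideal_def)
  \<comment> \<open>Outside Q, but inside every other member of M.\<close>
  define e where "e = (\<lambda>Q. \<Prod>Q'\<in>M - {Q}. x Q Q')"
  have e_int: "algebraic_int (e Q)" if "Q \<in> M" for Q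
    unfolding e_def using that x int by (intro algebraic_int_prod) blast
  have e_notin: "e Q \<notin> Q" if "Q \<in> M" for Q
    unfolding e_def using that x int
    by (intro o_prime_prod_notin o_maximal_imp_prime) (auto simp: M_def)
  have e_in: "e Q \<in> Q'" if "Q \<in> M" "Q' \<in> M" "Q \<noteq> Q'" for Q Q'
  proof -
    have "e Q = x Q Q' * (\<Prod>Q''\<in>M - {Q} - {Q'}. x Q Q'')"
      unfolding e_def using that finM by (subst prod.remove[of _ Q']) auto
    moreover have "algebraic_int (\<Prod>Q''\<in>M - {Q} - {Q'}. x Q Q'')"
      using that x int by (intro algebraic_int_prod) blast
    ultimately show ?thesis
      using x[OF that] that(2) by (auto simp: M_def o_maximal_def o_ideal_def intro!: o_module_mult')
  qed
  define G where "G = (\<Sum>Q\<in>M. e Q * g Q)"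
  have G: "G \<in> F" unfolding G_def using gu e_int by (intro o_module_sum[OF F'] o_module_mult[OF F']) auto
  have G_notin: "G * u Q \<notin> Q" if "Q \<in> M" for Q
  proof
    assume asm: "G * u Q \<in> Q"
    have Q: "o_module Q" using that by (auto simp: M_def o_maximal_def o_ideal_def)
    have "G * u Q = (\<Sum>Q'\<in>M. e Q' * (g Q' * u Q))"
      by (simp add: G_def sum_distrib_right mult.assoc)
    also have "\<dots> = e Q * (g Q * u Q) + (\<Sum>Q'\<in>M-{Q}. e Q' * (g Q' * u Q))"
      using that finM by (subst sum.remove[of _ Q]) auto
    finally have "e Q * (g Q * u Q) = G * u Q - (\<Sum>Q'\<in>M-{Q}. e Q' * (g Q' * u Q))" by simp
    also have "\<dots> \<in> Q"
    proof (intro o_module_diff[OF Q asm] o_module_sum[OF Q] o_module_mult'[OF Q])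
      fix Q' assume "Q' \<in> M - {Q}"
      then show "e Q' \<in> Q" "algebraic_int (g Q' * u Q)"
        using e_in that gu by (auto simp: o_inv_def mult.commute)
    qed
    finally have "e Q * (g Q * u Q) \<in> Q" .
    moreover have "algebraic_int (g Q * u Q)" using gu[OF that] by (auto simp: o_inv_def mult.commute)
    moreover have "o_prime Q" using that by (auto simp: M_def intro: o_maximal_imp_prime)
    ultimately show False using e_int[OF that] e_notin[OF that] gu[OF that] unfolding o_prime_def by blast
  qed
  \<comment> \<open>The ideal G F^-1 + a O. A maximal ideal above it contains a, hence belongs to M,
    where G u_Q is already known to lie outside it.\<close>
  define I where "I = {G * t + a * s | t s. t \<in> o_inv F \<and> algebraic_int s}"
  have I: "G * t + a * s \<in> I" if "t \<in> o_inv F" "algebraic_int s" for t s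
    using that by (auto simp: I_def)
  have I_ideal: "o_ideal I"
    unfolding o_ideal_def o_module_def
  proof (intro conjI ballI allI impI)
    show "0 \<in> I" using I[OF o_module_0[OF o_module_o_inv], of 0] by simp
    fix x assume "x \<in> I"
    then obtain t s where ts: "x = G * t + a * s" "t \<in> o_inv F" "algebraic_int s" by (auto simp: I_def)
    have "algebraic_int (G * t)" using ts(2) G by (auto simp: o_inv_def mult.commute)
    then show "algebraic_int x" using ts a by (auto intro: algebraic_int_add algebraic_int_mult)
    fix y assume "y \<in> I"
    then obtain t' s' where ts': "y = G * t' + a * s'" "t' \<in> o_inv F" "algebraic_int s'" by (auto simp: I_def)
    show "x + y \<in> I"
      using I[OF o_module_add[OF o_module_o_inv ts(2) ts'(2)] algebraic_int_add[OF ts(3) ts'(3)]]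
      by (simp add: ts ts' algebra_simps)
  next
    fix c x :: 'k assume c: "algebraic_int c" "x \<in> I"
    then obtain t s where ts: "x = G * t + a * s" "t \<in> o_inv F" "algebraic_int s" by (auto simp: I_def)
    show "c * x \<in> I"
      using I[OF o_module_mult[OF o_module_o_inv c(1) ts(2)] algebraic_int_mult[OF c(1) ts(3)]]
      by (simp add: ts algebra_simps)
  qed
  have aI: "a \<in> I" using I[OF o_module_0[OF o_module_o_inv] algebraic_int_one_field] by simp
  have "1 \<in> I"
  proof (rule ccontr)
    assume "1 \<notin> I"
    then obtain Q where Q: "o_maximal Q" "I \<subseteq> Q" using exists_maximal[OF I_ideal _ aI a(2)] by blast
    then have "Q \<in> M" using aI by (auto simp: M_def)
    then have "G * u Q \<in> I" using I[of "u Q" 0] gu by auto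
    then show False using G_notin[OF \<open>Q \<in> M\<close>] Q by blast
  qed
  then show ?thesis using that G by (auto simp: I_def)
qed

lemma quotient_of_integers:
  fixes x :: 'k
  assumes "x \<noteq> 0"
  shows "\<exists>a b. algebraic_int a \<and> a \<noteq> 0 \<and> algebraic_int b \<and> b \<noteq> 0 \<and> x = a / b"
proof -
  \<comment> \<open>Outside the zero ideal means nonzero, so the local statement becomes one about
    fractions.\<close>
  have "o_ideal {0::'k}" by (auto simp: o_ideal_def o_module_def)
  then obtain s where s: "algebraic_int s" "s \<noteq> 0" "algebraic_int (s * x) \<or> algebraic_int (s / x)"
    using locally_integral_or_inverse[of "{0}" x] assms by auto
  from s(3) show ?thesis
  proof
    assume "algebraic_int (s * x)"
    then show ?thesis using s assms by (intro exI[of _ "s * x"] exI[of _ s]) auto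
  next
    assume "algebraic_int (s / x)"
    then show ?thesis using s assms by (intro exI[of _ s] exI[of _ "s / x"]) auto
  qed
qed

end

section \<open>Valuations and factorization\<close>

lemma two_powi_less_iff [simp]: "(2::real) powi m < 2 powi n \<longleftrightarrow> m < n"
  using power_int_strict_increasing[of m n "2::real"] power_int_strict_increasing[of n m "2::real"]
  by (cases m n rule: linorder_cases) auto

lemma two_powi_le_iff [simp]: "(2::real) powi m \<le> 2 powi n \<longleftrightarrow> m \<le> n"
  by (simp flip: not_less)

lemma int_ring_simps [simp]:
  "carrier \<O> = {x :: 'k::field_char_0. algebraic_int x}"
  "x \<otimes>\<^bsub>\<O>\<^esub> y = x * y" "x \<oplus>\<^bsub>\<O>\<^esub> y = x + y" "\<zero>\<^bsub>\<O>\<^esub> = 0" "\<one>\<^bsub>\<O>\<^esub> = 1"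
  by (simp_all add: int_ring_of_def cring_class_ops_def)

lemma cring_int_ring: "cring (\<O> :: 'k::field_char_0 ring)"
proof (rule cringI)
  show "abelian_group (\<O> :: 'k ring)"
    by (rule abelian_groupI) (auto intro: algebraic_int_add bexI[of _ "- x" for x])
  show "Group.comm_monoid (\<O> :: 'k ring)"
    by (rule comm_monoidI) (auto intro: algebraic_int_mult)
qed (simp add: algebra_simps)

lemma int_ring_a_inv:
  assumes "algebraic_int (x :: 'k::field_char_0)"
  shows "\<ominus>\<^bsub>\<O>\<^esub> x = - x"
proof -
  interpret cring "\<O> :: 'k ring" by (rule cring_int_ring)
  show ?thesis using assms by (intro minus_equality) auto
qed

lemma ideal_iff_o_ideal: "ideal (I :: 'k::field_char_0 set) \<O> \<longleftrightarrow> o_ideal I"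
proof
  interpret R: cring "\<O> :: 'k ring" by (rule cring_int_ring)
  {
    assume I: "ideal I \<O>"
    interpret ideal I "\<O>" by (rule I)
    show "o_ideal I"
      unfolding o_ideal_def o_module_def
      using zero_closed a_closed I_l_closed a_subset by auto
  }
  assume I: "o_ideal I"
  then have M: "o_module I" by (simp add: o_ideal_def)
  show "ideal I \<O>"
  proof (rule idealI)
    show "ring (\<O> :: 'k ring)" by unfold_locales
    show "subgroup I (add_monoid \<O>)"
    proof (rule R.add.subgroupI)
      show "I \<subseteq> carrier \<O>" using I by (auto simp: o_ideal_def)
      show "I \<noteq> {}" using o_module_0[OF M] by auto
      fix a b assume ab: "a \<in> I" "b \<in> I"
      show "\<ominus>\<^bsub>\<O>\<^esub> a \<in> I" using ab I o_module_minus[OF M] by (simp add: int_ring_a_inv o_ideal_def)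
      show "a \<oplus>\<^bsub>\<O>\<^esub> b \<in> I" using ab o_module_add[OF M] by simp
    qed
  qed (use M in \<open>auto intro: o_module_mult o_module_mult'\<close>)
qed

lemma primeideal_imp_o_prime:
  assumes "primeideal (P :: 'k::field_char_0 set) \<O>"
  shows "o_prime P"
proof -
  interpret primeideal P "\<O>" by (rule assms)
  have I: "o_ideal P" using ideal_axioms by (simp add: ideal_iff_o_ideal)
  then show ?thesis
    using I_notcarr I_prime o_ideal_1_eq[OF I] by (auto simp: o_prime_def)
qed

lemma Units_int_ring:
  "Units \<O> = {u :: 'k::field_char_0. u \<noteq> 0 \<and> algebraic_int u \<and> algebraic_int (inverse u)}"
proof -
  have "y = inverse u" if "y * u = 1" for y u :: 'k
    using that by (metis inverse_unique mult.commute)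
  then show ?thesis by (force simp: Units_def)
qed

lemma cgenideal_int_ring: "PIdl\<^bsub>\<O>\<^esub> a = {a * x |x :: 'k::field_char_0. algebraic_int x}"
  by (auto simp: cgenideal_def mult.commute)

lemma ideals_set_simps [simp]:
  "carrier (ideals_set R) = {I. ideal I R}" "I \<otimes>\<^bsub>ideals_set R\<^esub> J = ideal_prod R I J"
  "\<one>\<^bsub>ideals_set R\<^esub> = carrier R"
  by (simp_all add: ideals_set_def)

definition o_power :: "'k::field_char_0 set \<Rightarrow> nat \<Rightarrow> 'k set" where
  "o_power P n = P [^]\<^bsub>ideals_set \<O>\<^esub> n"

lemma o_power_0: "o_power (P :: 'k::field_char_0 set) 0 = {x. algebraic_int x}"
  by (simp add: o_power_def)

lemma o_power_Suc: "o_power P (Suc n) = ideal_prod \<O> (o_power P n) P"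
  by (simp add: o_power_def)

lemma o_ideal_ideal_prod:
  "o_ideal (I :: 'k::field_char_0 set) \<Longrightarrow> o_ideal J \<Longrightarrow> o_ideal (ideal_prod \<O> I J)"
proof -
  interpret R: cring "\<O> :: 'k ring" by (rule cring_int_ring)
  show "o_ideal I \<Longrightarrow> o_ideal J \<Longrightarrow> o_ideal (ideal_prod \<O> I J)"
    using R.ideal_prod_is_ideal unfolding ideal_iff_o_ideal .
qed

lemma o_ideal_o_power: "o_ideal (P :: 'k::field_char_0 set) \<Longrightarrow> o_ideal (o_power P n)"
proof (induction n)
  case 0
  then show ?case
    by (auto simp: o_power_0 o_ideal_def o_module_def intro: algebraic_int_add algebraic_int_mult)
qed (simp add: o_power_Suc o_ideal_ideal_prod)

lemma power_mem_o_power: "x \<in> P \<Longrightarrow> x ^ n \<in> o_power P n"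
  by (induction n) (auto simp: o_power_0 o_power_Suc simp del: power_Suc
     simp: power_Suc2 intro!: ideal_prod.prod[of _ _ _ _ \<O>, simplified])

section \<open>The valuation at a nonzero prime\<close>

locale prime_place = number_field_type K for K :: "'k::field_char_0 itself" +
  fixes P :: "'k set"
  assumes P_prime: "o_prime P" and P_nonzero: "P \<noteq> {0}"
begin

lemma P_maximal: "o_maximal P"
  using o_prime_imp_maximal P_prime P_nonzero by blast

lemma P_ideal: "o_ideal P" and P_module: "o_module P" and one_notin_P: "1 \<notin> P"
  using P_prime by (auto simp: o_prime_def o_ideal_def)

lemma P_int: "x \<in> P \<Longrightarrow> algebraic_int x"
  using P_ideal by (simp add: o_ideal_def)

text \<open>In a dual basis of P the products u_i w_i add up to 1, so one of them is outside P. Its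
  w_i generates P locally with denominator s = u_i w_i, since s x = w_i (u_i x).\<close>

lemma ex_local_uniformizer:
  "\<exists>w. w \<in> P \<and> w \<noteq> 0 \<and> (\<exists>s. algebraic_int s \<and> s \<notin> P \<and> (\<forall>x\<in>P. \<exists>y. algebraic_int y \<and> s * x = w * y))"
proof -
  have "o_invertible P" using o_ideal_invertible P_ideal P_nonzero by blast
  then obtain n :: nat and u w where uw: "\<And>i. i < n \<Longrightarrow> u i \<in> o_inv P" "\<And>i. i < n \<Longrightarrow> w i \<in> P"
    "(\<Sum>i<n. u i * w i) = 1" by (rule o_invertibleE) blast
  obtain i where i: "i < n" "u i * w i \<notin> P"
    using o_module_sum[OF P_module, of "{..<n}" "\<lambda>i. u i * w i"] uw(3) one_notin_P by auto
  have "w i \<noteq> 0" using i o_module_0[OF P_module] by auto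
  moreover have "algebraic_int (u i * w i)" using uw i by (auto simp: o_inv_def)
  moreover have "\<exists>y. algebraic_int y \<and> u i * w i * x = w i * y" if "x \<in> P" for x
    using uw(1)[OF i(1)] that by (intro exI[of _ "u i * x"]) (auto simp: o_inv_def)
  ultimately show ?thesis using uw i by blast
qed

definition unif :: 'k where
  "unif = (SOME w. w \<in> P \<and> w \<noteq> 0 \<and> (\<exists>s. algebraic_int s \<and> s \<notin> P \<and> (\<forall>x\<in>P. \<exists>y. algebraic_int y \<and> s * x = w * y)))"

lemma unif: "unif \<in> P" "unif \<noteq> 0"
  "\<exists>s. algebraic_int s \<and> s \<notin> P \<and> (\<forall>x\<in>P. \<exists>y. algebraic_int y \<and> s * x = unif * y)"
  using someI_ex[OF ex_local_uniformizer] unfolding unif_def[symmetric] by auto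

text \<open>\<open>ord_ge n x\<close> says that \<open>x\<close> has valuation at least \<open>n\<close>.\<close>

definition ord_ge :: "int \<Rightarrow> 'k \<Rightarrow> bool" where
  "ord_ge n x \<longleftrightarrow> (\<exists>s y. algebraic_int s \<and> s \<notin> P \<and> algebraic_int y \<and> s * x = unif powi n * y)"

lemma ord_geI: "algebraic_int s \<Longrightarrow> s \<notin> P \<Longrightarrow> algebraic_int y \<Longrightarrow> s * x = unif powi n * y \<Longrightarrow> ord_ge n x"
  unfolding ord_ge_def by blast

lemma notin_P_mult:
  "algebraic_int x \<Longrightarrow> x \<notin> P \<Longrightarrow> algebraic_int y \<Longrightarrow> y \<notin> P \<Longrightarrow> x * y \<notin> P"
  using P_prime unfolding o_prime_def by blast

lemma ord_ge_add:
  assumes "ord_ge n x" "ord_ge n y"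
  shows "ord_ge n (x + y)"
proof -
  obtain s a t b where s: "algebraic_int s" "s \<notin> P" "algebraic_int a" "s * x = unif powi n * a"
    "algebraic_int t" "t \<notin> P" "algebraic_int b" "t * y = unif powi n * b"
    using assms unfolding ord_ge_def by blast
  have "s * t * (x + y) = t * (s * x) + s * (t * y)" by (simp add: algebra_simps)
  also have "\<dots> = unif powi n * (t * a + s * b)" unfolding s(4,8) by (simp add: algebra_simps)
  finally show ?thesis
    using s by (intro ord_geI[of "s * t" "t * a + s * b"] notin_P_mult algebraic_int_mult algebraic_int_add) auto
qed

lemma ord_ge_mult:
  assumes "ord_ge m x" "ord_ge n y"
  shows "ord_ge (m + n) (x * y)"
proof -
  obtain s a t b where s: "algebraic_int s" "s \<notin> P" "algebraic_int a" "s * x = unif powi m * a"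
    "algebraic_int t" "t \<notin> P" "algebraic_int b" "t * y = unif powi n * b"
    using assms unfolding ord_ge_def by blast
  have "s * t * (x * y) = (s * x) * (t * y)" by (simp add: mult_ac)
  also have "\<dots> = unif powi (m + n) * (a * b)" unfolding s(4,8) using unif by (simp add: power_int_add mult_ac)
  finally show ?thesis
    using s by (intro ord_geI[of "s * t" "a * b"] notin_P_mult algebraic_int_mult) auto
qed

lemma ord_ge_0: "ord_ge n 0"
  by (rule ord_geI[of 1 0]) (use one_notin_P in auto)

lemma ord_ge_int: "algebraic_int x \<Longrightarrow> ord_ge 0 x"
  by (rule ord_geI[of 1 x]) (use one_notin_P in auto)

lemma ord_ge_P: "x \<in> P \<Longrightarrow> ord_ge 1 x"
  using unif(3) by (force intro: ord_geI)

lemma ord_ge_mono: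
  assumes "ord_ge n x" "m \<le> n"
  shows "ord_ge m x"
proof -
  have "unif powi (n - m) = unif ^ nat (n - m)" using assms(2) by (simp add: power_int_def)
  then have "ord_ge 0 (unif powi (n - m))"
    by (simp add: ord_ge_int algebraic_int_power P_int unif)
  then obtain s a where a: "algebraic_int s" "s \<notin> P" "algebraic_int a" "s * x = unif powi n * a"
    using assms unfolding ord_ge_def by blast
  have "unif powi n = unif powi m * unif ^ nat (n - m)"
    using assms(2) unif by (simp add: power_int_add[symmetric] flip: \<open>unif powi (n - m) = _\<close>)
  then show ?thesis
    using a by (intro ord_geI[of s "unif ^ nat (n - m) * a"])
      (auto simp: mult_ac intro: algebraic_int_mult algebraic_int_power P_int unif)
qed

text \<open>If t inverts s modulo P, then (1 - s t)^n lies in P^n and expands to 1 - s q.\<close>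

lemma ex_inverse_mod_power:
  assumes "algebraic_int s" "s \<notin> P"
  shows "\<exists>q. algebraic_int q \<and> 1 - s * q \<in> o_power P n"
proof -
  obtain t where t: "algebraic_int t" "1 - s * t \<in> P"
    using P_maximal assms unfolding o_maximal_def by blast
  have "\<exists>q. algebraic_int q \<and> (1 - s * t) ^ n = 1 - s * q"
  proof (induction n)
    case (Suc n)
    then obtain q where q: "algebraic_int q" "(1 - s * t) ^ n = 1 - s * q" by blast
    have "(1 - s * t) ^ Suc n = 1 - s * (t + q - s * t * q)"
      by (simp add: q algebra_simps)
    then show ?case using q t assms
      by (intro exI[of _ "t + q - s * t * q"] conjI algebraic_int_diff algebraic_int_add algebraic_int_mult)
  qed (auto intro: exI[of _ 0])
  then show ?thesis using power_mem_o_power[OF t(2), of n] by auto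
qed

text \<open>The link between ideal powers and the valuation. A denominator s outside P can be
  removed because it is invertible modulo P^n: x = x (1 - s q) + q (s x).\<close>

lemma mem_o_power_iff: "x \<in> o_power P n \<longleftrightarrow> algebraic_int x \<and> ord_ge (int n) x"
proof
  have ord: "ord_ge (int n) x" if "x \<in> o_power P n" for n x
    using that
  proof (induction n arbitrary: x)
    case 0
    then show ?case by (auto simp: o_power_0 ord_ge_int)
  next
    case (Suc n)
    from Suc.prems have "x \<in> ideal_prod \<O> (o_power P n) P" by (simp add: o_power_Suc)
    then show ?case
    proof (induction rule: ideal_prod.induct)
      case (prod i j)
      then show ?case using ord_ge_mult[OF Suc.IH[of i] ord_ge_P[of j]] by (simp add: add.commute)
    qed (auto intro: ord_ge_add)
  qed
  assume "x \<in> o_power P n"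
  then show "algebraic_int x \<and> ord_ge (int n) x"
    using ord o_ideal_o_power[OF P_ideal] by (auto simp: o_ideal_def)
next
  assume x: "algebraic_int x \<and> ord_ge (int n) x"
  have M: "o_module (o_power P n)" using o_ideal_o_power[OF P_ideal] by (simp add: o_ideal_def)
  from x obtain s y where s: "algebraic_int s" "s \<notin> P" "algebraic_int y" "s * x = unif ^ n * y"
    by (auto simp: ord_ge_def)
  obtain q where q: "algebraic_int q" "1 - s * q \<in> o_power P n" using ex_inverse_mod_power s by blast
  have "x = x * (1 - s * q) + q * (s * x)" by (simp add: algebra_simps)
  also have "\<dots> \<in> o_power P n"
    unfolding s(4) using x q s power_mem_o_power[OF unif(1)]
    by (intro o_module_add[OF M] o_module_mult[OF M] o_module_mult'[OF M]) auto
  finally show "x \<in> o_power P n" .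
qed

definition has_ord :: "int \<Rightarrow> 'k \<Rightarrow> bool" where
  "has_ord n x \<longleftrightarrow> (\<exists>u w. algebraic_int u \<and> u \<notin> P \<and> algebraic_int w \<and> w \<notin> P \<and> x = unif powi n * u / w)"

lemma notin_P_nonzero: "u \<notin> P \<Longrightarrow> u \<noteq> 0"
  using o_module_0[OF P_module] by auto

lemma has_ord_nonzero: "has_ord n x \<Longrightarrow> x \<noteq> 0"
  using unif by (auto simp: has_ord_def dest: notin_P_nonzero)

lemma has_ord_mult:
  assumes "has_ord m x" "has_ord n y"
  shows "has_ord (m + n) (x * y)"
proof -
  obtain u w u' w' where "algebraic_int u" "u \<notin> P" "algebraic_int w" "w \<notin> P" "x = unif powi m * u / w"
    "algebraic_int u'" "u' \<notin> P" "algebraic_int w'" "w' \<notin> P" "y = unif powi n * u' / w'"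
    using assms unfolding has_ord_def by blast
  then show ?thesis unfolding has_ord_def
    by (intro exI[of _ "u * u'"] exI[of _ "w * w'"]) 
       (auto simp: power_int_add unif intro: algebraic_int_mult dest: notin_P_mult)
qed

lemma has_ord_inverse: "has_ord n x \<Longrightarrow> has_ord (- n) (inverse x)"
  unfolding has_ord_def
proof (elim exE conjE)
  fix u w assume "algebraic_int u" "u \<notin> P" "algebraic_int w" "w \<notin> P" "x = unif powi n * u / w"
  then show "\<exists>u w. algebraic_int u \<and> u \<notin> P \<and> algebraic_int w \<and> w \<notin> P \<and> inverse x = unif powi (- n) * u / w"
    by (intro exI[of _ w] exI[of _ u]) (simp add: power_int_minus field_simps)
qed

lemma has_ord_divide: "has_ord m x \<Longrightarrow> has_ord n y \<Longrightarrow> has_ord (m - n) (x / y)"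
  using has_ord_mult[of m x "- n" "inverse y"] has_ord_inverse by (simp add: field_simps)

lemma has_ord_imp_ord_ge: "has_ord n x \<Longrightarrow> ord_ge n x"
  unfolding has_ord_def
proof (elim exE conjE)
  fix u w assume "algebraic_int u" "u \<notin> P" "algebraic_int w" "w \<notin> P" "x = unif powi n * u / w"
  then show "ord_ge n x" by (intro ord_geI[of w u]) (simp_all add: notin_P_nonzero)
qed

lemma has_ord_not_ord_ge:
  assumes "has_ord n x" "n < m"
  shows "\<not> ord_ge m x"
proof
  assume "ord_ge m x"
  then have "ord_ge (n + 1) x" using ord_ge_mono[of m x "n + 1"] assms(2) by simp
  then obtain s y where s: "algebraic_int s" "s \<notin> P" "algebraic_int y" "s * x = unif powi (n + 1) * y"
    by (auto simp: ord_ge_def)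
  obtain u w where uw: "algebraic_int u" "u \<notin> P" "algebraic_int w" "w \<notin> P" "x = unif powi n * u / w"
    using assms unfolding has_ord_def by blast
  have "w \<noteq> 0" using uw notin_P_nonzero by blast
  then have "unif powi n * (s * u) = unif powi n * (unif * (y * w))"
    using s(4) uw(5) unif by (simp add: power_int_add field_simps)
  then have "s * u = unif * (y * w)" using unif by simp
  also have "\<dots> \<in> P" using unif s uw by (intro o_module_mult'[OF P_module]) (auto intro: algebraic_int_mult)
  finally show False using notin_P_mult s uw by blast
qed

lemma has_ord_unique: "has_ord m x \<Longrightarrow> has_ord n x \<Longrightarrow> m = n"
  using has_ord_not_ord_ge has_ord_imp_ord_ge by (metis linorder_neqE_linordered_idom)

text \<open>Only finitely many ideals contain x, while the powers of P are pairwise distinct, as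
  unif^m is in P^m but not in P^n for n > m. So x drops out of some power, and the last power
  containing it gives the valuation.\<close>

lemma ex_has_ord_int:
  assumes "algebraic_int x" "x \<noteq> 0"
  shows "\<exists>n. has_ord (int n) x"
proof -
  have "\<exists>n. x \<notin> o_power P n"
  proof (rule ccontr)
    assume "\<not> ?thesis"
    then have "range (o_power P) \<subseteq> {I. o_ideal I \<and> x \<in> I}"
      using o_ideal_o_power[OF P_ideal] by auto
    then have "finite (range (o_power P))"
      using finite_ideals_containing[OF assms] by (rule finite_subset)
    then have "\<not> inj (o_power P)" using finite_imageD by auto
    then obtain m n where mn: "m < n" "o_power P m = o_power P n"
      by (metis injI linorder_neqE_nat)
    have "unif ^ m \<in> o_power P n" using power_mem_o_power[OF unif(1)] mn(2) by auto
    then have "ord_ge (int n) (unif powi int m)" by (simp add: mem_o_power_iff)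
    moreover have "has_ord (int m) (unif powi int m)"
      unfolding has_ord_def using one_notin_P by (intro exI[of _ 1]) auto
    ultimately show False using has_ord_not_ord_ge mn(1) by (metis of_nat_less_iff)
  qed
  moreover have "x \<in> o_power P 0" using assms by (simp add: o_power_0)
  ultimately obtain n where n: "x \<in> o_power P n" "x \<notin> o_power P (Suc n)"
    using nat_induct[of "\<lambda>n. x \<in> o_power P n"] by blast
  obtain s y where s: "algebraic_int s" "s \<notin> P" "algebraic_int y" "s * x = unif powi (int n) * y"
    using n(1) unfolding mem_o_power_iff ord_ge_def by blast
  have "y \<notin> P"
  proof
    assume "y \<in> P"
    then obtain t z where t: "algebraic_int t" "t \<notin> P" "algebraic_int z" "t * y = unif * z"
      using ord_ge_P[of y] unfolding ord_ge_def by auto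
    have "(t * s) * x = unif powi (int (Suc n)) * z"
    proof -
      have "(t * s) * x = unif ^ n * (t * y)" using s(4) by (simp add: mult_ac)
      then show ?thesis unfolding t(4) by (simp add: mult_ac power_int_def nat_add_distrib)
    qed
    then have "ord_ge (int (Suc n)) x"
      using s t by (intro ord_geI[of "t * s" z]) (auto intro: algebraic_int_mult dest: notin_P_mult)
    then show False using n(2) assms by (simp add: mem_o_power_iff)
  qed
  then have "has_ord (int n) x"
    unfolding has_ord_def using s notin_P_nonzero[OF s(2)]
    by (intro exI[of _ y] exI[of _ s]) (auto simp: field_simps)
  then show ?thesis by blast
qed

lemma ex_has_ord:
  assumes "x \<noteq> 0"
  shows "\<exists>n. has_ord n x"
proof -
  obtain a b where ab: "algebraic_int a" "a \<noteq> 0" "algebraic_int b" "b \<noteq> 0" "x = a / b"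
    using quotient_of_integers[OF assms] by blast
  then show ?thesis using ex_has_ord_int has_ord_divide by metis
qed

lemma ideal_ord_eq:
  assumes "has_ord (int n) x" "algebraic_int x"
  shows "ideal_ord P x = n"
  unfolding ideal_ord_def o_power_def[symmetric]
proof (rule Greatest_equality)
  show "x \<in> o_power P n" using assms by (simp add: mem_o_power_iff has_ord_imp_ord_ge)
  fix m assume "x \<in> o_power P m"
  then have "ord_ge (int m) x" by (simp add: mem_o_power_iff)
  then show "m \<le> n" using has_ord_not_ord_ge[OF assms(1)] by (meson not_less of_nat_less_iff)
qed

text \<open>The fraction representing x is not unique, but additivity of the valuation makes all of
  them give the same difference.\<close>

lemma padic_ord_eq:
  assumes "has_ord n x"
  shows "padic_ord P x = n"
  unfolding padic_ord_def
proof (rule the_equality)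
  have key: "k = n" if "a \<in> carrier \<O> - {0}" "b \<in> carrier \<O> - {0}" "x = a / b"
    "k = int (ideal_ord P a) - int (ideal_ord P b)" for a b k
  proof -
    have "algebraic_int a" "a \<noteq> 0" "algebraic_int b" "b \<noteq> 0" using that by auto
    then obtain i j where ij: "has_ord (int i) a" "has_ord (int j) b"
      using ex_has_ord_int by meson
    then have "k = int i - int j" using that ideal_ord_eq by auto
    then show ?thesis using has_ord_divide[OF ij] has_ord_unique assms that(3) by blast
  qed
  obtain a b where ab: "algebraic_int a" "a \<noteq> 0" "algebraic_int b" "b \<noteq> 0" "x = a / b"
    using quotient_of_integers[OF has_ord_nonzero[OF assms]] by blast
  then show "\<exists>a\<in>carrier \<O> - {0}. \<exists>b\<in>carrier \<O> - {0}. x = a / b \<and> n = int (ideal_ord P a) - int (ideal_ord P b)"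
    using key[of a b] by auto
  fix k assume "\<exists>a\<in>carrier \<O> - {0}. \<exists>b\<in>carrier \<O> - {0}. x = a / b \<and> k = int (ideal_ord P a) - int (ideal_ord P b)"
  then show "k = n" using key by blast
qed

lemma padic_abs_0 [simp]: "padic_abs P 0 = 0"
  by (simp add: padic_abs_def)

lemma padic_abs_has_ord: "has_ord n x \<Longrightarrow> padic_abs P x = 2 powi (- n)"
  using has_ord_nonzero[of n x] padic_ord_eq by (simp add: padic_abs_def)

lemma padic_abs_nonneg: "padic_abs P x \<ge> 0"
  by (simp add: padic_abs_def)

lemma padic_abs_eq_0_iff [simp]: "padic_abs P x = 0 \<longleftrightarrow> x = 0"
  by (simp add: padic_abs_def)

lemma padic_abs_mult: "padic_abs P (x * y) = padic_abs P x * padic_abs P y"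
proof (cases "x = 0 \<or> y = 0")
  case False
  then obtain m n where "has_ord m x" "has_ord n y" using ex_has_ord by blast
  then show ?thesis
    using has_ord_mult[of m x n y] by (simp add: padic_abs_has_ord power_int_add[symmetric])
qed auto

lemma padic_abs_le_iff: "padic_abs P x \<le> 2 powi (- n) \<longleftrightarrow> ord_ge n x"
proof (cases "x = 0")
  case False
  then obtain m where m: "has_ord m x" using ex_has_ord by blast
  have "padic_abs P x \<le> 2 powi (- n) \<longleftrightarrow> n \<le> m"
    unfolding padic_abs_has_ord[OF m] by simp
  also have "\<dots> \<longleftrightarrow> ord_ge n x"
    using has_ord_imp_ord_ge[OF m] ord_ge_mono has_ord_not_ord_ge[OF m] by (meson not_less)
  finally show ?thesis .
qed (simp add: ord_ge_0)

lemma padic_abs_value: "x \<noteq> 0 \<Longrightarrow> \<exists>n. padic_abs P x = 2 powi n"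
  by (auto simp: padic_abs_def)

lemma padic_abs_add: "padic_abs P (x + y) \<le> max (padic_abs P x) (padic_abs P y)"
proof -
  have *: "padic_abs P (x + y) \<le> padic_abs P x"
    if "padic_abs P y \<le> padic_abs P x" for x y
  proof (cases "x = 0")
    case False
    then obtain n' where "padic_abs P x = 2 powi n'" using padic_abs_value[of x] by blast
    then obtain n where n: "padic_abs P x = 2 powi (- n)" by (metis minus_minus)
    then have "ord_ge n x" "ord_ge n y" using that by (auto simp flip: padic_abs_le_iff)
    then show ?thesis using ord_ge_add n padic_abs_le_iff by metis
  qed (use that padic_abs_nonneg[of y] in auto)
  show ?thesis
    using *[of x y] *[of y x] by (cases "padic_abs P y \<le> padic_abs P x") (auto simp: add.commute)
qed

lemma padic_abs_1 [simp]: "padic_abs P 1 = 1"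
  using padic_abs_mult[of 1 1] by (metis mult_cancel_right2 mult_1 padic_abs_eq_0_iff zero_neq_one)

lemma padic_abs_minus [simp]: "padic_abs P (- x) = padic_abs P x"
proof -
  have "padic_abs P (-1) * padic_abs P (-1) = 1"
    by (simp flip: padic_abs_mult)
  then have "padic_abs P (-1) = 1"
    using padic_abs_nonneg[of "-1"] by (metis abs_of_nonneg abs_square_eq_1 power2_eq_square)
  then show ?thesis using padic_abs_mult[of "-1" x] by simp
qed

lemma padic_abs_diff: "padic_abs P (x - y) \<le> max (padic_abs P x) (padic_abs P y)"
  using padic_abs_add[of x "- y"] by simp

lemma padic_abs_int: "algebraic_int x \<Longrightarrow> padic_abs P x \<le> 1"
  using padic_abs_le_iff[of x 0] ord_ge_int by simp

lemma mem_o_power_iff_abs: "algebraic_int x \<Longrightarrow> x \<in> o_power P n \<longleftrightarrow> padic_abs P x \<le> 2 powi (- int n)"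
  by (simp add: mem_o_power_iff padic_abs_le_iff)

lemma padic_abs_unif: "padic_abs P unif = 1 / 2"
proof -
  have "has_ord 1 unif" unfolding has_ord_def using one_notin_P by (intro exI[of _ 1]) auto
  then show ?thesis by (simp add: padic_abs_has_ord power_int_minus field_simps)
qed

lemma padic_abs_unit:
  assumes "u \<in> Units \<O>"
  shows "padic_abs P u = 1"
proof -
  have "padic_abs P u * padic_abs P (inverse u) = 1"
    using assms by (simp flip: padic_abs_mult add: Units_int_ring)
  moreover have "padic_abs P u \<le> 1" "padic_abs P (inverse u) \<le> 1"
    using assms by (auto simp: Units_int_ring intro: padic_abs_int)
  ultimately show ?thesis
    by (metis mult_left_le_one_le mult_right_le_one_le nle_le padic_abs_nonneg)
qed

text \<open>Integers are dense in the local ring: in z = y / s the denominator is replaced by an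
  inverse modulo P^n.\<close>

lemma padic_abs_approx:
  assumes "padic_abs P z \<le> 1"
  shows "\<exists>c. algebraic_int c \<and> padic_abs P (z - c) \<le> 2 powi (- int n)"
proof -
  have "ord_ge 0 z" using assms padic_abs_le_iff[of z 0] by simp
  then obtain s y where s: "algebraic_int s" "s \<notin> P" "algebraic_int y" "s * z = y"
    by (auto simp: ord_ge_def)
  obtain q where q: "algebraic_int q" "1 - s * q \<in> o_power P n" using ex_inverse_mod_power s by blast
  have "algebraic_int (1 - s * q)" using q s by (intro algebraic_int_diff algebraic_int_mult) auto
  then have "padic_abs P (1 - s * q) \<le> 2 powi (- int n)" using q(2) by (simp add: mem_o_power_iff_abs)
  moreover have "z - y * q = z * (1 - s * q)" using s(4) by (simp add: algebra_simps)
  ultimately have "padic_abs P (z - y * q) \<le> 1 * 2 powi (- int n)"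
    using assms by (simp only: padic_abs_mult) (intro mult_mono padic_abs_nonneg, auto)
  then show ?thesis using s q by (intro exI[of _ "y * q"]) (auto intro: algebraic_int_mult)
qed

end

lemma o_ideal_finprod:
  fixes I :: "'i \<Rightarrow> 'k::field_char_0 set"
  assumes "finite A" "\<And>i. i \<in> A \<Longrightarrow> o_ideal (I i)"
  shows "o_ideal (\<Otimes>\<^bsub>ideals_set \<O>\<^esub>i\<in>A. I i)"
    and "\<And>x. (\<And>i. i \<in> A \<Longrightarrow> x i \<in> I i) \<Longrightarrow> (\<Prod>i\<in>A. x i) \<in> (\<Otimes>\<^bsub>ideals_set \<O>\<^esub>i\<in>A. I i)"
    and "\<And>i. i \<in> A \<Longrightarrow> (\<Otimes>\<^bsub>ideals_set \<O>\<^esub>i\<in>A. I i) \<subseteq> I i"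
proof -
  interpret R: cring "\<O> :: 'k ring" by (rule cring_int_ring)
  interpret M: Group.comm_monoid "ideals_set (\<O> :: 'k ring)" by (rule R.ideals_set_is_comm_monoid)
  let ?P = "\<lambda>A. \<Otimes>\<^bsub>ideals_set \<O>\<^esub>i\<in>A. I i"
  have "o_ideal (?P A) \<and> (\<forall>x. (\<forall>i\<in>A. x i \<in> I i) \<longrightarrow> (\<Prod>i\<in>A. x i) \<in> ?P A) \<and> (\<forall>i\<in>A. ?P A \<subseteq> I i)"
    using assms
  proof (induction A rule: finite_induct)
    case empty
    \<comment> \<open>The empty product is the unit ideal, written as a zeroth power to unfold
      it.\<close>
    have "?P {} = o_power {} 0" by (simp add: o_power_0)
    then show ?case
      by (auto simp: o_power_0 o_ideal_def o_module_def intro: algebraic_int_add algebraic_int_mult)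
  next
    case (insert j A)
    have eq: "?P (insert j A) = ideal_prod \<O> (I j) (?P A)"
      using insert by (subst M.finprod_insert) (auto simp: ideal_iff_o_ideal)
    have IH: "o_ideal (?P A)" "\<And>x. (\<And>i. i \<in> A \<Longrightarrow> x i \<in> I i) \<Longrightarrow> (\<Prod>i\<in>A. x i) \<in> ?P A" "\<And>i. i \<in> A \<Longrightarrow> ?P A \<subseteq> I i"
      using insert by auto
    have "?P (insert j A) \<subseteq> I j \<inter> ?P A"
      unfolding eq using insert.prems IH(1) by (intro R.ideal_prod_inter) (auto simp: ideal_iff_o_ideal)
    moreover have "o_ideal (?P (insert j A))"
      unfolding eq using insert.prems IH(1) by (intro o_ideal_ideal_prod) auto
    moreover have "(\<Prod>i\<in>insert j A. x i) \<in> ?P (insert j A)" if "\<forall>i\<in>insert j A. x i \<in> I i" for x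
    proof -
      have "x j * (\<Prod>i\<in>A. x i) \<in> ideal_prod \<O> (I j) (?P A)"
        using ideal_prod.prod[of "x j" "I j" "\<Prod>i\<in>A. x i" "?P A" \<O>] IH(2)[of x] that by simp
      then show ?thesis unfolding eq using insert.hyps by simp
    qed
    ultimately show ?case using IH(3) by blast
  qed
  then show "o_ideal (?P A)" "\<And>x. (\<And>i. i \<in> A \<Longrightarrow> x i \<in> I i) \<Longrightarrow> (\<Prod>i\<in>A. x i) \<in> ?P A"
     "\<And>i. i \<in> A \<Longrightarrow> ?P A \<subseteq> I i" by auto
qed

section \<open>Factorization of a principal ideal and simultaneous congruences\<close>

locale prime_family = number_field_type K for K :: "'k::field_char_0 itself" +
  fixes A :: "'i set" and P :: "'i \<Rightarrow> 'k set" and e :: "'i \<Rightarrow> nat"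
  assumes finite_A: "finite A"
    and primes: "\<And>i. i \<in> A \<Longrightarrow> prime_place K (P i)"
    and inj_P: "inj_on P A"
begin

lemma avoid: "i \<in> A \<Longrightarrow> o_maximal Q \<Longrightarrow> P i \<noteq> Q \<Longrightarrow> \<exists>x. x \<in> P i \<and> x \<notin> Q"
  using o_maximal_avoid[of Q "P i"] prime_place.P_maximal[OF primes] by blast

text \<open>The product of the x_i stays outside Q; it serves as a denominator at Q that clears the
  powers of all other primes.\<close>

lemma coprime_element:
  assumes "o_maximal Q"
  shows "\<exists>x. (\<forall>i\<in>A. P i \<noteq> Q \<longrightarrow> x i \<in> o_power (P i) (e i)) \<and> (\<forall>i\<in>A. algebraic_int (x i) \<and> x i \<notin> Q)"
proof -
  have Q: "o_prime Q" using assms by (rule o_maximal_imp_prime)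
  have "\<exists>y. (P i \<noteq> Q \<longrightarrow> y \<in> o_power (P i) (e i)) \<and> algebraic_int y \<and> y \<notin> Q" if i: "i \<in> A" for i
  proof (cases "P i = Q")
    case True
    then show ?thesis using assms by (intro exI[of _ 1]) (auto simp: o_maximal_def)
  next
    case False
    then obtain x where x: "x \<in> P i" "x \<notin> Q" using avoid[OF i assms] by blast
    then have "algebraic_int x" using prime_place.P_int[OF primes[OF i]] by blast
    then show ?thesis using x Q
      by (intro exI[of _ "x ^ e i"]) (auto intro: power_mem_o_power algebraic_int_power dest: o_prime_power_notin)
  qed
  then obtain x where "\<And>i. i \<in> A \<Longrightarrow> (P i \<noteq> Q \<longrightarrow> x i \<in> o_power (P i) (e i)) \<and> algebraic_int (x i) \<and> x i \<notin> Q"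
    by metis
  then show ?thesis by (intro exI[of _ x]) simp
qed

lemma o_ideal_power: "i \<in> A \<Longrightarrow> o_ideal (o_power (P i) (e i))"
  using prime_place.P_ideal[OF primes] by (rule o_ideal_o_power)

text \<open>Intersection equals product for powers of distinct primes. The multipliers of y into the
  product form an ideal containing a. If it were proper, it would lie in a maximal Q, but
  \<open>coprime_element\<close> provides a multiplier outside Q, the factor at Q, if there is one,
  being supplied by y itself.\<close>

lemma mem_finprod_iff:
  assumes a: "(\<Otimes>\<^bsub>ideals_set \<O>\<^esub>i\<in>A. o_power (P i) (e i)) = {a * x |x. algebraic_int x}"
    and nz: "a \<noteq> 0" "algebraic_int a"
  shows "(\<exists>x. algebraic_int x \<and> y = a * x) \<longleftrightarrow> algebraic_int y \<and> (\<forall>i\<in>A. y \<in> o_power (P i) (e i))"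
proof
  assume "\<exists>x. algebraic_int x \<and> y = a * x"
  then have "y \<in> (\<Otimes>\<^bsub>ideals_set \<O>\<^esub>i\<in>A. o_power (P i) (e i))" "algebraic_int y"
    unfolding a using nz by (auto intro: algebraic_int_mult)
  then show "algebraic_int y \<and> (\<forall>i\<in>A. y \<in> o_power (P i) (e i))"
    using o_ideal_finprod(3)[OF finite_A, of "\<lambda>i. o_power (P i) (e i)"] o_ideal_power by blast
next
  assume y: "algebraic_int y \<and> (\<forall>i\<in>A. y \<in> o_power (P i) (e i))"
  let ?I = "\<Otimes>\<^bsub>ideals_set \<O>\<^esub>i\<in>A. o_power (P i) (e i)"
  have I: "o_module ?I"
    using o_ideal_finprod(1)[OF finite_A, of "\<lambda>i. o_power (P i) (e i)"] o_ideal_power by (simp add: o_ideal_def)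
  define J where "J = {c. algebraic_int c \<and> c * y \<in> ?I}"
  have J: "o_ideal J"
    unfolding o_ideal_def o_module_def J_def
    using o_module_0[OF I] o_module_add[OF I] o_module_mult[OF I]
    by (auto simp: algebra_simps intro: algebraic_int_add algebraic_int_mult)
  have aJ: "a \<in> J" unfolding J_def a using y nz by blast
  have "1 \<in> J"
  proof (rule ccontr)
    assume "1 \<notin> J"
    then obtain Q where Q: "o_maximal Q" "J \<subseteq> Q" using exists_maximal[OF J _ aJ nz(1)] by blast
    have Q': "o_prime Q" using Q(1) by (rule o_maximal_imp_prime)
    obtain x where x: "\<And>i. i \<in> A \<Longrightarrow> P i \<noteq> Q \<Longrightarrow> x i \<in> o_power (P i) (e i)" "\<And>i. i \<in> A \<Longrightarrow> algebraic_int (x i) \<and> x i \<notin> Q"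
      using coprime_element[OF Q(1)] by blast
    define c where "c = (\<Prod>i\<in>A. x i)"
    have c: "algebraic_int c" "c \<notin> Q"
      unfolding c_def using x(2) by (auto intro!: algebraic_int_prod o_prime_prod_notin[OF Q'])
    have "c * y \<in> ?I"
    proof (cases "\<exists>j\<in>A. P j = Q")
      case True
      then obtain j where j: "j \<in> A" "P j = Q" by blast
      \<comment> \<open>With y as the factor at j the element lies in the product; multiplying by
        x_j, which is outside Q, makes it c y.\<close>
      have "(\<Prod>i\<in>A. (x(j := y)) i) \<in> ?I"
      proof (rule o_ideal_finprod(2)[OF finite_A o_ideal_power])
        fix i assume i: "i \<in> A"
        show "(x(j := y)) i \<in> o_power (P i) (e i)"
        proof (cases "i = j")
          case False
          then have "P i \<noteq> Q" using j i inj_onD[OF inj_P _ i j(1)] by metis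
          then show ?thesis using x(1)[OF i] False by simp
        qed (use y j(1) in simp)
      qed
      from o_module_mult[OF I conjunct1[OF x(2)[OF j(1)]] this]
      have "x j * (\<Prod>i\<in>A. (x(j := y)) i) \<in> ?I" .
      also have "(\<Prod>i\<in>A. (x(j := y)) i) = y * (\<Prod>i\<in>A - {j}. x i)"
        using prod.remove[OF finite_A j(1), of "x(j := y)"] by simp
      also have "x j * (y * (\<Prod>i\<in>A - {j}. x i)) = c * y"
        unfolding c_def using j finite_A by (subst prod.remove[of A j]) (auto simp: mult_ac)
      finally show ?thesis .
    next
      case False
      then have "c \<in> ?I"
        unfolding c_def using x(1) by (intro o_ideal_finprod(2)[OF finite_A o_ideal_power]) auto
      then show ?thesis using y by (intro o_module_mult'[OF I]) auto
    qed
    then have "c \<in> J" using c by (simp add: J_def)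
    then show False using Q(2) c(2) by blast
  qed
  then have "y \<in> ?I" by (simp add: J_def)
  then show "\<exists>x. algebraic_int x \<and> y = a * x" unfolding a by blast
qed

text \<open>An element outside P_i that lies in all other powers, multiplied by its inverse modulo
  the i-th power, is congruent to 1 there and to 0 elsewhere; these are the weights for the
  z_i.\<close>

lemma chinese_remainder:
  assumes z: "\<And>i. i \<in> A \<Longrightarrow> algebraic_int (z i)"
  shows "\<exists>c. algebraic_int c \<and> (\<forall>i\<in>A. c - z i \<in> o_power (P i) (e i))"
proof -
  have "\<exists>y. algebraic_int y \<and> 1 - y \<in> o_power (P i) (e i) \<and> (\<forall>j\<in>A. j \<noteq> i \<longrightarrow> y \<in> o_power (P j) (e j))"
    if i: "i \<in> A" for i
  proof -
    interpret Pi: prime_place K "P i" by (rule primes[OF i])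
    obtain x where x: "\<And>j. j \<in> A \<Longrightarrow> P j \<noteq> P i \<Longrightarrow> x j \<in> o_power (P j) (e j)" "\<And>j. j \<in> A \<Longrightarrow> algebraic_int (x j) \<and> x j \<notin> P i"
      using coprime_element[OF Pi.P_maximal] by blast
    define c where "c = (\<Prod>j\<in>A. x j)"
    have c: "algebraic_int c" "c \<notin> P i"
      unfolding c_def using x(2) by (auto intro!: algebraic_int_prod o_prime_prod_notin[OF Pi.P_prime])
    then obtain q where q: "algebraic_int q" "1 - c * q \<in> o_power (P i) (e i)"
      using Pi.ex_inverse_mod_power by blast
    have "c * q \<in> o_power (P j) (e j)" if j: "j \<in> A" "j \<noteq> i" for j
    proof -
      have M: "o_module (o_power (P j) (e j))" using o_ideal_power[OF j(1)] by (simp add: o_ideal_def)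
      have "P j \<noteq> P i" using j i inj_onD[OF inj_P] by blast
      then have "x j \<in> o_power (P j) (e j)" using x(1) j by blast
      then have "((\<Prod>k\<in>A-{j}. x k) * q) * x j \<in> o_power (P j) (e j)"
        using x(2) q by (intro o_module_mult[OF M] algebraic_int_mult algebraic_int_prod) auto
      moreover have "c * q = ((\<Prod>k\<in>A-{j}. x k) * q) * x j"
        unfolding c_def using j finite_A by (subst prod.remove[of A j]) (auto simp: mult_ac)
      ultimately show ?thesis by (simp only:)
    qed
    then show ?thesis using c q by (intro exI[of _ "c * q"]) (auto intro: algebraic_int_mult)
  qed
  then obtain y where y: "\<And>i. i \<in> A \<Longrightarrow> algebraic_int (y i)" "\<And>i. i \<in> A \<Longrightarrow> 1 - y i \<in> o_power (P i) (e i)"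
     "\<And>i j. i \<in> A \<Longrightarrow> j \<in> A \<Longrightarrow> j \<noteq> i \<Longrightarrow> y i \<in> o_power (P j) (e j)" by metis
  define c where "c = (\<Sum>i\<in>A. z i * y i)"
  have "c - z i \<in> o_power (P i) (e i)" if i: "i \<in> A" for i
  proof -
    have M: "o_module (o_power (P i) (e i))" using o_ideal_power[OF i] by (simp add: o_ideal_def)
    have "c = z i * y i + (\<Sum>j\<in>A-{i}. z j * y j)"
      unfolding c_def using i finite_A by (subst sum.remove[of A i]) auto
    then have "c - z i = (\<Sum>j\<in>A-{i}. z j * y j) - z i * (1 - y i)" by (simp add: algebra_simps)
    also have "\<dots> \<in> o_power (P i) (e i)"
    proof (rule o_module_diff[OF M])
      show "(\<Sum>j\<in>A-{i}. z j * y j) \<in> o_power (P i) (e i)"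
        using y z i by (intro o_module_sum[OF M] o_module_mult[OF M]) auto
      show "z i * (1 - y i) \<in> o_power (P i) (e i)"
        by (rule o_module_mult[OF M z[OF i] y(2)[OF i]])
    qed
    finally show ?thesis .
  qed
  moreover have "algebraic_int c" unfolding c_def using y z by (intro algebraic_int_sum algebraic_int_mult) auto
  ultimately show ?thesis by blast
qed

end

section \<open>Completions\<close>

context prime_place
begin

abbreviation cl :: "(nat \<Rightarrow> 'k) \<Rightarrow> (nat \<Rightarrow> 'k) set" where
  "cl s \<equiv> null_seqs P +>\<^bsub>cauchy_ring P\<^esub> s"

lemma cauchy_ring_simps [simp]:
  "s \<otimes>\<^bsub>cauchy_ring P\<^esub> t = (\<lambda>n. s n * t n)" "s \<oplus>\<^bsub>cauchy_ring P\<^esub> t = (\<lambda>n. s n + t n)"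
  "\<one>\<^bsub>cauchy_ring P\<^esub> = (\<lambda>_. 1)" "\<zero>\<^bsub>cauchy_ring P\<^esub> = (\<lambda>_. 0)"
  by (simp_all add: cauchy_ring_def)

lemma cauchy_ring_carrier:
  "s \<in> carrier (cauchy_ring P) \<longleftrightarrow> (\<forall>\<epsilon>>0. \<exists>N. \<forall>i\<ge>N. \<forall>j\<ge>N. padic_abs P (s i - s j) < \<epsilon>)"
  by (simp add: cauchy_ring_def)

lemma padic_abs_abs_diff_le: "\<bar>padic_abs P x - padic_abs P y\<bar> \<le> padic_abs P (x - y)"
proof -
  have "padic_abs P x \<le> max (padic_abs P (x - y)) (padic_abs P y)"
    using padic_abs_add[of "x - y" y] by simp
  moreover have "padic_abs P y \<le> max (padic_abs P (x - y)) (padic_abs P x)"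
    using padic_abs_diff[of x "x - y"] by (simp add: max.commute)
  ultimately show ?thesis
    using padic_abs_nonneg[of "x - y"] padic_abs_nonneg[of x] padic_abs_nonneg[of y] by linarith
qed

lemma cauchy_abs_convergent:
  assumes "s \<in> carrier (cauchy_ring P)"
  shows "convergent (\<lambda>n. padic_abs P (s n))"
proof -
  have "Cauchy (\<lambda>n. padic_abs P (s n))"
    unfolding Cauchy_def dist_real_def
    using assms padic_abs_abs_diff_le unfolding cauchy_ring_carrier by (meson le_less_trans)
  then show ?thesis by (simp add: Cauchy_convergent_iff)
qed

lemma null_seqs_iff: "s \<in> null_seqs P \<longleftrightarrow> (\<lambda>n. padic_abs P (s n)) \<longlonglongrightarrow> 0"
  by (simp add: null_seqs_def)

lemma null_seqs_cauchy: "null_seqs P \<subseteq> carrier (cauchy_ring P)"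
proof
  fix s assume s: "s \<in> null_seqs P"
  show "s \<in> carrier (cauchy_ring P)" unfolding cauchy_ring_carrier
  proof (intro allI impI)
    fix r :: real assume "r > 0"
    then obtain N where N: "\<And>n. n \<ge> N \<Longrightarrow> padic_abs P (s n) < r"
      using s unfolding null_seqs_iff LIMSEQ_iff by (auto simp: abs_of_nonneg padic_abs_nonneg)
    have "padic_abs P (s i - s j) < r" if "i \<ge> N" "j \<ge> N" for i j
      using padic_abs_diff[of "s i" "s j"] N[OF that(1)] N[OF that(2)] by linarith
    then show "\<exists>N. \<forall>i\<ge>N. \<forall>j\<ge>N. padic_abs P (s i - s j) < r" by blast
  qed
qed

lemma cauchy_add:
  assumes "s \<in> carrier (cauchy_ring P)" "t \<in> carrier (cauchy_ring P)"
  shows "(\<lambda>n. s n + t n) \<in> carrier (cauchy_ring P)"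
  unfolding cauchy_ring_carrier
proof (intro allI impI)
  fix r :: real assume "r > 0"
  then obtain M N where M: "\<And>i j. i \<ge> M \<Longrightarrow> j \<ge> M \<Longrightarrow> padic_abs P (s i - s j) < r"
    and N: "\<And>i j. i \<ge> N \<Longrightarrow> j \<ge> N \<Longrightarrow> padic_abs P (t i - t j) < r"
    using assms unfolding cauchy_ring_carrier by meson
  have "padic_abs P (s i + t i - (s j + t j)) < r" if "i \<ge> max M N" "j \<ge> max M N" for i j
    using padic_abs_add[of "s i - s j" "t i - t j"] M[of i j] N[of i j] that by (simp add: algebra_simps)
  then show "\<exists>N. \<forall>i\<ge>N. \<forall>j\<ge>N. padic_abs P (s i + t i - (s j + t j)) < r" by blast
qed

lemma cauchy_const: "(\<lambda>_. x) \<in> carrier (cauchy_ring P)"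
  by (auto simp: cauchy_ring_carrier)

lemma cauchy_bounded:
  assumes "s \<in> carrier (cauchy_ring P)"
  shows "\<exists>B>0. \<forall>n. padic_abs P (s n) \<le> B"
proof -
  have "Bseq (\<lambda>n. padic_abs P (s n))" using cauchy_abs_convergent[OF assms] by (rule convergent_imp_Bseq)
  then show ?thesis by (auto simp: Bseq_def abs_of_nonneg padic_abs_nonneg)
qed

lemma cauchy_mult:
  assumes "s \<in> carrier (cauchy_ring P)" "t \<in> carrier (cauchy_ring P)"
  shows "(\<lambda>n. s n * t n) \<in> carrier (cauchy_ring P)"
  unfolding cauchy_ring_carrier
proof (intro allI impI)
  fix r :: real assume r: "r > 0"
  obtain B where B: "B > 0" "\<And>n. padic_abs P (s n) \<le> B" using cauchy_bounded[OF assms(1)] by blast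
  obtain C where C: "C > 0" "\<And>n. padic_abs P (t n) \<le> C" using cauchy_bounded[OF assms(2)] by blast
  have "r / C > 0" "r / B > 0" using r B C by auto
  then obtain M N where M: "\<And>i j. i \<ge> M \<Longrightarrow> j \<ge> M \<Longrightarrow> padic_abs P (s i - s j) < r / C"
    and N: "\<And>i j. i \<ge> N \<Longrightarrow> j \<ge> N \<Longrightarrow> padic_abs P (t i - t j) < r / B"
    using assms unfolding cauchy_ring_carrier by meson
  have "padic_abs P (s i * t i - s j * t j) < r" if ij: "i \<ge> max M N" "j \<ge> max M N" for i j
  proof -
    have "padic_abs P (s i) * padic_abs P (t i - t j) \<le> B * padic_abs P (t i - t j)"
      by (intro mult_right_mono B padic_abs_nonneg)
    moreover have "B * padic_abs P (t i - t j) < B * (r / B)"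
      using B(1) N[of i j] ij by (intro mult_strict_left_mono) auto
    moreover have "padic_abs P (s i - s j) * padic_abs P (t j) \<le> padic_abs P (s i - s j) * C"
      by (intro mult_left_mono C padic_abs_nonneg)
    moreover have "padic_abs P (s i - s j) * C < (r / C) * C"
      using C(1) M[of i j] ij by (intro mult_strict_right_mono) auto
    moreover have "s i * t i - s j * t j = s i * (t i - t j) + (s i - s j) * t j" by (simp add: algebra_simps)
    ultimately show ?thesis
      using padic_abs_add[of "s i * (t i - t j)" "(s i - s j) * t j"] B C by (simp add: padic_abs_mult)
  qed
  then show "\<exists>N. \<forall>i\<ge>N. \<forall>j\<ge>N. padic_abs P (s i * t i - s j * t j) < r" by blast
qed

lemma cauchy_minus: "s \<in> carrier (cauchy_ring P) \<Longrightarrow> (\<lambda>n. - s n) \<in> carrier (cauchy_ring P)"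
  using cauchy_mult[OF cauchy_const[of "-1"]] by simp

lemma cring_cauchy_ring: "cring (cauchy_ring P)"
proof (rule cringI)
  show "abelian_group (cauchy_ring P)"
  proof (rule abelian_groupI)
    fix x assume "x \<in> carrier (cauchy_ring P)"
    then show "\<exists>y\<in>carrier (cauchy_ring P). y \<oplus>\<^bsub>cauchy_ring P\<^esub> x = \<zero>\<^bsub>cauchy_ring P\<^esub>"
      by (intro bexI[of _ "\<lambda>n. - x n"]) (auto simp: cauchy_minus)
  qed (auto simp: cauchy_add cauchy_const algebra_simps)
  show "Group.comm_monoid (cauchy_ring P)"
    by (rule comm_monoidI) (auto simp: cauchy_mult cauchy_const mult_ac)
qed (simp add: algebra_simps)

sublocale CR: cring "cauchy_ring P"
  by (rule cring_cauchy_ring)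

lemma cauchy_a_inv: "s \<in> carrier (cauchy_ring P) \<Longrightarrow> \<ominus>\<^bsub>cauchy_ring P\<^esub> s = (\<lambda>n. - s n)"
  by (rule CR.minus_equality) (auto simp: cauchy_minus)

lemma null_seqs_add:
  assumes "s \<in> null_seqs P" "t \<in> null_seqs P"
  shows "(\<lambda>n. s n + t n) \<in> null_seqs P"
proof -
  have "(\<lambda>n. max (padic_abs P (s n)) (padic_abs P (t n))) \<longlonglongrightarrow> max 0 0"
    using assms unfolding null_seqs_iff by (rule tendsto_max)
  then show ?thesis
    unfolding null_seqs_iff max.idem
    by (rule Lim_null_comparison[rotated]) (simp add: padic_abs_nonneg padic_abs_add)
qed

lemma null_seqs_mult:
  assumes "s \<in> null_seqs P" "t \<in> carrier (cauchy_ring P)"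
  shows "(\<lambda>n. t n * s n) \<in> null_seqs P"
proof -
  obtain l where "(\<lambda>n. padic_abs P (t n)) \<longlonglongrightarrow> l" using cauchy_abs_convergent[OF assms(2)] convergent_def by blast
  from tendsto_mult[OF this, of "\<lambda>n. padic_abs P (s n)" 0] assms(1)
  show ?thesis by (simp add: null_seqs_iff padic_abs_mult)
qed

lemma ideal_null_seqs: "ideal (null_seqs P) (cauchy_ring P)"
proof (rule idealI)
  show "ring (cauchy_ring P)" by (rule CR.ring_axioms)
  show "subgroup (null_seqs P) (add_monoid (cauchy_ring P))"
  proof (rule CR.add.subgroupI)
    show "null_seqs P \<noteq> {}" using null_seqs_iff[of "\<lambda>_. 0"] by auto
    fix a b assume "a \<in> null_seqs P" "b \<in> null_seqs P"
    then show "a \<oplus>\<^bsub>cauchy_ring P\<^esub> b \<in> null_seqs P" by (simp add: null_seqs_add)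
    have "\<ominus>\<^bsub>cauchy_ring P\<^esub> a = (\<lambda>n. - a n)"
      using null_seqs_cauchy \<open>a \<in> null_seqs P\<close> by (intro cauchy_a_inv) auto
    then show "\<ominus>\<^bsub>cauchy_ring P\<^esub> a \<in> null_seqs P"
      using \<open>a \<in> null_seqs P\<close> by (simp add: null_seqs_iff)
  qed (rule null_seqs_cauchy)
qed (use null_seqs_mult in \<open>auto simp: mult.commute\<close>)

sublocale C: cring "completion P"
  unfolding completion_def by (rule ideal.quotient_is_cring[OF ideal_null_seqs cring_cauchy_ring])

lemma cl_hom: "cl \<in> ring_hom (cauchy_ring P) (completion P)"
  unfolding completion_def by (rule ideal.rcos_ring_hom[OF ideal_null_seqs])

lemma completion_carrier: "carrier (completion P) = cl ` carrier (cauchy_ring P)"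
  by (auto simp: completion_def FactRing_def A_RCOSETS_def')

lemma cl_closed: "s \<in> carrier (cauchy_ring P) \<Longrightarrow> cl s \<in> carrier (completion P)"
  by (simp add: completion_carrier)

lemma completion_cases:
  assumes "c \<in> carrier (completion P)"
  obtains s where "s \<in> carrier (cauchy_ring P)" "c = cl s"
  using assms by (auto simp: completion_carrier)

lemma cl_add: "s \<in> carrier (cauchy_ring P) \<Longrightarrow> t \<in> carrier (cauchy_ring P) \<Longrightarrow>
    cl s \<oplus>\<^bsub>completion P\<^esub> cl t = cl (\<lambda>n. s n + t n)"
  and cl_mult: "s \<in> carrier (cauchy_ring P) \<Longrightarrow> t \<in> carrier (cauchy_ring P) \<Longrightarrow>
    cl s \<otimes>\<^bsub>completion P\<^esub> cl t = cl (\<lambda>n. s n * t n)"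
  and cl_one: "cl (\<lambda>_. 1) = \<one>\<^bsub>completion P\<^esub>"
  using ring_hom_add[OF cl_hom] ring_hom_mult[OF cl_hom] ring_hom_one[OF cl_hom] by simp_all

lemma cl_eq_zero_iff:
  assumes "s \<in> carrier (cauchy_ring P)"
  shows "cl s = \<zero>\<^bsub>completion P\<^esub> \<longleftrightarrow> s \<in> null_seqs P"
proof -
  interpret I: ideal "null_seqs P" "cauchy_ring P" by (rule ideal_null_seqs)
  have "\<zero>\<^bsub>completion P\<^esub> = null_seqs P" by (simp add: completion_def FactRing_def)
  then show ?thesis
    using CR.a_coset_join1[OF _ assms I.a_subgroup] CR.a_coset_join2[OF assms I.a_subgroup] by auto
qed

lemma cl_zero: "cl (\<lambda>_. 0) = \<zero>\<^bsub>completion P\<^esub>"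
  using cl_eq_zero_iff[OF cauchy_const[of 0]] by (simp add: null_seqs_iff)

lemma cl_minus:
  assumes "s \<in> carrier (cauchy_ring P)"
  shows "\<ominus>\<^bsub>completion P\<^esub> cl s = cl (\<lambda>n. - s n)"
  by (rule C.minus_equality)
     (use assms cl_add[OF cauchy_minus[OF assms] assms] cl_zero in \<open>auto intro: cl_closed cauchy_minus\<close>)

lemma cl_diff:
  assumes "s \<in> carrier (cauchy_ring P)" "t \<in> carrier (cauchy_ring P)"
  shows "cl s \<ominus>\<^bsub>completion P\<^esub> cl t = cl (\<lambda>n. s n - t n)"
  using assms by (simp add: a_minus_def cl_minus cl_add cauchy_minus)

section \<open>The absolute value on the completion\<close>

abbreviation N :: "(nat \<Rightarrow> 'k) set \<Rightarrow> real" where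
  "N \<equiv> completion_abs P"

lemma tendsto_N:
  assumes s: "s \<in> carrier (cauchy_ring P)"
  shows "(\<lambda>n. padic_abs P (s n)) \<longlonglongrightarrow> N (cl s)"
proof -
  obtain l where l: "(\<lambda>n. padic_abs P (s n)) \<longlonglongrightarrow> l" using cauchy_abs_convergent[OF s] convergent_def by blast
  have lim: "(\<lambda>n. padic_abs P (t n)) \<longlonglongrightarrow> l" if t: "t \<in> cl s" for t
  proof -
    obtain h where h: "h \<in> null_seqs P" "t = (\<lambda>n. h n + s n)" using t by (auto simp: a_r_coset_def')
    have "(\<lambda>n. padic_abs P (t n) - padic_abs P (s n)) \<longlonglongrightarrow> 0"
    proof (rule Lim_null_comparison)
      show "\<forall>\<^sub>F n in sequentially. norm (padic_abs P (t n) - padic_abs P (s n)) \<le> padic_abs P (h n)"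
      proof (intro always_eventually allI)
        fix n show "norm (padic_abs P (t n) - padic_abs P (s n)) \<le> padic_abs P (h n)"
          using padic_abs_abs_diff_le[of "t n" "s n"] by (simp add: h)
      qed
      show "(\<lambda>n. padic_abs P (h n)) \<longlonglongrightarrow> 0" using h by (simp add: null_seqs_iff)
    qed
    from tendsto_add[OF this l] show ?thesis by simp
  qed
  have "(\<lambda>_. 0) \<in> null_seqs P" by (simp add: null_seqs_iff)
  then have "s \<in> cl s" by (force simp: a_r_coset_def')
  have "N (cl s) = l"
    unfolding completion_abs_def
  proof (rule the_equality)
    show "\<exists>s\<in>cl s. (\<lambda>n. padic_abs P (s n)) \<longlonglongrightarrow> l" using \<open>s \<in> cl s\<close> l by blast
    fix l' assume "\<exists>s\<in>cl s. (\<lambda>n. padic_abs P (s n)) \<longlonglongrightarrow> l'"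
    then show "l' = l" using lim LIMSEQ_unique by blast
  qed
  then show ?thesis using l by simp
qed

lemma N_nonneg: "c \<in> carrier (completion P) \<Longrightarrow> N c \<ge> 0"
  by (elim completion_cases) (auto intro: LIMSEQ_le_const[OF tendsto_N] simp: padic_abs_nonneg)

lemma N_eq_0_iff: "c \<in> carrier (completion P) \<Longrightarrow> N c = 0 \<longleftrightarrow> c = \<zero>\<^bsub>completion P\<^esub>"
proof (elim completion_cases)
  fix s assume s: "s \<in> carrier (cauchy_ring P)" "c = cl s"
  show ?thesis
    unfolding s(2) cl_eq_zero_iff[OF s(1)] null_seqs_iff using tendsto_N[OF s(1)] LIMSEQ_unique by metis
qed

lemma N_mult:
  assumes "c \<in> carrier (completion P)" "d \<in> carrier (completion P)"
  shows "N (c \<otimes>\<^bsub>completion P\<^esub> d) = N c * N d"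
proof -
  obtain s t where st: "s \<in> carrier (cauchy_ring P)" "c = cl s" "t \<in> carrier (cauchy_ring P)" "d = cl t"
    using assms by (metis completion_cases)
  have "(\<lambda>n. padic_abs P (s n * t n)) \<longlonglongrightarrow> N c * N d"
    unfolding padic_abs_mult st by (intro tendsto_mult tendsto_N st)
  moreover have "(\<lambda>n. padic_abs P (s n * t n)) \<longlonglongrightarrow> N (c \<otimes>\<^bsub>completion P\<^esub> d)"
    using tendsto_N[OF cauchy_mult[OF st(1,3)]] st by (simp add: cl_mult)
  ultimately show ?thesis using LIMSEQ_unique by blast
qed

lemma N_add:
  assumes "c \<in> carrier (completion P)" "d \<in> carrier (completion P)"
  shows "N (c \<oplus>\<^bsub>completion P\<^esub> d) \<le> max (N c) (N d)"
proof -
  obtain s t where st: "s \<in> carrier (cauchy_ring P)" "c = cl s" "t \<in> carrier (cauchy_ring P)" "d = cl t"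
    using assms by (metis completion_cases)
  have 1: "(\<lambda>n. max (padic_abs P (s n)) (padic_abs P (t n))) \<longlonglongrightarrow> max (N c) (N d)"
    unfolding st by (intro tendsto_max tendsto_N st)
  have 2: "(\<lambda>n. padic_abs P (s n + t n)) \<longlonglongrightarrow> N (c \<oplus>\<^bsub>completion P\<^esub> d)"
    using tendsto_N[OF cauchy_add[OF st(1,3)]] st by (simp add: cl_add)
  show ?thesis by (rule LIMSEQ_le[OF 2 1]) (use padic_abs_add in blast)
qed

lemma N_minus:
  assumes "c \<in> carrier (completion P)"
  shows "N (\<ominus>\<^bsub>completion P\<^esub> c) = N c"
proof -
  obtain s where st: "s \<in> carrier (cauchy_ring P)" "c = cl s"
    using assms by (metis completion_cases)
  have "(\<lambda>n. padic_abs P (- s n)) \<longlonglongrightarrow> N (\<ominus>\<^bsub>completion P\<^esub> c)"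
    using tendsto_N[OF cauchy_minus[OF st(1)]] st by (simp add: cl_minus)
  then show ?thesis using tendsto_N[OF st(1)] st LIMSEQ_unique by force
qed

lemma N_diff:
  assumes "c \<in> carrier (completion P)" "d \<in> carrier (completion P)"
  shows "N (c \<ominus>\<^bsub>completion P\<^esub> d) \<le> max (N c) (N d)"
  using N_add[OF assms(1) C.a_inv_closed[OF assms(2)]] N_minus[OF assms(2)] by (simp add: a_minus_def)

text \<open>Ultrametric phenomenon: once two terms differ by less than their own size, their
  absolute values agree. So completing adds no new absolute values.\<close>

lemma eventually_constant_abs:
  assumes s: "s \<in> carrier (cauchy_ring P)" and nz: "cl s \<noteq> \<zero>\<^bsub>completion P\<^esub>"
  shows "\<exists>M. \<forall>i\<ge>M. padic_abs P (s i) = N (cl s)"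
proof -
  have pos: "N (cl s) > 0"
    using N_eq_0_iff[OF cl_closed[OF s]] nz N_nonneg[OF cl_closed[OF s]] by linarith
  then obtain K where K: "\<And>i. i \<ge> K \<Longrightarrow> \<bar>padic_abs P (s i) - N (cl s)\<bar> < N (cl s) / 2"
    using LIMSEQ_D[OF tendsto_N[OF s], of "N (cl s) / 2"] by auto
  obtain L where L: "\<And>i j. i \<ge> L \<Longrightarrow> j \<ge> L \<Longrightarrow> padic_abs P (s i - s j) < N (cl s) / 2"
    using s pos unfolding cauchy_ring_carrier by (meson half_gt_zero)
  have const: "padic_abs P (s i) \<le> padic_abs P (s j)" if "i \<ge> max K L" "j \<ge> max K L" for i j
  proof -
    have "padic_abs P (s i - s j) < padic_abs P (s i)"
      using K[of i] L[of i j] that by (simp add: abs_if split: if_splits)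
    then show ?thesis using padic_abs_add[of "s i - s j" "s j"] by auto
  qed
  define l where "l = padic_abs P (s (max K L))"
  have ev: "padic_abs P (s i) = l" if "i \<ge> max K L" for i
    using const[OF that order_refl] const[OF order_refl that] by (simp add: l_def)
  have "(\<lambda>n. padic_abs P (s n)) \<longlonglongrightarrow> l"
    by (rule tendsto_eventually) (use ev in \<open>auto simp: eventually_sequentially intro!: exI[of _ "max K L"]\<close>)
  then have "l = N (cl s)" using tendsto_N[OF s] LIMSEQ_unique by blast
  then show ?thesis using ev by blast
qed

lemma N_value:
  assumes "c \<in> carrier (completion P)" "c \<noteq> \<zero>\<^bsub>completion P\<^esub>"
  shows "\<exists>n. N c = 2 powi n"
proof -
  obtain s where s: "s \<in> carrier (cauchy_ring P)" "c = cl s" using assms by (metis completion_cases)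
  then obtain M where M: "padic_abs P (s M) = N c" using eventually_constant_abs assms by blast
  then have "s M \<noteq> 0" using N_eq_0_iff[OF assms(1)] assms(2) by auto
  then show ?thesis using padic_abs_value[of "s M"] M by simp
qed

lemma completion_inverse:
  assumes c: "c \<in> carrier (completion P)" "c \<noteq> \<zero>\<^bsub>completion P\<^esub>"
  shows "\<exists>d\<in>carrier (completion P). c \<otimes>\<^bsub>completion P\<^esub> d = \<one>\<^bsub>completion P\<^esub>"
proof -
  obtain s where s: "s \<in> carrier (cauchy_ring P)" "c = cl s" using assms by (metis completion_cases)
  then obtain M where M: "\<And>i. i \<ge> M \<Longrightarrow> padic_abs P (s i) = N c" using eventually_constant_abs c by blast
  have pos: "N c > 0" using N_eq_0_iff[OF c(1)] c(2) N_nonneg[OF c(1)] by linarith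
  have nz: "s i \<noteq> 0" if "i \<ge> M" for i using M[OF that] pos by auto
  \<comment> \<open>Terms before M may vanish, and then their inverse is 0; only the tail
    matters.\<close>
  define t where "t = (\<lambda>i. inverse (s i))"
  have "padic_abs P (t i - t j) * (N c * N c) = padic_abs P (s i - s j)" if "i \<ge> M" "j \<ge> M" for i j
  proof -
    have "(t i - t j) * (s i * s j) = s j - s i" using nz that by (simp add: t_def field_simps)
    then have "padic_abs P (t i - t j) * (padic_abs P (s i) * padic_abs P (s j)) = padic_abs P (s j - s i)"
      by (metis padic_abs_mult)
    then show ?thesis using M that by (metis padic_abs_minus minus_diff_eq)
  qed
  then have eq: "padic_abs P (t i - t j) = padic_abs P (s i - s j) / (N c * N c)" if "i \<ge> M" "j \<ge> M" for i j
    using that pos by (simp add: field_simps)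
  have t: "t \<in> carrier (cauchy_ring P)"
    unfolding cauchy_ring_carrier
  proof (intro allI impI)
    fix r :: real assume "r > 0"
    then have "r * (N c * N c) > 0" using pos by simp
    then obtain L where L: "\<And>i j. i \<ge> L \<Longrightarrow> j \<ge> L \<Longrightarrow> padic_abs P (s i - s j) < r * (N c * N c)"
      using s unfolding cauchy_ring_carrier by meson
    have "padic_abs P (t i - t j) < r" if "i \<ge> max L M" "j \<ge> max L M" for i j
      using L[of i j] eq[of i j] that pos by (simp add: divide_less_eq)
    then show "\<exists>N. \<forall>i\<ge>N. \<forall>j\<ge>N. padic_abs P (t i - t j) < r" by blast
  qed
  have "(\<lambda>n. s n * t n - 1) \<in> null_seqs P"
    unfolding null_seqs_iff
    by (rule tendsto_eventually) (use nz in \<open>auto simp: eventually_sequentially t_def intro!: exI[of _ M]\<close>)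
  then have "cl (\<lambda>n. s n * t n) \<ominus>\<^bsub>completion P\<^esub> cl (\<lambda>_. 1) = \<zero>\<^bsub>completion P\<^esub>"
    using cl_eq_zero_iff[of "\<lambda>n. s n * t n - 1"] null_seqs_cauchy s t
    by (subst cl_diff) (auto intro: cauchy_mult cauchy_const)
  then have "cl (\<lambda>n. s n * t n) = cl (\<lambda>_. 1)"
    using s t by (subst (asm) C.r_right_minus_eq) (auto intro!: cl_closed cauchy_mult cauchy_const)
  then show ?thesis using s t by (intro bexI[of _ "cl t"]) (auto simp: cl_mult cl_one intro: cl_closed)
qed

lemma N_zero [simp]: "N \<zero>\<^bsub>completion P\<^esub> = 0"
  using N_eq_0_iff by simp

lemma N_one [simp]: "N \<one>\<^bsub>completion P\<^esub> = 1"
  using tendsto_N[OF cauchy_const[of 1]] LIMSEQ_unique[OF _ tendsto_const[of 1]] by (simp add: cl_one)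

sublocale C: field "completion P"
proof (rule C.cring_fieldI)
  show "Units (completion P) = carrier (completion P) - {\<zero>\<^bsub>completion P\<^esub>}"
  proof (intro equalityI subsetI)
    fix x assume "x \<in> Units (completion P)"
    then obtain y where "x \<in> carrier (completion P)" "y \<in> carrier (completion P)" "x \<otimes>\<^bsub>completion P\<^esub> y = \<one>\<^bsub>completion P\<^esub>"
      by (auto simp: Units_def)
    moreover from this have "N x * N y = 1" by (simp flip: N_mult)
    ultimately show "x \<in> carrier (completion P) - {\<zero>\<^bsub>completion P\<^esub>}" by auto
  next
    fix x assume x: "x \<in> carrier (completion P) - {\<zero>\<^bsub>completion P\<^esub>}"
    then obtain d where "d \<in> carrier (completion P)" "x \<otimes>\<^bsub>completion P\<^esub> d = \<one>\<^bsub>completion P\<^esub>"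
      using completion_inverse[of x] by blast
    moreover from this x have "d \<otimes>\<^bsub>completion P\<^esub> x = \<one>\<^bsub>completion P\<^esub>" by (simp add: C.m_comm)
    ultimately show "x \<in> Units (completion P)" using x by (auto simp: Units_def)
  qed
qed

abbreviation emb :: "'k \<Rightarrow> (nat \<Rightarrow> 'k) set" where
  "emb \<equiv> completion_embed P"

lemma emb_eq: "emb x = cl (\<lambda>_. x)"
  by (simp add: completion_embed_def)

lemma emb_closed [simp]: "emb x \<in> carrier (completion P)"
  by (simp add: emb_eq cl_closed cauchy_const)

lemma emb_mult: "emb (x * y) = emb x \<otimes>\<^bsub>completion P\<^esub> emb y"
  and emb_diff: "emb (x - y) = emb x \<ominus>\<^bsub>completion P\<^esub> emb y"
  and emb_0 [simp]: "emb 0 = \<zero>\<^bsub>completion P\<^esub>"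
  and emb_1 [simp]: "emb 1 = \<one>\<^bsub>completion P\<^esub>"
  by (simp_all add: emb_eq cl_add cl_mult cl_diff cl_zero cl_one cauchy_const)

lemma N_emb [simp]: "N (emb x) = padic_abs P x"
  using tendsto_N[OF cauchy_const[of x]] LIMSEQ_unique[OF _ tendsto_const[of "padic_abs P x"]]
  by (simp add: emb_eq)

lemma emb_dense:
  assumes "c \<in> carrier (completion P)" "r > 0"
  shows "\<exists>x. N (c \<ominus>\<^bsub>completion P\<^esub> emb x) \<le> r"
proof -
  obtain s where s: "s \<in> carrier (cauchy_ring P)" "c = cl s" using assms by (metis completion_cases)
  then obtain L where L: "\<And>i j. i \<ge> L \<Longrightarrow> j \<ge> L \<Longrightarrow> padic_abs P (s i - s j) < r"
    using assms(2) unfolding cauchy_ring_carrier by meson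
  have d: "(\<lambda>n. s n - s L) \<in> carrier (cauchy_ring P)"
    using cauchy_add[OF s(1) cauchy_const[of "- s L"]] by simp
  have "N (c \<ominus>\<^bsub>completion P\<^esub> emb (s L)) \<le> r"
    unfolding s(2) emb_eq cl_diff[OF s(1) cauchy_const]
    by (rule LIMSEQ_le_const2[OF tendsto_N[OF d]]) (use L in \<open>auto intro!: exI[of _ L] less_imp_le\<close>)
  then show ?thesis by blast
qed

end

section \<open>The Bruhat--Tits tree\<close>

context prime_place
begin

abbreviation KP :: "(nat \<Rightarrow> 'k) set set" where "KP \<equiv> carrier (completion P)"
abbreviation c_add (infixl \<open>+\<^sub>C\<close> 65) where "x +\<^sub>C y \<equiv> x \<oplus>\<^bsub>completion P\<^esub> y"
abbreviation c_diff (infixl \<open>-\<^sub>C\<close> 65) where "x -\<^sub>C y \<equiv> x \<ominus>\<^bsub>completion P\<^esub> y"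
abbreviation c_mult (infixl \<open>*\<^sub>C\<close> 70) where "x *\<^sub>C y \<equiv> x \<otimes>\<^bsub>completion P\<^esub> y"
abbreviation c_zero (\<open>0\<^sub>C\<close>) where "0\<^sub>C \<equiv> \<zero>\<^bsub>completion P\<^esub>"
abbreviation c_one (\<open>1\<^sub>C\<close>) where "1\<^sub>C \<equiv> \<one>\<^bsub>completion P\<^esub>"

lemma N_inverse:
  assumes "x \<in> KP" "y \<in> KP" "x *\<^sub>C y = 1\<^sub>C"
  shows "N y = inverse (N x)"
  using N_mult[OF assms(1,2)] assms(3) by (metis N_one inverse_unique)

lemma N_pos: "x \<in> KP \<Longrightarrow> x \<noteq> 0\<^sub>C \<Longrightarrow> N x > 0"
  using N_nonneg[of x] N_eq_0_iff[of x] by linarith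

lemma completion_divide:
  assumes "x \<in> KP" "y \<in> KP" "y \<noteq> 0\<^sub>C"
  obtains q where "q \<in> KP" "q *\<^sub>C y = x" "N q = N x / N y"
proof -
  obtain d where d: "d \<in> KP" "y *\<^sub>C d = 1\<^sub>C" using completion_inverse assms by blast
  have "(x *\<^sub>C d) *\<^sub>C y = x *\<^sub>C (y *\<^sub>C d)" using assms d(1) by algebra
  then have "(x *\<^sub>C d) *\<^sub>C y = x" using d assms by simp
  moreover have "N (x *\<^sub>C d) = N x / N y"
    using N_inverse[OF assms(2) d] assms d by (simp add: N_mult divide_inverse)
  ultimately show ?thesis using that[of "x *\<^sub>C d"] assms d by blast
qed

section \<open>Lattices with triangular bases\<close>

definition cpow :: "int \<Rightarrow> (nat \<Rightarrow> 'k) set" where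
  "cpow n = emb (unif powi n)"

lemma cpow_closed [simp]: "cpow n \<in> KP"
  by (simp add: cpow_def)

lemma N_cpow [simp]: "N (cpow n) = 2 powi (- n)"
proof -
  have "has_ord n (unif powi n)" unfolding has_ord_def using one_notin_P by (intro exI[of _ 1]) auto
  then show ?thesis by (simp add: cpow_def padic_abs_has_ord)
qed

lemma cpow_nonzero [simp]: "cpow n \<noteq> 0\<^sub>C"
  using N_cpow[of n] by (metis N_zero power_int_eq_0_iff zero_neq_numeral)

text \<open>The lattice with basis pi^j (1, z) and pi^k (0, 1). In terms of inequalities, inclusion
  and homothety become computations with absolute values.\<close>

definition Lat :: "int \<Rightarrow> int \<Rightarrow> (nat \<Rightarrow> 'k) set \<Rightarrow> 'k compl_vec set" where
  "Lat j k z = {(x, y). x \<in> KP \<and> y \<in> KP \<and> N x \<le> 2 powi (- j) \<and> N (y -\<^sub>C z *\<^sub>C x) \<le> 2 powi (- k)}"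

lemma LatI: "x \<in> KP \<Longrightarrow> y \<in> KP \<Longrightarrow> N x \<le> 2 powi (- j) \<Longrightarrow> N (y -\<^sub>C z *\<^sub>C x) \<le> 2 powi (- k) \<Longrightarrow> (x, y) \<in> Lat j k z"
  by (simp add: Lat_def)

text \<open>Column reduction: since w_1 is no larger than v_1, subtracting an integral multiple of v
  makes the first entry of w vanish. The coefficient b is read off from y - z x, and then a from the
  first coordinate.\<close>

lemma integral_span_eq:
  assumes v: "v1 \<in> KP" "v2 \<in> KP" "w1 \<in> KP" "w2 \<in> KP" "z \<in> KP" "z *\<^sub>C v1 = v2" "N w1 \<le> N v1"
    and nz: "v1 \<noteq> 0\<^sub>C" "w2 -\<^sub>C z *\<^sub>C w1 \<noteq> 0\<^sub>C"
  shows "{vec_add P (vec_scale P a (v1, v2)) (vec_scale P b (w1, w2)) | a b.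
      a \<in> carrier (completion_int P) \<and> b \<in> carrier (completion_int P)} =
    {(x, y). x \<in> KP \<and> y \<in> KP \<and> N x \<le> N v1 \<and> N (y -\<^sub>C z *\<^sub>C x) \<le> N (w2 -\<^sub>C z *\<^sub>C w1)}" (is "?A = ?B")
proof (intro equalityI subsetI)
  fix p assume "p \<in> ?A"
  then obtain a b where ab: "a \<in> KP" "N a \<le> 1" "b \<in> KP" "N b \<le> 1"
    "p = (a *\<^sub>C v1 +\<^sub>C b *\<^sub>C w1, a *\<^sub>C v2 +\<^sub>C b *\<^sub>C w2)"
    by (auto simp: completion_int_def vec_add_def vec_scale_def)
  have "N (a *\<^sub>C v1 +\<^sub>C b *\<^sub>C w1) \<le> max (N (a *\<^sub>C v1)) (N (b *\<^sub>C w1))"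
    using ab v by (intro N_add) auto
  also have "\<dots> \<le> N v1"
  proof -
    have "N a * N v1 \<le> N v1" using ab v by (intro mult_left_le_one_le N_nonneg) auto
    moreover have "N b * N w1 \<le> N w1" using ab v by (intro mult_left_le_one_le N_nonneg) auto
    ultimately show ?thesis using ab v by (simp add: N_mult)
  qed
  finally have 1: "N (a *\<^sub>C v1 +\<^sub>C b *\<^sub>C w1) \<le> N v1" .
  have "(a *\<^sub>C v2 +\<^sub>C b *\<^sub>C w2) -\<^sub>C z *\<^sub>C (a *\<^sub>C v1 +\<^sub>C b *\<^sub>C w1) = b *\<^sub>C (w2 -\<^sub>C z *\<^sub>C w1)"
    unfolding v(6)[symmetric] using ab v(1-5) by algebra
  then have "N ((a *\<^sub>C v2 +\<^sub>C b *\<^sub>C w2) -\<^sub>C z *\<^sub>C (a *\<^sub>C v1 +\<^sub>C b *\<^sub>C w1)) = N b * N (w2 -\<^sub>C z *\<^sub>C w1)"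
    using ab v by (simp add: N_mult)
  also have "\<dots> \<le> N (w2 -\<^sub>C z *\<^sub>C w1)" using ab v by (intro mult_left_le_one_le N_nonneg) auto
  finally show "p \<in> ?B" using 1 ab v by auto
next
  fix p assume "p \<in> ?B"
  then obtain x y where xy: "p = (x, y)" "x \<in> KP" "y \<in> KP" "N x \<le> N v1" "N (y -\<^sub>C z *\<^sub>C x) \<le> N (w2 -\<^sub>C z *\<^sub>C w1)"
    by blast
  have dK: "w2 -\<^sub>C z *\<^sub>C w1 \<in> KP" "y -\<^sub>C z *\<^sub>C x \<in> KP" using v xy by auto
  obtain b where b: "b \<in> KP" "b *\<^sub>C (w2 -\<^sub>C z *\<^sub>C w1) = y -\<^sub>C z *\<^sub>C x"
    "N b = N (y -\<^sub>C z *\<^sub>C x) / N (w2 -\<^sub>C z *\<^sub>C w1)"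
    using completion_divide[OF dK(2,1) nz(2)] by metis
  have Nb: "N b \<le> 1" unfolding b(3) using xy(5) N_pos[OF dK(1) nz(2)] by simp
  obtain a where a: "a \<in> KP" "a *\<^sub>C v1 = x -\<^sub>C b *\<^sub>C w1" "N a = N (x -\<^sub>C b *\<^sub>C w1) / N v1"
    using completion_divide[of "x -\<^sub>C b *\<^sub>C w1" v1] xy b v nz by (metis C.minus_closed C.m_closed)
  have diff: "N (x -\<^sub>C b *\<^sub>C w1) \<le> max (N x) (N (b *\<^sub>C w1))" using xy b v by (intro N_diff) auto
  have "N b * N w1 \<le> N w1" using b v Nb by (intro mult_left_le_one_le N_nonneg)
  then have "N (b *\<^sub>C w1) \<le> N w1" using b(1) v(3) by (simp only: N_mult)
  then have "max (N x) (N (b *\<^sub>C w1)) \<le> N v1" using xy v by simp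
  with diff have "N (x -\<^sub>C b *\<^sub>C w1) \<le> N v1" by linarith
  then have Na: "N a \<le> 1" unfolding a(3) using N_pos[OF v(1) nz(1)] by simp
  have "a *\<^sub>C v1 +\<^sub>C b *\<^sub>C w1 = x"
    unfolding a(2) using xy b(1) v(1-5) by algebra
  moreover have "a *\<^sub>C v2 +\<^sub>C b *\<^sub>C w2 = y"
  proof -
    have "a *\<^sub>C v2 +\<^sub>C b *\<^sub>C w2 = z *\<^sub>C (a *\<^sub>C v1) +\<^sub>C b *\<^sub>C w2"
      unfolding v(6)[symmetric] using a(1) b(1) v(1-5) by algebra
    also have "\<dots> = b *\<^sub>C (w2 -\<^sub>C z *\<^sub>C w1) +\<^sub>C z *\<^sub>C x"
      unfolding a(2) using xy b(1) v(1-5) by algebra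
    also have "\<dots> = y" unfolding b(2) using xy v(1-5) by algebra
    finally show ?thesis .
  qed
  ultimately have "p = vec_add P (vec_scale P a (v1, v2)) (vec_scale P b (w1, w2))"
    using xy(1) by (simp add: vec_add_def vec_scale_def)
  moreover have "a \<in> carrier (completion_int P)" "b \<in> carrier (completion_int P)"
    using a(1) b(1) Na Nb by (simp_all add: completion_int_def)
  ultimately show "p \<in> ?A" by blast
qed

lemma integral_span_eq_Lat:
  assumes v: "v1 \<in> KP" "v2 \<in> KP" "w1 \<in> KP" "w2 \<in> KP" and le: "N w1 \<le> N v1"
    and ind: "lin_indep2 P (v1, v2) (w1, w2)"
  shows "\<exists>j k. \<exists>z\<in>KP. {vec_add P (vec_scale P a (v1, v2)) (vec_scale P b (w1, w2)) | a b.
      a \<in> carrier (completion_int P) \<and> b \<in> carrier (completion_int P)} = Lat j k z"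
proof -
  have ind': "a = 0\<^sub>C \<and> b = 0\<^sub>C" if "a \<in> KP" "b \<in> KP" "a *\<^sub>C v1 +\<^sub>C b *\<^sub>C w1 = 0\<^sub>C" "a *\<^sub>C v2 +\<^sub>C b *\<^sub>C w2 = 0\<^sub>C" for a b
    using ind that unfolding lin_indep2_def by (auto simp: vec_add_def vec_scale_def)
  have v1: "v1 \<noteq> 0\<^sub>C"
  proof
    assume v1: "v1 = 0\<^sub>C"
    then have w1: "w1 = 0\<^sub>C" using le N_nonneg[OF v(3)] N_eq_0_iff[OF v(3)] by simp
    \<comment> \<open>The relation w_2 v - v_2 w = 0 forces w_2 = 0, and then w = 0.\<close>
    have "w2 *\<^sub>C v2 +\<^sub>C (\<ominus>\<^bsub>completion P\<^esub> v2) *\<^sub>C w2 = 0\<^sub>C" using v(2,4) by algebra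
    then have v2: "w2 = 0\<^sub>C" using ind'[of w2 "\<ominus>\<^bsub>completion P\<^esub> v2"] v v1 w1 by simp
    show False using ind'[of "0\<^sub>C" "1\<^sub>C"] v v1 w1 v2 by simp
  qed
  obtain z where z: "z \<in> KP" "z *\<^sub>C v1 = v2" using completion_divide[OF v(2,1) v1] by blast
  have d: "w2 -\<^sub>C z *\<^sub>C w1 \<noteq> 0\<^sub>C"
  proof
    assume d: "w2 -\<^sub>C z *\<^sub>C w1 = 0\<^sub>C"
    then have w2: "w2 = z *\<^sub>C w1" using v z by simp
    obtain q where q: "q \<in> KP" "q *\<^sub>C v1 = w1" using completion_divide[OF v(3,1) v1] by blast
    have 1: "(\<ominus>\<^bsub>completion P\<^esub> q) *\<^sub>C v1 +\<^sub>C 1\<^sub>C *\<^sub>C w1 = 0\<^sub>C"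
      unfolding q(2)[symmetric] using q(1) v(1) by algebra
    have 2: "(\<ominus>\<^bsub>completion P\<^esub> q) *\<^sub>C v2 +\<^sub>C 1\<^sub>C *\<^sub>C w2 = 0\<^sub>C"
      unfolding w2 q(2)[symmetric] z(2)[symmetric] using q(1) v(1) z(1) by algebra
    have "1\<^sub>C = 0\<^sub>C" using ind'[OF _ _ 1 2] q(1) by simp
    then show False by simp
  qed
  obtain j where j: "N v1 = 2 powi j" using N_value[OF v(1) v1] by blast
  obtain k where k: "N (w2 -\<^sub>C z *\<^sub>C w1) = 2 powi k" using N_value[OF _ d] v z by auto
  show ?thesis
    using integral_span_eq[OF v z le v1 d] z(1)
    by (intro exI[of _ "-j"] exI[of _ "-k"] bexI[of _ z]) (auto simp: Lat_def j k)
qed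

lemma vec_add_commute: "v \<in> KP \<times> KP \<Longrightarrow> w \<in> KP \<times> KP \<Longrightarrow> vec_add P v w = vec_add P w v"
  by (auto simp: vec_add_def C.a_comm)

lemma vec_scale_closed: "c \<in> KP \<Longrightarrow> v \<in> KP \<times> KP \<Longrightarrow> vec_scale P c v \<in> KP \<times> KP"
  by (auto simp: vec_scale_def)

lemma bt_lattices_Lat:
  assumes "L \<in> bt_lattices P"
  shows "\<exists>j k. \<exists>z\<in>KP. L = Lat j k z"
proof -
  let ?S = "\<lambda>v w. {vec_add P (vec_scale P a v) (vec_scale P b w) | a b.
      a \<in> carrier (completion_int P) \<and> b \<in> carrier (completion_int P)}"
  obtain v w where vw: "v \<in> KP \<times> KP" "w \<in> KP \<times> KP" "lin_indep2 P v w" "L = ?S v w"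
    using assms unfolding bt_lattices_def by blast
  have sub: "a \<in> carrier (completion_int P) \<Longrightarrow> a \<in> KP" for a by (simp add: completion_int_def)
  have comm: "vec_add P (vec_scale P a v) (vec_scale P b w) = vec_add P (vec_scale P b w) (vec_scale P a v)"
    if "a \<in> KP" "b \<in> KP" for a b
    using vw that by (intro vec_add_commute vec_scale_closed)
  \<comment> \<open>The span is symmetric in the two vectors, so the one with the larger first entry
    can be used for the reduction.\<close>
  have S_comm: "?S v w = ?S w v"
    using comm sub by (intro Collect_cong) metis
  have ind: "lin_indep2 P w v"
    using vw(3) comm unfolding lin_indep2_def by metis
  obtain v1 v2 w1 w2 where c: "v = (v1, v2)" "w = (w1, w2)" by (cases v, cases w)
  show ?thesis
  proof (cases "N w1 \<le> N v1")
    case True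
    then show ?thesis unfolding vw(4) using integral_span_eq_Lat[of v1 v2 w1 w2] vw c by auto
  next
    case False
    then show ?thesis unfolding vw(4) S_comm using integral_span_eq_Lat[of w1 w2 v1 v2] vw c ind by auto
  qed
qed

lemma Lat_mem_bt_lattices:
  assumes "z \<in> KP"
  shows "Lat j k z \<in> bt_lattices P"
proof -
  let ?v = "(cpow j, z *\<^sub>C cpow j)" and ?w = "(0\<^sub>C, cpow k)"
  have d: "cpow k -\<^sub>C z *\<^sub>C 0\<^sub>C = cpow k" using assms by (simp add: a_minus_def)
  have ind: "lin_indep2 P ?v ?w"
    unfolding lin_indep2_def
  proof (intro ballI impI)
    fix a b assume ab: "a \<in> KP" "b \<in> KP" "vec_add P (vec_scale P a ?v) (vec_scale P b ?w) = (0\<^sub>C, 0\<^sub>C)"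
    then have "a *\<^sub>C cpow j = 0\<^sub>C" by (auto simp: vec_add_def vec_scale_def)
    then have a: "a = 0\<^sub>C" using ab C.integral[of a "cpow j"] by auto
    then have "b *\<^sub>C cpow k = 0\<^sub>C" using ab assms by (auto simp: vec_add_def vec_scale_def)
    then show "a = 0\<^sub>C \<and> b = 0\<^sub>C" using a ab C.integral[of b "cpow k"] by auto
  qed
  have eq: "Lat j k z = {vec_add P (vec_scale P a ?v) (vec_scale P b ?w) | a b.
      a \<in> carrier (completion_int P) \<and> b \<in> carrier (completion_int P)}"
    using integral_span_eq[of "cpow j" "z *\<^sub>C cpow j" "0\<^sub>C" "cpow k" z] assms d by (simp add: Lat_def)
  have v: "?v \<in> KP \<times> KP" and w: "?w \<in> KP \<times> KP" using assms by auto
  show ?thesis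
    unfolding bt_lattices_def mem_Collect_eq
    by (intro exI[of _ ?v] exI[of _ ?w] conjI) (fact eq v w ind)+
qed

lemma vec_scale_Lat:
  assumes "z \<in> KP" and c: "c \<in> KP" "N c = 2 powi (- n)"
  shows "vec_scale P c ` Lat j k z = Lat (j + n) (k + n) z"
proof -
  have nz: "c \<noteq> 0\<^sub>C" using c by (metis N_zero power_int_eq_0_iff zero_neq_numeral)
  have le: "2 powi (- n) * u \<le> 2 powi (- l - n) \<longleftrightarrow> u \<le> 2 powi (- l)" for u :: real and l
  proof -
    have "(2::real) powi (- l - n) = 2 powi (- n) * 2 powi (- l)" by (simp flip: power_int_add add: add.commute)
    then show ?thesis by simp
  qed
  have key: "(c *\<^sub>C x, c *\<^sub>C y) \<in> Lat (j + n) (k + n) z \<longleftrightarrow> (x, y) \<in> Lat j k z" if "x \<in> KP" "y \<in> KP" for x y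
  proof -
    have "c *\<^sub>C y -\<^sub>C z *\<^sub>C (c *\<^sub>C x) = c *\<^sub>C (y -\<^sub>C z *\<^sub>C x)" using that assms(1) c(1) by algebra
    then show ?thesis using that assms by (simp add: Lat_def N_mult le)
  qed
  show ?thesis
  proof (intro equalityI subsetI)
    fix p assume "p \<in> vec_scale P c ` Lat j k z"
    then obtain x y where "(x, y) \<in> Lat j k z" "p = (c *\<^sub>C x, c *\<^sub>C y)" by (auto simp: vec_scale_def)
    moreover from this have "x \<in> KP" "y \<in> KP" by (auto simp: Lat_def)
    ultimately show "p \<in> Lat (j + n) (k + n) z" using key by blast
  next
    fix p assume p: "p \<in> Lat (j + n) (k + n) z"
    then obtain x y where xy: "p = (x, y)" "x \<in> KP" "y \<in> KP" by (auto simp: Lat_def)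
    obtain x' y' where "x' \<in> KP" "x' *\<^sub>C c = x" "y' \<in> KP" "y' *\<^sub>C c = y"
      using completion_divide[OF xy(2) c(1) nz] completion_divide[OF xy(3) c(1) nz] by metis
    then have x': "x' \<in> KP" "c *\<^sub>C x' = x" "y' \<in> KP" "c *\<^sub>C y' = y" using c by (auto simp: C.m_comm)
    then have "(x', y') \<in> Lat j k z" using key p xy by metis
    then show "p \<in> vec_scale P c ` Lat j k z" using x' xy by (intro image_eqI[of _ _ "(x', y')"]) (auto simp: vec_scale_def)
  qed
qed

lemma homothety_class_Lat:
  assumes "z \<in> KP"
  shows "homothety_class P (Lat j k z) = {Lat (j + n) (k + n) z | n. True}"
  unfolding homothety_class_def
proof (intro equalityI subsetI)
  fix L assume "L \<in> {vec_scale P c ` Lat j k z |c. c \<in> KP - {0\<^sub>C}}"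
  then obtain c where c: "c \<in> KP" "c \<noteq> 0\<^sub>C" "L = vec_scale P c ` Lat j k z" by auto
  then obtain n where "N c = 2 powi n" using N_value by blast
  then show "L \<in> {Lat (j + n) (k + n) z | n. True}"
    using vec_scale_Lat[OF assms c(1), of "- n" j k] c(3) by (intro CollectI exI[of _ "- n"]) simp
next
  fix L assume "L \<in> {Lat (j + n) (k + n) z | n. True}"
  then obtain n where "L = vec_scale P (cpow n) ` Lat j k z"
    using vec_scale_Lat[OF assms cpow_closed N_cpow] by auto
  then show "L \<in> {vec_scale P c ` Lat j k z |c. c \<in> KP - {0\<^sub>C}}" by auto
qed

text \<open>Inclusion is tested on the basis: pi^k (0, 1) yields k' \<le> k, and pi^j (1, z) yields
  the other two conditions.\<close>

lemma Lat_subset_iff: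
  assumes "z \<in> KP" "z' \<in> KP"
  shows "Lat j k z \<subseteq> Lat j' k' z' \<longleftrightarrow> j' \<le> j \<and> k' \<le> k \<and> N (z -\<^sub>C z') \<le> 2 powi (j - k')"
proof
  assume sub: "Lat j k z \<subseteq> Lat j' k' z'"
  have "cpow k -\<^sub>C z *\<^sub>C 0\<^sub>C = cpow k" "cpow k -\<^sub>C z' *\<^sub>C 0\<^sub>C = cpow k" using assms by (simp_all add: a_minus_def)
  then have k: "k' \<le> k"
    using subsetD[OF sub LatI[of "0\<^sub>C" "cpow k" j z k]] by (simp add: Lat_def)
  have 0: "z *\<^sub>C cpow j -\<^sub>C z *\<^sub>C cpow j = 0\<^sub>C" using assms by simp
  have eq: "z *\<^sub>C cpow j -\<^sub>C z' *\<^sub>C cpow j = (z -\<^sub>C z') *\<^sub>C cpow j"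
    using assms cpow_closed[of j] by algebra
  have "(cpow j, z *\<^sub>C cpow j) \<in> Lat j' k' z'"
    using sub LatI[of "cpow j" "z *\<^sub>C cpow j" j z k] assms 0 by auto
  then have "j' \<le> j" "N (z -\<^sub>C z') * 2 powi (- j) \<le> 2 powi (- k')"
    using assms by (simp_all add: Lat_def eq N_mult)
  moreover have "(2::real) powi (- k') = 2 powi (j - k') * 2 powi (- j)" by (simp flip: power_int_add)
  ultimately show "j' \<le> j \<and> k' \<le> k \<and> N (z -\<^sub>C z') \<le> 2 powi (j - k')" using k by simp
next
  assume h: "j' \<le> j \<and> k' \<le> k \<and> N (z -\<^sub>C z') \<le> 2 powi (j - k')"
  show "Lat j k z \<subseteq> Lat j' k' z'"
  proof
    fix p assume "p \<in> Lat j k z"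
    then obtain x y where xy: "p = (x, y)" "x \<in> KP" "y \<in> KP" "N x \<le> 2 powi (- j)" "N (y -\<^sub>C z *\<^sub>C x) \<le> 2 powi (- k)"
      by (auto simp: Lat_def)
    have "N (z -\<^sub>C z') * N x \<le> 2 powi (j - k') * 2 powi (- j)"
      using h xy assms by (intro mult_mono N_nonneg) auto
    also have "\<dots> = 2 powi (- k')" by (simp flip: power_int_add)
    finally have 1: "N ((z -\<^sub>C z') *\<^sub>C x) \<le> 2 powi (- k')" using xy assms by (simp add: N_mult)
    have "y -\<^sub>C z' *\<^sub>C x = (y -\<^sub>C z *\<^sub>C x) +\<^sub>C (z -\<^sub>C z') *\<^sub>C x" using xy(2,3) assms by algebra
    also have "N \<dots> \<le> max (N (y -\<^sub>C z *\<^sub>C x)) (N ((z -\<^sub>C z') *\<^sub>C x))"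
      using xy assms by (intro N_add) auto
    also have "\<dots> \<le> 2 powi (- k')"
      using 1 xy(5) h order.trans[OF xy(5), of "2 powi (- k')"] by simp
    finally have "N (y -\<^sub>C z' *\<^sub>C x) \<le> 2 powi (- k')" .
    moreover have "N x \<le> 2 powi (- j')" using xy(4) h order.trans[OF xy(4), of "2 powi (- j')"] by simp
    ultimately show "p \<in> Lat j' k' z'" using xy by (auto simp: Lat_def)
  qed
qed

text \<open>By \<open>V_eq_iff\<close> these vertices behave like closed balls with centre z and
  radius 2^-k. Here k is the difference of the two exponents, which homothety preserves, and density
  allows the centre to be taken in the number field.\<close>

definition V :: "int \<Rightarrow> 'k \<Rightarrow> 'k bt_vertex" where
  "V k z = {Lat n (k + n) (emb z) | n. True}"

lemma lat_subset_iff: "Lat j k (emb z) \<subseteq> Lat j' k' (emb z') \<longleftrightarrow> j' \<le> j \<and> k' \<le> k \<and> padic_abs P (z - z') \<le> 2 powi (j - k')"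
  by (simp add: Lat_subset_iff flip: emb_diff)

lemma lat_eq_iff: "Lat j k (emb z) = Lat j' k' (emb z') \<longleftrightarrow> j = j' \<and> k = k' \<and> padic_abs P (z - z') \<le> 2 powi (j - k)"
proof -
  have "padic_abs P (z' - z) = padic_abs P (z - z')" by (metis minus_diff_eq padic_abs_minus)
  then show ?thesis by (auto simp: set_eq_subset lat_subset_iff)
qed

lemma V_eq_iff: "V k z = V k' z' \<longleftrightarrow> k = k' \<and> padic_abs P (z - z') \<le> 2 powi (- k)"
proof
  assume "V k z = V k' z'"
  moreover have "Lat 0 k (emb z) \<in> V k z" unfolding V_def by (intro CollectI exI[of _ 0]) simp
  ultimately obtain n where "Lat 0 k (emb z) = Lat n (k' + n) (emb z')" by (auto simp: V_def)
  then show "k = k' \<and> padic_abs P (z - z') \<le> 2 powi (- k)" by (auto simp: lat_eq_iff)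
next
  assume "k = k' \<and> padic_abs P (z - z') \<le> 2 powi (- k)"
  then have "Lat n (k + n) (emb z) = Lat n (k' + n) (emb z')" for n
    by (auto simp: lat_eq_iff)
  then show "V k z = V k' z'" by (simp add: V_def)
qed

lemma homothety_class_V: "homothety_class P (Lat j k (emb z)) = V (k - j) z"
  unfolding homothety_class_Lat[OF emb_closed] V_def
proof (intro equalityI subsetI)
  fix L assume "L \<in> {Lat (j + n) (k + n) (emb z) |n. True}"
  then obtain n where "L = Lat (j + n) (k + n) (emb z)" by blast
  then show "L \<in> {Lat n (k - j + n) (emb z) |n. True}" by (intro CollectI exI[of _ "j + n"]) simp
next
  fix L assume "L \<in> {Lat n (k - j + n) (emb z) |n. True}"
  then obtain n where "L = Lat n (k - j + n) (emb z)" by blast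
  then show "L \<in> {Lat (j + n) (k + n) (emb z) |n. True}"
    by (intro CollectI exI[of _ "n - j"]) (simp add: algebra_simps)
qed

lemma V_in_bt_vertices: "V k z \<in> bt_vertices P"
  unfolding bt_vertices_def using homothety_class_V[of 0 k z] Lat_mem_bt_lattices[OF emb_closed] by force

lemma bt_vertices_cases:
  assumes "v \<in> bt_vertices P"
  obtains k z where "v = V k z"
proof -
  obtain L where L: "L \<in> bt_lattices P" "v = homothety_class P L" using assms by (auto simp: bt_vertices_def)
  then obtain j k z where z: "z \<in> KP" "L = Lat j k z" using bt_lattices_Lat by blast
  obtain x where x: "N (z -\<^sub>C emb x) \<le> 2 powi (j - k)" using emb_dense[OF z(1), of "2 powi (j - k)"] by auto
  have "N (emb x -\<^sub>C z) = N (z -\<^sub>C emb x)"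
    using N_minus[of "z -\<^sub>C emb x"] z(1) C.minus_closed by (metis C.minus_minus C.minus_add C.a_comm C.a_inv_closed a_minus_def emb_closed)
  then have "L = Lat j k (emb x)"
    unfolding z(2) set_eq_subset using x z(1) by (simp add: Lat_subset_iff)
  then show ?thesis using that L(2) homothety_class_V by blast
qed

text \<open>The value group is discrete, so an absolute value below 1 is at most 1/2, the absolute
  value of \<open>unif\<close>.\<close>

lemma uniformizer_iff: "uniformizer P \<pi> \<longleftrightarrow> \<pi> \<in> KP \<and> N \<pi> = 1 / 2"
proof -
  have ideal: "PIdl\<^bsub>completion_int P\<^esub> \<pi> = {x *\<^sub>C \<pi> | x. x \<in> KP \<and> N x \<le> 1}" for \<pi>
    by (auto simp: cgenideal_def completion_int_def)
  have half: "N c \<le> 1 / 2" if c: "c \<in> KP" "N c < 1" for c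
  proof (cases "c = 0\<^sub>C")
    case False
    then obtain n where n: "N c = 2 powi n" using N_value[OF c(1)] by blast
    then have "n < 0" using c(2) two_powi_less_iff[of n 0] by simp
    then have "(2::real) powi n \<le> 2 powi (- 1)" by (simp only: two_powi_le_iff)
    then show ?thesis by (simp add: n power_int_minus)
  qed simp
  show ?thesis
  proof
    assume "uniformizer P \<pi>"
    then have pi: "\<pi> \<in> KP" "{x *\<^sub>C \<pi> | x. x \<in> KP \<and> N x \<le> 1} = {c \<in> KP. N c < 1}"
      unfolding uniformizer_def ideal by (auto simp: completion_int_def)
    have "1\<^sub>C *\<^sub>C \<pi> \<in> {x *\<^sub>C \<pi> | x. x \<in> KP \<and> N x \<le> 1}" by (intro CollectI exI[of _ "1\<^sub>C"]) simp
    then have "N \<pi> < 1" unfolding pi(2) using pi(1) by simp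
    then have "N \<pi> \<le> 1 / 2" using half pi(1) by blast
    have "emb unif \<in> {c \<in> KP. N c < 1}" by (simp add: padic_abs_unif)
    then obtain x where x: "x \<in> KP" "N x \<le> 1" "emb unif = x *\<^sub>C \<pi>" unfolding pi(2)[symmetric] by blast
    then have "1 / 2 = N x * N \<pi>" using N_emb[of unif] pi(1) by (simp add: N_mult padic_abs_unif)
    also have "\<dots> \<le> N \<pi>" using x pi(1) by (intro mult_left_le_one_le N_nonneg)
    finally show "\<pi> \<in> KP \<and> N \<pi> = 1 / 2" using \<open>N \<pi> \<le> 1 / 2\<close> pi(1) by simp
  next
    assume pi: "\<pi> \<in> KP \<and> N \<pi> = 1 / 2"
    then have nz: "\<pi> \<noteq> 0\<^sub>C" by auto
    have "{x *\<^sub>C \<pi> | x. x \<in> KP \<and> N x \<le> 1} = {c \<in> KP. N c < 1}"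
    proof (intro equalityI subsetI)
      fix c assume "c \<in> {c \<in> KP. N c < 1}"
      then have c: "c \<in> KP" "N c \<le> 1 / 2" using half by auto
      then obtain q where "q \<in> KP" "q *\<^sub>C \<pi> = c" "N q = N c / N \<pi>" using completion_divide pi nz by metis
      then show "c \<in> {x *\<^sub>C \<pi> | x. x \<in> KP \<and> N x \<le> 1}" using c pi by (intro CollectI exI[of _ q]) auto
    next
      fix c assume "c \<in> {x *\<^sub>C \<pi> | x. x \<in> KP \<and> N x \<le> 1}"
      then obtain x where x: "x \<in> KP" "N x \<le> 1" "c = x *\<^sub>C \<pi>" by blast
      have "N x * N \<pi> \<le> N \<pi>" using x pi by (intro mult_left_le_one_le N_nonneg) auto
      then have "N x * N \<pi> < 1" using pi by linarith
      moreover have "N c = N x * N \<pi>" using x pi by (simp only: N_mult)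
      ultimately show "c \<in> {c \<in> KP. N c < 1}" using x pi by simp
    qed
    then show "uniformizer P \<pi>" unfolding uniformizer_def ideal using pi by (auto simp: completion_int_def)
  qed
qed

lemma uniformizer_cpow: "uniformizer P (cpow 1)"
  by (simp add: uniformizer_iff power_int_minus)

lemma uniformizer_scale_Lat:
  assumes "uniformizer P \<pi>"
  shows "vec_scale P \<pi> ` Lat j k (emb z) = Lat (j + 1) (k + 1) (emb z)"
  using assms by (intro vec_scale_Lat) (auto simp: uniformizer_iff power_int_minus)

lemma standard_vertex_eq: "standard_vertex P = V 0 0"
proof -
  have "carrier (completion_int P) \<times> carrier (completion_int P) = Lat 0 0 (emb 0)"
    by (auto simp: completion_int_def Lat_def a_minus_def)
  then show ?thesis unfolding standard_vertex_def by (simp only: homothety_class_V diff_self)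
qed

lemma N_int_pow:
  assumes "\<pi> \<in> KP" "N \<pi> = 1 / 2"
  shows "\<pi> [^]\<^bsub>completion P\<^esub> (k::int) \<in> KP \<and> N (\<pi> [^]\<^bsub>completion P\<^esub> k) = 2 powi (- k)"
proof -
  have "N (\<pi> [^]\<^bsub>completion P\<^esub> n) = (1 / 2) ^ n" for n :: nat
    by (induction n) (use assms in \<open>simp_all add: N_mult\<close>)
  then have nat: "N (\<pi> [^]\<^bsub>completion P\<^esub> n) = 2 powi (- int n)" for n :: nat
    by (simp add: power_int_minus power_one_over inverse_eq_divide)
  have nz: "\<pi> \<noteq> 0\<^sub>C" using assms by auto
  show ?thesis
  proof (cases "k < 0")
    case False
    have "int (nat k) = k" using False by simp
    then have "N (\<pi> [^]\<^bsub>completion P\<^esub> nat k) = 2 powi (- k)" using nat[of "nat k"] by (simp only:)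
    moreover have "\<pi> [^]\<^bsub>completion P\<^esub> k = \<pi> [^]\<^bsub>completion P\<^esub> nat k"
      using False by (simp only: int_pow_def2 if_False)
    ultimately show ?thesis using C.nat_pow_closed[OF assms(1)] by simp
  next
    case True
    let ?p = "\<pi> [^]\<^bsub>completion P\<^esub> nat (- k)"
    have "- int (nat (- k)) = k" using True by simp
    then have p: "?p \<in> KP" "N ?p = 2 powi k"
      using C.nat_pow_closed[OF assms(1)] nat[of "nat (- k)"] by (simp_all only:)
    then have "?p \<noteq> 0\<^sub>C" by (metis N_zero power_int_eq_0_iff zero_neq_numeral)
    then have u: "?p \<in> Units (completion P)" using p C.field_Units by auto
    have "N (inv\<^bsub>completion P\<^esub> ?p) = inverse (N ?p)"
      using u p by (intro N_inverse) auto
    moreover have "\<pi> [^]\<^bsub>completion P\<^esub> k = inv\<^bsub>completion P\<^esub> ?p"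
      using True by (simp only: int_pow_def2 if_True)
    ultimately show ?thesis using C.Units_inv_closed[OF u] p by (simp add: power_int_minus)
  qed
qed

text \<open>In the language of balls the apartment consists of the balls around 0; a power of a
  uniformizer matters only through its absolute value.\<close>

lemma standard_apartment_eq: "standard_apartment P = range (\<lambda>k. V k 0)"
proof -
  have eq: "homothety_class P (carrier (completion_int P) \<times>
         (\<lambda>y. \<pi> [^]\<^bsub>completion P\<^esub> k *\<^sub>C y) ` carrier (completion_int P)) = V k 0"
    if "uniformizer P \<pi>" for \<pi> and k :: int
  proof -
    let ?c = "\<pi> [^]\<^bsub>completion P\<^esub> k"
    have c: "?c \<in> KP" "N ?c = 2 powi (- k)" using N_int_pow that by (auto simp: uniformizer_iff)
    then have nz: "?c \<noteq> 0\<^sub>C" by (metis N_zero power_int_eq_0_iff zero_neq_numeral)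
    have "(\<lambda>y. ?c *\<^sub>C y) ` carrier (completion_int P) = {y \<in> KP. N y \<le> 2 powi (- k)}"
    proof (intro equalityI subsetI)
      fix y assume "y \<in> (\<lambda>y. ?c *\<^sub>C y) ` carrier (completion_int P)"
      then obtain q where q: "q \<in> KP" "N q \<le> 1" "y = ?c *\<^sub>C q" by (auto simp: completion_int_def)
      then have "N y \<le> N ?c" using c by (simp only: N_mult) (intro mult_right_le_one_le N_nonneg, auto)
      then show "y \<in> {y \<in> KP. N y \<le> 2 powi (- k)}" using q c by simp
    next
      fix y assume y: "y \<in> {y \<in> KP. N y \<le> 2 powi (- k)}"
      then obtain q where q: "q \<in> KP" "q *\<^sub>C ?c = y" "N q = N y / N ?c" using completion_divide[of y ?c] c nz by auto
      then have "N q \<le> 1" using y c by simp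
      then show "y \<in> (\<lambda>y. ?c *\<^sub>C y) ` carrier (completion_int P)"
        using q c by (intro image_eqI[of _ _ q]) (auto simp: completion_int_def C.m_comm)
    qed
    then have "carrier (completion_int P) \<times> (\<lambda>y. ?c *\<^sub>C y) ` carrier (completion_int P) = Lat 0 k (emb 0)"
      by (auto simp: completion_int_def Lat_def a_minus_def)
    then show ?thesis by (simp only: homothety_class_V) simp
  qed
  show ?thesis unfolding standard_apartment_def using eq uniformizer_cpow by (auto simp: image_iff) metis+
qed

end

lemma diag2_nth [simp]:
  "diag2 a b $ 1 $ 1 = a" "diag2 a b $ 1 $ 2 = 0" "diag2 a b $ 2 $ 1 = 0" "diag2 a b $ 2 $ 2 = b"
  by (simp_all add: diag2_def)

section \<open>Distances in the tree and side branches\<close>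

context prime_place
begin

text \<open>The representative of v whose first coordinates fill pi^n O; with this indexing
  homothety is a shift of n.\<close>

definition lat :: "'k bt_vertex \<Rightarrow> int \<Rightarrow> 'k compl_vec set" where
  "lat v n = (THE L. L \<in> v \<and> (\<exists>k z. L = Lat n k (emb z)))"

lemma lat_V: "lat (V k z) n = Lat n (k + n) (emb z)"
  unfolding lat_def
proof (rule the_equality)
  show "Lat n (k + n) (emb z) \<in> V k z \<and> (\<exists>k' z'. Lat n (k + n) (emb z) = Lat n k' (emb z'))"
    unfolding V_def by blast
  fix L assume "L \<in> V k z \<and> (\<exists>k z. L = Lat n k (emb z))"
  then obtain m k' z' where "L = Lat m (k + m) (emb z)" "L = Lat n k' (emb z')" by (auto simp: V_def)
  then show "L = Lat n (k + n) (emb z)" using lat_eq_iff by metis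
qed

text \<open>Containments between the lattices of two vertices in both directions give a lower bound
  for the distance, since each edge costs one power of the uniformizer for the round trip.\<close>

definition near :: "'k bt_vertex \<Rightarrow> 'k bt_vertex \<Rightarrow> int \<Rightarrow> bool" where
  "near v w m \<longleftrightarrow> (\<exists>a b. lat v a \<subseteq> lat w 0 \<and> lat w b \<subseteq> lat v 0 \<and> a + b \<le> m)"

lemma lat_shift:
  assumes "v \<in> bt_vertices P" "w \<in> bt_vertices P"
  shows "lat v a \<subseteq> lat w b \<longleftrightarrow> lat v (a + n) \<subseteq> lat w (b + n)"
proof -
  obtain k z k' z' where "v = V k z" "w = V k' z'" using assms by (metis bt_vertices_cases)
  moreover have "a + n - (k' + (b + n)) = a - (k' + b)" by simp
  ultimately show ?thesis by (simp only: lat_V lat_subset_iff add_le_cancel_right add.assoc[symmetric])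
qed

lemma near_trans:
  assumes "u \<in> bt_vertices P" "v \<in> bt_vertices P" "w \<in> bt_vertices P" "near u v m" "near v w n"
  shows "near u w (m + n)"
proof -
  obtain a b c d where ab: "lat u a \<subseteq> lat v 0" "lat v b \<subseteq> lat u 0" "a + b \<le> m"
    "lat v c \<subseteq> lat w 0" "lat w d \<subseteq> lat v 0" "c + d \<le> n"
    using assms unfolding near_def by blast
  have "lat u (a + c) \<subseteq> lat w 0"
    using lat_shift[OF assms(1,2), of a 0 c] ab by auto
  moreover have "lat w (d + b) \<subseteq> lat u 0"
    using lat_shift[OF assms(3,2), of d 0 b] ab by auto
  ultimately show ?thesis
    unfolding near_def using ab by (intro exI[of _ "a + c"] exI[of _ "d + b"]) auto
qed

lemma mem_V_imp: "L \<in> V k z \<Longrightarrow> \<exists>n. L = lat (V k z) n"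
  unfolding lat_V by (simp add: V_def)

lemma bt_adj_near:
  assumes "(v, w) \<in> bt_adj P"
  shows "near v w 1"
proof -
  have vw: "v \<in> bt_vertices P" "w \<in> bt_vertices P" using assms by (auto simp: bt_adj_def)
  then obtain k z k' z' where kz: "v = V k z" "w = V k' z'" by (metis bt_vertices_cases)
  obtain L L' \<pi> where L: "L \<in> v" "L' \<in> w" "uniformizer P \<pi>" "vec_scale P \<pi> ` L \<subset> L'" "L' \<subset> L"
    using assms by (auto simp: bt_adj_def)
  obtain n where "L = lat v n" using mem_V_imp[of L k z] L(1) unfolding kz by blast
  moreover obtain n' where "L' = lat w n'" using mem_V_imp[of L' k' z'] L(2) unfolding kz by blast
  ultimately have n: "L = lat v n" "L' = lat w n'" by auto
  have "vec_scale P \<pi> ` L = lat v (n + 1)"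
    unfolding n kz lat_V uniformizer_scale_Lat[OF L(3)] by (simp add: add.assoc)
  then have "lat v (n + 1) \<subseteq> lat w n'" "lat w n' \<subseteq> lat v n" using L n by auto
  then have "lat v (n + 1 - n') \<subseteq> lat w 0" "lat w (n' - n) \<subseteq> lat v 0"
    using lat_shift[OF vw, of "n + 1" n' "- n'"] lat_shift[OF vw(2,1), of n' n "- n"] by auto
  \<comment> \<open>The two exponents add up to 1 whichever representatives were chosen.\<close>
  then show ?thesis unfolding near_def by (intro exI[of _ "n + 1 - n'"] exI[of _ "n' - n"]) auto
qed

lemma near_refl: "v \<in> bt_vertices P \<Longrightarrow> near v v 0"
  unfolding near_def by (intro exI[of _ 0]) auto

lemma relpow_near:
  assumes "v \<in> bt_vertices P" "(v, w) \<in> bt_adj P ^^ n"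
  shows "w \<in> bt_vertices P \<and> near v w (int n)"
  using assms(2)
proof (induction n arbitrary: w)
  case 0
  then show ?case using assms(1) near_refl by auto
next
  case (Suc n)
  then obtain u where u: "(v, u) \<in> bt_adj P ^^ n" "(u, w) \<in> bt_adj P" by auto
  then have w: "w \<in> bt_vertices P" "u \<in> bt_vertices P" by (auto simp: bt_adj_def)
  then show ?case
    using near_trans[OF assms(1) w(2,1), of "int n" 1] Suc.IH[OF u(1)] bt_adj_near[OF u(2)]
    by (simp add: add.commute)
qed

text \<open>For t \<le> k the ball of radius 2^-k around z leaves the apartment at level t, so a
  path to level j takes k - t steps to the apartment and |j - t| steps along it. The four
  inequalities bound a below by the larger of 0 and j - t, and b by the larger of k - j and k -
  t.\<close>

lemma near_apartment_ge:
  assumes "near (V k z) (V j 0) m" "padic_abs P z = 2 powi (- t)"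
  shows "k - t + \<bar>j - t\<bar> \<le> m"
proof -
  obtain a b where ab: "Lat a (k + a) (emb z) \<subseteq> Lat 0 j (emb 0)" "Lat b (j + b) (emb 0) \<subseteq> Lat 0 k (emb z)" "a + b \<le> m"
    using assms(1) unfolding near_def lat_V by auto
  have "0 \<le> a" "- t \<le> a - j" "k \<le> j + b" "- t \<le> b - k"
    using ab(1,2) assms(2) unfolding lat_subset_iff by simp_all
  then show ?thesis using ab(3) by linarith
qed

lemma bt_adj_step: "(V k z, V (k - 1) z) \<in> bt_adj P"
proof -
  have L: "Lat 0 k (emb z) \<in> V k z" "Lat 1 k (emb z) \<in> V (k - 1) z"
    unfolding V_def by (force intro: exI[of _ 0] exI[of _ 1])+
  have "Lat 1 (k + 1) (emb z) \<subset> Lat 1 k (emb z)" "Lat 1 k (emb z) \<subset> Lat 0 k (emb z)"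
    by (auto simp: psubset_eq lat_subset_iff lat_eq_iff)
  moreover have "vec_scale P (cpow 1) ` Lat 0 k (emb z) = Lat 1 (k + 1) (emb z)"
    using uniformizer_scale_Lat[OF uniformizer_cpow, of 0 k z] by simp
  ultimately show ?thesis
    unfolding bt_adj_def mem_Collect_eq case_prod_conv
    by (intro conjI V_in_bt_vertices bexI[OF _ L(1)] bexI[OF _ L(2)] exI[of _ "cpow 1"] uniformizer_cpow)
       simp_all
qed

lemma bt_path: "(V k z, V (k - int n) z) \<in> bt_adj P ^^ n"
proof (induction n)
  case (Suc n)
  have "k - int (Suc n) = k - int n - 1" by simp
  then show ?case using relpow_Suc_I[OF Suc bt_adj_step] by (simp only:)
qed simp

lemma bt_dist_le: "(v, w) \<in> bt_adj P ^^ n \<Longrightarrow> bt_dist P v w \<le> enat n"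
  unfolding bt_dist_def by (rule INF_lower) simp

lemma enat_INF_le_imp:
  fixes f :: "'b \<Rightarrow> enat"
  assumes "(INF x\<in>A. f x) \<le> enat e"
  shows "\<exists>x\<in>A. f x \<le> enat e"
proof (rule ccontr)
  assume "\<not> ?thesis"
  then have "enat (Suc e) \<le> f x" if "x \<in> A" for x
    using that by (metis Suc_ile_eq not_le)
  then have "enat (Suc e) \<le> (INF x\<in>A. f x)" by (rule INF_greatest)
  then show False using assms by (metis Suc_ile_eq not_le)
qed

text \<open>Enlarging the ball around z step by step, one reaches at radius 2^-t a ball that
  contains 0, which is an apartment vertex.\<close>

lemma bt_dist_apartment_le:
  assumes "padic_abs P z \<le> 2 powi (- t)" "t \<le> k"
  shows "bt_dist P (V k z) (V t 0) \<le> enat (nat (k - t))"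
proof -
  have "V t z = V t 0" using assms(1) by (simp add: V_eq_iff)
  moreover have "k - int (nat (k - t)) = t" using assms(2) by simp
  ultimately show ?thesis using bt_dist_le[OF bt_path[of k z "nat (k - t)"]] by (simp only:)
qed

lemma bt_dist_apartment_ge:
  assumes "padic_abs P z = 2 powi (- t)"
  shows "enat (nat (k - t + \<bar>j - t\<bar>)) \<le> bt_dist P (V k z) (V j 0)"
  unfolding bt_dist_def
proof (rule INF_greatest)
  fix n assume "n \<in> {n. (V k z, V j 0) \<in> bt_adj P ^^ n}"
  then have "near (V k z) (V j 0) (int n)" using relpow_near V_in_bt_vertices by blast
  then show "enat (nat (k - t + \<bar>j - t\<bar>)) \<le> enat n" using near_apartment_ge[of k z j "int n", OF _ assms] by (simp add: nat_le_iff)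
qed

text \<open>A vertex off the apartment meets it at the level t with |z| = 2^-t, and that is its
  unique nearest point. So the nearest vertex is the standard one exactly for |z| = 1, and then k is
  the distance.\<close>

lemma side_branch_eq:
  "side_branch P e = {V k z | k z. 0 \<le> k \<and> k \<le> int e \<and> padic_abs P z = 1}"
proof (intro equalityI subsetI)
  fix v assume v: "v \<in> side_branch P e"
  then have vv: "v \<in> bt_vertices P" and inf: "(INF a\<in>range (\<lambda>k. V k 0). bt_dist P v a) \<le> enat e"
    and near: "\<And>j. j \<noteq> 0 \<Longrightarrow> bt_dist P v (V 0 0) < bt_dist P v (V j 0)"
    unfolding side_branch_def standard_apartment_eq standard_vertex_eq by (auto simp: V_eq_iff)
  obtain k z where kz: "v = V k z" using vv by (rule bt_vertices_cases)
  show "v \<in> {V k z | k z. 0 \<le> k \<and> k \<le> int e \<and> padic_abs P z = 1}"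
  proof (cases "padic_abs P z \<le> 2 powi (- k)")
    case True
    \<comment> \<open>A ball containing 0 is itself on the apartment, so it must be the standard
      vertex; the centre 1 describes the same ball and has absolute value 1.\<close>
    then have "bt_dist P v (V k 0) \<le> enat 0" using bt_dist_apartment_le[of z k k] kz by simp
    then have "\<not> bt_dist P v (V 0 0) < bt_dist P v (V k 0)"
      by (simp flip: zero_enat_def)
    then have "k = 0" using near[of k] by blast
    then have "v = V 0 1" using True kz padic_abs_diff[of z 1] by (simp add: V_eq_iff)
    then show ?thesis by (intro CollectI exI[of _ 0] exI[of _ 1]) simp
  next
    case False
    then have "z \<noteq> 0" by auto
    then obtain t' where "padic_abs P z = 2 powi t'" using padic_abs_value by blast
    then obtain t where t: "padic_abs P z = 2 powi (- t)" by (metis minus_minus)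
    then have tk: "t < k" using False by simp
    have le: "bt_dist P v (V t 0) \<le> enat (nat (k - t))"
      using bt_dist_apartment_le[of z t k] t tk kz by simp
    have ge: "enat (nat (k - t + \<bar>j - t\<bar>)) \<le> bt_dist P v (V j 0)" for j
      unfolding kz by (rule bt_dist_apartment_ge[OF t])
    \<comment> \<open>Otherwise the apartment vertex at level t would be closer than the standard
      one.\<close>
    have "t = 0"
    proof (rule ccontr)
      assume "t \<noteq> 0"
      then have "enat (nat (k - t + \<bar>0 - t\<bar>)) < enat (nat (k - t))"
        using near[of t] ge[of 0] le by (meson le_less_trans less_le_trans)
      then show False by simp
    qed
    obtain j where j: "bt_dist P v (V j 0) \<le> enat e" using enat_INF_le_imp[OF inf] by auto
    have "enat (nat (k + \<bar>j\<bar>)) \<le> enat e" using order.trans[OF ge[of j] j] \<open>t = 0\<close> by simp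
    then have "k \<le> int e" by simp
    then show ?thesis using kz tk t \<open>t = 0\<close> by (intro CollectI exI[of _ k] exI[of _ z]) simp
  qed
next
  fix v assume "v \<in> {V k z | k z. 0 \<le> k \<and> k \<le> int e \<and> padic_abs P z = 1}"
  then obtain k z where kz: "v = V k z" "0 \<le> k" "k \<le> int e" "padic_abs P z = 1"
    by (elim CollectE exE conjE)
  have le: "bt_dist P v (V 0 0) \<le> enat (nat k)"
    using bt_dist_apartment_le[of z 0 k] kz by simp
  show "v \<in> side_branch P e"
    unfolding side_branch_def standard_apartment_eq standard_vertex_eq
  proof (intro CollectI conjI ballI impI)
    show "v \<in> bt_vertices P" using kz V_in_bt_vertices by simp
    have "(INF a\<in>range (\<lambda>k. V k 0). bt_dist P v a) \<le> bt_dist P v (V 0 0)"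
      by (rule INF_lower) blast
    also note le
    also have "enat (nat k) \<le> enat e" using kz by simp
    finally show "(INF a\<in>range (\<lambda>k. V k 0). bt_dist P v a) \<le> enat e" .
    fix a assume "a \<in> range (\<lambda>k. V k 0)" "a \<noteq> V 0 0"
    then obtain j where j: "a = V j 0" "j \<noteq> 0" by auto
    have "enat (nat k) < enat (nat (k - 0 + \<bar>j - 0\<bar>))" using j kz by simp
    also have "\<dots> \<le> bt_dist P v a"
      unfolding j kz(1) by (rule bt_dist_apartment_ge) (simp add: kz)
    finally show "bt_dist P v (V 0 0) < bt_dist P v a" using le by simp
  qed
qed

lemma vertex_act_V:
  assumes u: "padic_abs P u = 1"
  shows "vertex_act P (diag2 1 u) (V k z) = V k (u * z)"
proof -
  have act: "mat_act P (diag2 1 u) (x, y) = (x, emb u *\<^sub>C y)" if "x \<in> KP" "y \<in> KP" for x y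
    using that by (simp add: mat_act_def)
  have img: "mat_act P (diag2 1 u) ` Lat j l (emb z) = Lat j l (emb (u * z))" for j l
  proof -
    have key: "(x, emb u *\<^sub>C y) \<in> Lat j l (emb (u * z)) \<longleftrightarrow> (x, y) \<in> Lat j l (emb z)" if "x \<in> KP" "y \<in> KP" for x y
    proof -
      have "emb u *\<^sub>C y -\<^sub>C emb (u * z) *\<^sub>C x = emb u *\<^sub>C (y -\<^sub>C emb z *\<^sub>C x)"
        unfolding emb_mult using that emb_closed[of u] emb_closed[of z] by algebra
      then show ?thesis using that u by (simp add: Lat_def N_mult)
    qed
    show ?thesis
    proof (intro equalityI subsetI)
      fix p assume "p \<in> mat_act P (diag2 1 u) ` Lat j l (emb z)"
      then obtain x y where xy: "(x, y) \<in> Lat j l (emb z)" "p = mat_act P (diag2 1 u) (x, y)" by auto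
      moreover from xy(1) have "x \<in> KP" "y \<in> KP" by (auto simp: Lat_def)
      ultimately show "p \<in> Lat j l (emb (u * z))" using act key by metis
    next
      fix p assume p: "p \<in> Lat j l (emb (u * z))"
      then obtain x y where xy: "p = (x, y)" "x \<in> KP" "y \<in> KP" by (auto simp: Lat_def)
      have "emb u \<noteq> 0\<^sub>C" using u N_emb[of u] by (metis N_zero zero_neq_one)
      then obtain y' where "y' \<in> KP" "y' *\<^sub>C emb u = y" using completion_divide[OF xy(3) emb_closed] by metis
      then have y': "y' \<in> KP" "emb u *\<^sub>C y' = y" by (simp_all add: C.m_comm)
      then have "(x, y') \<in> Lat j l (emb z)" using key[OF xy(2) y'(1)] p xy(1) by simp
      then show "p \<in> mat_act P (diag2 1 u) ` Lat j l (emb z)"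
        using act[OF xy(2) y'(1)] y'(2) xy(1) by (intro image_eqI[of _ _ "(x, y')"]) simp_all
    qed
  qed
  have "V l y = range (\<lambda>n. Lat n (l + n) (emb y))" for l y by (auto simp: V_def)
  then show ?thesis by (simp only: vertex_act_def image_image img)
qed

end

section \<open>Integral forms and lattices\<close>

lemma mat2_mult_nth: "(A ** B) $ i $ j = A $ i $ 1 * B $ 1 $ j + A $ i $ 2 * B $ 2 $ j"
  for A B :: "'k::field_char_0^2^2"
  by (simp add: matrix_matrix_mult_def sum_2)

lemma mat2_eq_iff:
  "A = B \<longleftrightarrow> A $ 1 $ 1 = B $ 1 $ 1 \<and> A $ 1 $ 2 = B $ 1 $ 2 \<and> A $ 2 $ 1 = B $ 2 $ 1 \<and> A $ 2 $ 2 = B $ 2 $ 2"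
  for A B :: "'k::field_char_0^2^2"
  by (auto simp: vec_eq_iff forall_2)

lemma mat2_1_nth [simp]:
  "(mat 1 :: 'k::field_char_0^2^2) $ 1 $ 1 = 1" "(mat 1 :: 'k::field_char_0^2^2) $ 1 $ 2 = 0"
  "(mat 1 :: 'k::field_char_0^2^2) $ 2 $ 1 = 0" "(mat 1 :: 'k::field_char_0^2^2) $ 2 $ 2 = 1"
  by (simp_all add: mat_def)

definition mat2 :: "'k::field_char_0 \<Rightarrow> 'k \<Rightarrow> 'k \<Rightarrow> 'k \<Rightarrow> 'k^2^2" where
  "mat2 a b c d = vector [vector [a, b], vector [c, d]]"

lemma mat2_nth [simp]:
  "mat2 a b c d $ 1 $ 1 = a" "mat2 a b c d $ 1 $ 2 = b" "mat2 a b c d $ 2 $ 1 = c" "mat2 a b c d $ 2 $ 2 = d"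
  by (simp_all add: mat2_def)

lemma GL2_simps [simp]: "A \<otimes>\<^bsub>GL2 S\<^esub> B = A ** B" "\<one>\<^bsub>GL2 S\<^esub> = mat 1"
  by (simp_all add: GL2_def)

lemma GL2_UNIV_iff: "A \<in> carrier (GL2 UNIV) \<longleftrightarrow> invertible A"
  by (simp add: GL2_def invertible_def)

lemma matrix_inv_mult:
  fixes A :: "'k::field_char_0^2^2"
  assumes "invertible A"
  shows "A ** matrix_inv A = mat 1" "matrix_inv A ** A = mat 1"
  using someI_ex[of "\<lambda>B. A ** B = mat 1 \<and> B ** A = mat 1"] assms
  by (auto simp: matrix_inv_def invertible_def)

lemma matrix_inv_eqI:
  fixes A :: "'k::field_char_0^2^2"
  assumes "A ** B = mat 1" "B ** A = mat 1"
  shows "invertible A" "matrix_inv A = B"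
proof -
  show inv: "invertible A" using assms by (auto simp: invertible_def)
  have "matrix_inv A = matrix_inv A ** (A ** B)" by (simp add: assms)
  then show "matrix_inv A = B" by (simp only: matrix_mul_assoc matrix_inv_mult[OF inv] matrix_mul_lid)
qed

lemma invertible_matrix_inv:
  fixes A :: "'k::field_char_0^2^2"
  assumes "invertible A"
  shows "invertible (matrix_inv A)" "matrix_inv (matrix_inv A) = A"
  using matrix_inv_eqI[of "matrix_inv A" A] matrix_inv_mult[OF assms] by auto

lemma matrix_inv_mat_mult:
  fixes A B :: "'k::field_char_0^2^2"
  assumes "invertible A" "invertible B"
  shows "matrix_inv (A ** B) = matrix_inv B ** matrix_inv A"
proof (rule matrix_inv_eqI)
  have "A ** B ** (matrix_inv B ** matrix_inv A) = A ** (B ** matrix_inv B) ** matrix_inv A"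
    by (simp add: matrix_mul_assoc)
  then show "A ** B ** (matrix_inv B ** matrix_inv A) = mat 1" using assms by (simp add: matrix_inv_mult)
  have "matrix_inv B ** matrix_inv A ** (A ** B) = matrix_inv B ** (matrix_inv A ** A) ** B"
    by (simp add: matrix_mul_assoc)
  then show "matrix_inv B ** matrix_inv A ** (A ** B) = mat 1" using assms by (simp add: matrix_inv_mult)
qed

definition app :: "'k::field_char_0^2^2 \<Rightarrow> 'k \<times> 'k \<Rightarrow> 'k \<times> 'k" where
  "app A = (\<lambda>(x, y). (A $ 1 $ 1 * x + A $ 1 $ 2 * y, A $ 2 $ 1 * x + A $ 2 $ 2 * y))"

lemma app_mult: "app (A ** B) p = app A (app B p)"
  by (cases p) (simp add: app_def mat2_mult_nth algebra_simps)

lemma app_one [simp]: "app (mat 1) p = p"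
  by (cases p) (simp add: app_def)

lemma app_mult_image: "app (A ** B) ` S = app A ` app B ` S"
  by (simp add: image_image app_mult)

lemma app_inv:
  assumes "invertible A"
  shows "app A (app (matrix_inv A) p) = p" "app (matrix_inv A) (app A p) = p"
  using matrix_inv_mult[OF assms] by (simp_all flip: app_mult)

lemma app_image_eq_iff:
  assumes "invertible A"
  shows "app A ` S = T \<longleftrightarrow> S = app (matrix_inv A) ` T"
proof -
  have "app (matrix_inv A) ` app A ` S = S" "app A ` app (matrix_inv A) ` T = T"
    by (simp_all add: image_image app_inv[OF assms])
  then show ?thesis by auto
qed

definition O2 :: "('k::field_char_0 \<times> 'k) set" where
  "O2 = {(x, y). algebraic_int x \<and> algebraic_int y}"

lemma integral_entries_iff:
  "(\<forall>i j. algebraic_int (M $ i $ j)) \<longleftrightarrow> app M ` O2 \<subseteq> O2"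
  for M :: "'k::field_char_0^2^2"
proof
  assume M: "\<forall>i j. algebraic_int (M $ i $ j)"
  then show "app M ` O2 \<subseteq> O2"
    by (auto simp: O2_def app_def intro!: algebraic_int_add algebraic_int_mult)
next
  assume "app M ` O2 \<subseteq> O2"
  then have "app M (1, 0) \<in> O2" "app M (0, 1) \<in> O2" by (auto simp: O2_def)
  then show "\<forall>i j. algebraic_int (M $ i $ j)" by (simp add: O2_def app_def forall_2)
qed

text \<open>Turns conjugation by integral matrices into a question about lattices in K^2.\<close>

lemma GL2_int_iff:
  "M \<in> carrier (GL2 {x. algebraic_int x}) \<longleftrightarrow> invertible M \<and> app M ` O2 = O2"
  for M :: "'k::field_char_0^2^2"
proof
  assume "M \<in> carrier (GL2 {x. algebraic_int x})"
  then obtain B where B: "\<forall>i j. algebraic_int (M $ i $ j)" "\<forall>i j. algebraic_int (B $ i $ j)"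
    "M ** B = mat 1" "B ** M = mat 1" by (auto simp: GL2_def)
  have sub: "app M ` O2 \<subseteq> O2" "app B ` O2 \<subseteq> O2" using B(1,2) integral_entries_iff by blast+
  have "O2 = app M ` app B ` O2" unfolding app_mult_image[symmetric] B(3) by simp
  then have "O2 \<subseteq> app M ` O2" using sub(2) by (metis image_mono)
  then show "invertible M \<and> app M ` O2 = O2" using sub(1) B by (auto simp: invertible_def)
next
  assume M: "invertible M \<and> app M ` O2 = O2"
  then have "app (matrix_inv M) ` O2 = O2" using app_image_eq_iff[of M O2 O2] by auto
  then show "M \<in> carrier (GL2 {x. algebraic_int x})"
    using M matrix_inv_mult[of M] integral_entries_iff[of M] integral_entries_iff[of "matrix_inv M"]
    unfolding GL2_def by auto
qed

lemma group_GL2_int: "group (GL2 {x :: 'k::field_char_0. algebraic_int x})"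
proof (rule groupI)
  let ?G = "GL2 {x :: 'k. algebraic_int x}"
  fix x y z assume x: "x \<in> carrier ?G" and y: "y \<in> carrier ?G" and z: "z \<in> carrier ?G"
  show "x \<otimes>\<^bsub>?G\<^esub> y \<in> carrier ?G"
    using x y by (simp add: GL2_int_iff invertible_mult app_mult_image)
  show "x \<otimes>\<^bsub>?G\<^esub> y \<otimes>\<^bsub>?G\<^esub> z = x \<otimes>\<^bsub>?G\<^esub> (y \<otimes>\<^bsub>?G\<^esub> z)"
    by (simp add: matrix_mul_assoc)
next
  let ?G = "GL2 {x :: 'k. algebraic_int x}"
  have "invertible (mat 1 :: 'k^2^2)" by (auto simp: invertible_def)
  then show "\<one>\<^bsub>?G\<^esub> \<in> carrier ?G" by (simp add: GL2_int_iff)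
  fix x assume x: "x \<in> carrier ?G"
  show "\<one>\<^bsub>?G\<^esub> \<otimes>\<^bsub>?G\<^esub> x = x" by simp
  have "invertible x" using x by (simp add: GL2_int_iff)
  moreover have "matrix_inv x \<in> carrier ?G"
    using x app_image_eq_iff[of x O2 O2] by (auto simp: GL2_int_iff invertible_matrix_inv)
  ultimately show "\<exists>y\<in>carrier ?G. y \<otimes>\<^bsub>?G\<^esub> x = \<one>\<^bsub>?G\<^esub>" by (intro bexI[of _ "matrix_inv x"]) (simp_all add: matrix_inv_mult)
qed

lemma conj_hom_eq:
  "g \<in> carrier G \<Longrightarrow> conj_hom G A \<rho> g = A ** \<rho> g ** matrix_inv A"
  by (simp add: conj_hom_def)

lemma conj_hom_extensional: "conj_hom G A \<rho> \<in> extensional (carrier G)"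
  by (simp add: conj_hom_def)

lemma conj_hom_mult:
  assumes "invertible A" "invertible B"
  shows "conj_hom G A (conj_hom G B \<rho>) = conj_hom G (A ** B) \<rho>"
  by (rule extensionalityI[OF conj_hom_extensional conj_hom_extensional])
     (simp add: conj_hom_eq matrix_inv_mat_mult[OF assms] matrix_mul_assoc)

lemma conj_hom_one:
  fixes \<rho> :: "'g \<Rightarrow> 'k::field_char_0^2^2"
  assumes "\<rho> \<in> extensional (carrier G)"
  shows "conj_hom G (mat 1) \<rho> = \<rho>"
proof -
  have "matrix_inv (mat 1 :: 'k^2^2) = mat 1" by (rule matrix_inv_eqI) simp_all
  then show ?thesis
    by (intro extensionalityI[OF conj_hom_extensional assms]) (simp add: conj_hom_eq)
qed

text \<open>The actions in question are restricted to a set E and behave as group actions only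
  there, hence the relative hypotheses.\<close>

lemma orbit_eq_iff:
  assumes "group G" and closed: "\<And>g x. g \<in> carrier G \<Longrightarrow> x \<in> E \<Longrightarrow> \<phi> g x \<in> E"
    and one: "\<And>x. x \<in> E \<Longrightarrow> \<phi> \<one>\<^bsub>G\<^esub> x = x"
    and mult: "\<And>g h x. g \<in> carrier G \<Longrightarrow> h \<in> carrier G \<Longrightarrow> x \<in> E \<Longrightarrow> \<phi> (g \<otimes>\<^bsub>G\<^esub> h) x = \<phi> g (\<phi> h x)"
    and "x \<in> E" "y \<in> E"
  shows "orbit G \<phi> x = orbit G \<phi> y \<longleftrightarrow> (\<exists>g\<in>carrier G. y = \<phi> g x)"
proof
  interpret group G by fact
  assume "orbit G \<phi> x = orbit G \<phi> y"
  moreover have "y \<in> orbit G \<phi> y" unfolding orbit_def using one[OF \<open>y \<in> E\<close>] one_closed by force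
  ultimately show "\<exists>g\<in>carrier G. y = \<phi> g x" by (auto simp: orbit_def)
next
  interpret group G by fact
  assume "\<exists>g\<in>carrier G. y = \<phi> g x"
  then obtain g where g: "g \<in> carrier G" "y = \<phi> g x" by blast
  show "orbit G \<phi> x = orbit G \<phi> y"
  proof (intro equalityI subsetI)
    fix z assume "z \<in> orbit G \<phi> y"
    then obtain h where "h \<in> carrier G" "z = \<phi> h y" by (auto simp: orbit_def)
    then have "z = \<phi> (h \<otimes>\<^bsub>G\<^esub> g) x" "h \<otimes>\<^bsub>G\<^esub> g \<in> carrier G" using g mult \<open>x \<in> E\<close> by auto
    then show "z \<in> orbit G \<phi> x" unfolding orbit_def by blast
  next
    fix z assume "z \<in> orbit G \<phi> x"
    then obtain h where h: "h \<in> carrier G" "z = \<phi> h x" by (auto simp: orbit_def)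
    have "\<phi> (h \<otimes>\<^bsub>G\<^esub> inv\<^bsub>G\<^esub> g) y = \<phi> (h \<otimes>\<^bsub>G\<^esub> inv\<^bsub>G\<^esub> g \<otimes>\<^bsub>G\<^esub> g) x"
      using g h mult \<open>x \<in> E\<close> by simp
    also have "h \<otimes>\<^bsub>G\<^esub> inv\<^bsub>G\<^esub> g \<otimes>\<^bsub>G\<^esub> g = h" using g h by (simp add: m_assoc)
    finally have "z = \<phi> (h \<otimes>\<^bsub>G\<^esub> inv\<^bsub>G\<^esub> g) y" using h by simp
    then show "z \<in> orbit G \<phi> y" unfolding orbit_def using g h by blast
  qed
qed

section \<open>Lattices over O in the plane\<close>

context number_field_type
begin

text \<open>An extension of J by its inverse; z = 0 gives the sum of submodules of the two
  coordinate axes, which are the eigenlines of the representation, and z measures the deviation from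
  this splitting.\<close>

definition Lam :: "'k set \<Rightarrow> 'k \<Rightarrow> ('k \<times> 'k) set" where
  "Lam J z = {(x, y). x \<in> J \<and> y - z * x \<in> o_inv J}"

lemma one_in_o_inv: "o_ideal J \<Longrightarrow> 1 \<in> o_inv J"
  by (auto simp: o_ideal_def o_inv_def)

lemma Lam_cong:
  assumes "z - z' \<in> o_inv2 J"
  shows "Lam J z = Lam J z'"
proof -
  have sub: "Lam J z \<subseteq> Lam J z'" if d: "z - z' \<in> o_inv2 J" for z z'
  proof
    fix p assume "p \<in> Lam J z"
    then obtain x y where p: "p = (x, y)" "x \<in> J" "y - z * x \<in> o_inv J" by (auto simp: Lam_def)
    have "(y - z * x) + (z - z') * x \<in> o_inv J"
      using p d by (intro o_module_add[OF o_module_o_inv]) (auto simp: o_inv2_def)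
    then show "p \<in> Lam J z'" using p by (simp add: Lam_def algebra_simps)
  qed
  have "z' - z \<in> o_inv2 J" using o_module_minus[OF o_module_o_inv2 assms] by simp
  then show ?thesis using sub assms by blast
qed

text \<open>Freeness of \<open>Lam J z\<close>: the matrix with columns \<open>(x, y)\<close> and \<open>(- w, s)\<close> has determinant 1
  and its columns generate \<open>J \<oplus> J\<^sup>-\<^sup>1\<close>.\<close>

lemma Lam_free:
  assumes J: "o_ideal J" "J \<noteq> {0}"
  shows "\<exists>A. invertible A \<and> app A ` Lam J z = O2"
proof -
  have inv: "o_invertible J" using J by (rule o_ideal_invertible)
  have JM: "o_module J" using J by (simp add: o_ideal_def)
  obtain x where x: "x \<in> J" "x \<noteq> 0" using J(2) o_module_0[OF JM] by blast
  have x_int: "algebraic_int x" using x J by (simp add: o_ideal_def)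
  \<comment> \<open>Modulo x, the inverse of J is generated by a single y; the certificate for this
    is the relation of determinant 1.\<close>
  obtain y w s where ys: "y \<in> o_inv J" "w \<in> o_inv (o_inv J)" "algebraic_int s" "y * w + x * s = 1"
    using generator_modulo[OF o_invertible_o_inv[OF inv] x_int x(2)] by metis
  have w: "w \<in> J" using ys(2) by (simp add: o_inv_o_inv[OF inv])
  \<comment> \<open>J consists of integers, so its inverse contains 1 and with it s.\<close>
  have s: "s \<in> o_inv J" using o_module_mult[OF o_module_o_inv ys(3) one_in_o_inv[OF J(1)]] by simp
  have int: "algebraic_int (q * p)" if "p \<in> J" "q \<in> o_inv J" for p q using that by (auto simp: o_inv_def)
  \<comment> \<open>\<open>B\<close> is the matrix of determinant 1 sheared by z, and
    \<open>A\<close> is its adjugate.\<close>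
  define A where "A = mat2 (s - w * z) w (- y - x * z) x"
  define B where "B = mat2 x (- w) (y + z * x) (s - z * w)"
  have "(s - w * z) * x + w * (y + z * x) = 1" "x * (s - w * z) - w * (- y - x * z) = 1"
    "(- y - x * z) * - w + x * (s - z * w) = 1" "(y + z * x) * w + (s - z * w) * x = 1"
    using ys(4) by (simp_all add: algebra_simps)
  then have AB: "A ** B = mat 1" "B ** A = mat 1"
    by (simp_all add: mat2_eq_iff mat2_mult_nth A_def B_def algebra_simps)
  have A: "app A (p, q) = (s * p + w * (q - z * p), - y * p + x * (q - z * p))" for p q
    by (simp add: app_def A_def algebra_simps)
  have B: "app B (m, n) = (x * m - w * n, z * (x * m - w * n) + (y * m + s * n))" for m n
    by (simp add: app_def B_def algebra_simps)
  have "app A ` Lam J z \<subseteq> O2"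
  proof
    fix r assume "r \<in> app A ` Lam J z"
    then obtain p q where pq: "p \<in> J" "q - z * p \<in> o_inv J" "r = app A (p, q)" by (auto simp: Lam_def)
    have "algebraic_int p" using pq J by (simp add: o_ideal_def)
    have "algebraic_int (s * p + w * (q - z * p))"
      using int[OF w pq(2)] ys(3) \<open>algebraic_int p\<close>
      by (intro algebraic_int_add algebraic_int_mult[of s]) (auto simp: mult.commute)
    moreover have "algebraic_int (- y * p + x * (q - z * p))"
      using int[OF x(1) pq(2)] int[OF pq(1) ys(1)]
      by (intro algebraic_int_add) (auto simp: mult.commute)
    ultimately show "r \<in> O2" by (simp add: pq A O2_def)
  qed
  moreover have "O2 \<subseteq> app A ` Lam J z"
  proof
    fix r :: "'k \<times> 'k" assume "r \<in> O2"
    then obtain m n where mn: "r = (m, n)" "algebraic_int m" "algebraic_int n" by (auto simp: O2_def)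
    have "x * m - w * n \<in> J" using x w mn by (intro o_module_diff[OF JM] o_module_mult'[OF JM])
    moreover have "y * m + s * n \<in> o_inv J"
      using ys s mn by (intro o_module_add[OF o_module_o_inv] o_module_mult'[OF o_module_o_inv])
    ultimately have "app B r \<in> Lam J z" by (simp add: Lam_def mn B)
    moreover have "app A (app B r) = r" using AB by (simp flip: app_mult)
    ultimately show "r \<in> app A ` Lam J z" by (metis image_eqI)
  qed
  ultimately show ?thesis using matrix_inv_eqI(1)[OF AB] by blast
qed

text \<open>Unimodular lattices are of the form \<open>Lam J z\<close>: the projection to \<open>J\<close> splits since \<open>J\<close> is
  invertible, and the determinant identifies the kernel with the inverse of \<open>J\<close>.\<close>

lemma unimodular_lattice_Lam:
  fixes b11 b12 b21 b22 :: 'k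
  assumes det: "b11 * b22 - b12 * b21 = 1"
    and J: "J = {b11 * m + b12 * n | m n. algebraic_int m \<and> algebraic_int n}" and inv: "o_invertible J"
  shows "\<exists>z. app (mat2 b11 b12 b21 b22) ` O2 = Lam J z"
proof -
  let ?B = "mat2 b11 b12 b21 b22"
  have JM: "o_module J" using inv by (simp add: o_invertible_def)
  have L_iff: "(x, y) \<in> app ?B ` O2 \<longleftrightarrow> (\<exists>m n. algebraic_int m \<and> algebraic_int n \<and> x = b11 * m + b12 * n \<and> y = b21 * m + b22 * n)" for x y
    by (auto simp: app_def O2_def image_iff)
  have L_add: "(x + x', y + y') \<in> app ?B ` O2" if h: "(x, y) \<in> app ?B ` O2" "(x', y') \<in> app ?B ` O2" for x y x' y'
  proof -
    obtain m n where "algebraic_int m" "algebraic_int n" "x = b11 * m + b12 * n" "y = b21 * m + b22 * n"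
      using h(1) unfolding L_iff by (elim exE conjE)
    moreover obtain m' n' where "algebraic_int m'" "algebraic_int n'" "x' = b11 * m' + b12 * n'" "y' = b21 * m' + b22 * n'"
      using h(2) unfolding L_iff by (elim exE conjE)
    ultimately show ?thesis unfolding L_iff
      by (intro exI[of _ "m + m'"] exI[of _ "n + n'"]) (simp add: algebra_simps algebraic_int_add)
  qed
  have L_mult: "(c * x, c * y) \<in> app ?B ` O2" if h: "(x, y) \<in> app ?B ` O2" "algebraic_int c" for x y c
  proof -
    obtain m n where "algebraic_int m" "algebraic_int n" "x = b11 * m + b12 * n" "y = b21 * m + b22 * n"
      using h(1) unfolding L_iff by (elim exE conjE)
    then show ?thesis unfolding L_iff using h(2)
      by (intro exI[of _ "c * m"] exI[of _ "c * n"]) (simp add: algebra_simps algebraic_int_mult)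
  qed
  have kernel: "(0, q) \<in> app ?B ` O2 \<longleftrightarrow> q \<in> o_inv J" for q
  proof
    assume "(0, q) \<in> app ?B ` O2"
    then obtain m n where mn: "algebraic_int m" "algebraic_int n" "0 = b11 * m + b12 * n" "q = b21 * m + b22 * n"
      unfolding L_iff by (elim exE conjE)
    show "q \<in> o_inv J"
      unfolding o_inv_def J
    proof safe
      fix m' n' :: 'k assume mn': "algebraic_int m'" "algebraic_int n'"
      \<comment> \<open>The subtracted term is a multiple of 0 = b11 m + b12 n; it turns the
        expression into the determinant times an integer.\<close>
      have "q * (b11 * m' + b12 * n') = q * (b11 * m' + b12 * n') - (b11 * m + b12 * n) * (b21 * m' + b22 * n')"
        using mn(3) by simp
      also have "\<dots> = (b11 * b22 - b12 * b21) * (m' * n - n' * m)" unfolding mn(4) by (simp add: algebra_simps)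
      finally show "algebraic_int (q * (b11 * m' + b12 * n'))"
        unfolding det using mn mn' by (simp add: algebraic_int_diff algebraic_int_mult)
    qed
  next
    assume q: "q \<in> o_inv J"
    have "b11 \<in> J" unfolding J by (intro CollectI exI[of _ 1] exI[of _ 0]) simp
    moreover have "b12 \<in> J" unfolding J by (intro CollectI exI[of _ 0] exI[of _ 1]) simp
    ultimately have "algebraic_int (- b12 * q)" "algebraic_int (b11 * q)" using q by (auto simp: o_inv_def mult.commute)
    moreover have "0 = b11 * (- b12 * q) + b12 * (b11 * q)" by (simp add: algebra_simps)
    moreover have "q = (b11 * b22 - b12 * b21) * q" by (simp add: det)
    then have "q = b21 * (- b12 * q) + b22 * (b11 * q)" by (simp add: algebra_simps)
    ultimately show "(0, q) \<in> app ?B ` O2" unfolding L_iff by blast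
  qed
  obtain N :: nat and u w where uw: "\<And>i. i < N \<Longrightarrow> u i \<in> o_inv J" "\<And>i. i < N \<Longrightarrow> w i \<in> J"
    "(\<Sum>i<N. u i * w i) = 1" using inv by (rule o_invertibleE) blast
  have "\<exists>t. (w i, t) \<in> app ?B ` O2" if "i < N" for i
    using uw(2)[OF that] unfolding L_iff J by blast
  then obtain t where t: "\<And>i. i < N \<Longrightarrow> (w i, t i) \<in> app ?B ` O2" by metis
  \<comment> \<open>The dual basis of J combines the lifts t_i of the w_i into a linear section x
    \<mapsto> (x, z x).\<close>
  define z where "z = (\<Sum>i<N. u i * t i)"
  have split: "(x, z * x) \<in> app ?B ` O2" if x: "x \<in> J" for x
  proof -
    have "(\<Sum>i<n. x * u i * w i, \<Sum>i<n. x * u i * t i) \<in> app ?B ` O2" if "n \<le> N" for n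
      using that
    proof (induction n)
      case 0
      show ?case using kernel[of 0] o_module_0[OF o_module_o_inv] by simp
    next
      case (Suc n)
      have "algebraic_int (x * u n)" using uw(1)[of n] x Suc.prems by (auto simp: o_inv_def mult.commute)
      from L_add[OF Suc.IH L_mult[OF t[of n] this]] Suc.prems show ?case by (simp add: mult.assoc)
    qed
    from this[of N] have "(x * (\<Sum>i<N. u i * w i), x * z) \<in> app ?B ` O2"
      by (simp add: sum_distrib_left mult.assoc z_def)
    then show ?thesis using uw(3) by (simp add: mult.commute)
  qed
  have "(x, y) \<in> app ?B ` O2 \<longleftrightarrow> (x, y) \<in> Lam J z" for x y
  proof
    assume xy: "(x, y) \<in> app ?B ` O2"
    then have x: "x \<in> J" unfolding L_iff J by blast
    have "(x + (- 1) * x, y + (- 1) * (z * x)) \<in> app ?B ` O2"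
      by (intro L_add xy L_mult split x) simp
    then show "(x, y) \<in> Lam J z" using x kernel by (simp add: Lam_def)
  next
    assume "(x, y) \<in> Lam J z"
    then have "(x + 0, z * x + (y - z * x)) \<in> app ?B ` O2"
      by (intro L_add split) (auto simp: kernel Lam_def)
    then show "(x, y) \<in> app ?B ` O2" by simp
  qed
  then have "app ?B ` O2 = Lam J z" by auto
  then show ?thesis by blast
qed

lemma o_module_scale:
  fixes J :: "'k set"
  assumes "o_module J"
  shows "o_module ((*) s ` J)"
  unfolding o_module_def
proof (intro conjI ballI allI impI)
  show "0 \<in> (*) s ` J" using o_module_0[OF assms] by (intro image_eqI[of _ _ 0]) auto
  fix x assume "x \<in> (*) s ` J"
  then obtain x' where x': "x = s * x'" "x' \<in> J" by auto
  show "x + y \<in> (*) s ` J" if y: "y \<in> (*) s ` J" for y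
  proof -
    obtain y' where "y = s * y'" "y' \<in> J" using y by auto
    then show ?thesis using x' o_module_add[OF assms] by (intro image_eqI[of _ _ "x' + y'"]) (auto simp: algebra_simps)
  qed
next
  fix c x :: 'k assume "algebraic_int c" "x \<in> (*) s ` J"
  then show "c * x \<in> (*) s ` J" using o_module_mult[OF assms] by force
qed

lemma o_inv_scale:
  assumes "s \<noteq> 0"
  shows "q \<in> o_inv ((*) s ` J) \<longleftrightarrow> s * q \<in> o_inv J"
  by (auto simp: o_inv_def mult_ac)

text \<open>With a dual basis of J, s is the sum of the u_i (s w_i), and every summand is
  integral.\<close>

lemma stabilizer_integral:
  assumes J: "o_invertible J" and "\<And>x. x \<in> J \<Longrightarrow> s * x \<in> J"
  shows "algebraic_int s"
proof -
  obtain N :: nat and u w where uw: "\<And>i. i < N \<Longrightarrow> u i \<in> o_inv J" "\<And>i. i < N \<Longrightarrow> w i \<in> J"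
    "(\<Sum>i<N. u i * w i) = 1" using J by (rule o_invertibleE) blast
  have "s = (\<Sum>i<N. u i * (s * w i))"
  proof -
    have "s = s * (\<Sum>i<N. u i * w i)" by (simp add: uw(3))
    also have "\<dots> = (\<Sum>i<N. u i * (s * w i))" unfolding sum_distrib_left by (simp add: mult_ac)
    finally show ?thesis .
  qed
  moreover have "algebraic_int (\<Sum>i<N. u i * (s * w i))"
    using uw(1,2) assms(2) by (intro algebraic_int_sum) (auto simp: o_inv_def)
  ultimately show ?thesis by simp
qed

lemma stabilizer_unit:
  assumes J: "o_invertible J" and "s \<noteq> 0" "(*) s ` J = J"
  shows "s \<in> Units \<O>"
proof -
  have "algebraic_int s" using assms(3) by (intro stabilizer_integral[OF J]) auto
  moreover have "inverse s * x \<in> J" if "x \<in> J" for x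
  proof -
    from that obtain y where "y \<in> J" "x = s * y" using assms(3) by blast
    then show ?thesis using assms(2) by (simp flip: mult.assoc)
  qed
  then have "algebraic_int (inverse s)" by (rule stabilizer_integral[OF J])
  ultimately show ?thesis using assms(2) by (simp add: Units_int_ring)
qed

lemma app_diag2: "app (diag2 s t) (x, y) = (s * x, t * y)"
  by (simp add: app_def)

lemma diag2_inverse:
  assumes "s \<noteq> 0" "t \<noteq> 0"
  shows "invertible (diag2 s t)" "matrix_inv (diag2 s t) = diag2 (inverse s) (inverse t)"
  using matrix_inv_eqI[of "diag2 s t" "diag2 (inverse s) (inverse t)"] assms
  by (simp_all add: mat2_eq_iff mat2_mult_nth)

text \<open>Necessity: projecting gives J' = s J; comparing the vectors (0, q) gives t J^-1 = J'^-1
  = s^-1 J^-1, so s t preserves J^-1 and is a unit; the images of (x, z x) then compare z' with t z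
  / s.\<close>

lemma Lam_diag_image:
  assumes s: "s \<noteq> 0" "t \<noteq> 0" and J: "o_invertible J" "o_invertible J'"
  shows "app (diag2 s t) ` Lam J z = Lam J' z' \<longleftrightarrow>
    J' = (*) s ` J \<and> s * t \<in> Units \<O> \<and> z' - t * z / s \<in> o_inv2 J'"
proof
  have JM: "o_module J" "o_module J'" using J by (simp_all add: o_invertible_def)
  have img: "(x, y) \<in> app (diag2 s t) ` Lam J z \<longleftrightarrow> (x / s, y / t) \<in> Lam J z" for x y
  proof
    assume "(x / s, y / t) \<in> Lam J z"
    then show "(x, y) \<in> app (diag2 s t) ` Lam J z"
      using s by (intro image_eqI[of _ _ "(x / s, y / t)"]) (auto simp: app_diag2)
  qed (use s in \<open>auto simp: app_diag2\<close>)
  have mem: "x \<in> (*) s ` J \<longleftrightarrow> x / s \<in> J" for x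
    using s by (auto intro!: image_eqI[of _ _ "x / s"])
  {
    assume eq: "app (diag2 s t) ` Lam J z = Lam J' z'"
    have sub: "(s * x, t * (z * x)) \<in> Lam J' z'" if "x \<in> J" for x
      unfolding eq[symmetric] using that o_module_0[OF o_module_o_inv]
      by (intro image_eqI[of _ _ "(x, z * x)"]) (auto simp: app_diag2 Lam_def)
    have J': "J' = (*) s ` J"
    proof (intro equalityI subsetI)
      fix x assume "x \<in> J'"
      then have "(x, z' * x) \<in> app (diag2 s t) ` Lam J z"
        unfolding eq using o_module_0[OF o_module_o_inv] by (simp add: Lam_def)
      then show "x \<in> (*) s ` J" unfolding img mem by (simp add: Lam_def)
    next
      fix x assume "x \<in> (*) s ` J"
      then show "x \<in> J'" using sub by (auto simp: Lam_def)
    qed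
    have ker: "q / t \<in> o_inv J \<longleftrightarrow> q \<in> o_inv J'" for q
    proof -
      have "(0, q) \<in> app (diag2 s t) ` Lam J z \<longleftrightarrow> (0, q) \<in> Lam J' z'" by (simp add: eq)
      then show ?thesis unfolding img using o_module_0[OF JM(1)] o_module_0[OF JM(2)] by (simp add: Lam_def)
    qed
    have "(*) (s * t) ` o_inv J = o_inv J"
    proof (intro equalityI subsetI)
      fix x assume "x \<in> (*) (s * t) ` o_inv J"
      then obtain q where "q \<in> o_inv J" "x = s * (t * q)" by (auto simp: mult.assoc)
      then show "x \<in> o_inv J" using ker[of "t * q"] s by (simp add: J' o_inv_scale)
    next
      fix x assume x: "x \<in> o_inv J"
      then have "x / s \<in> o_inv J'" using s by (simp add: J' o_inv_scale)
      then have "x / s / t \<in> o_inv J" by (simp only: ker)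
      then show "x \<in> (*) (s * t) ` o_inv J" using s by (intro image_eqI[of _ _ "x / s / t"]) auto
    qed
    then have "s * t \<in> Units \<O>" using s by (intro stabilizer_unit[OF o_invertible_o_inv[OF J(1)]]) auto
    moreover have "z' - t * z / s \<in> o_inv2 J'"
      unfolding o_inv2_def J'
    proof safe
      fix x assume "x \<in> J"
      then have "t * (z * x) - z' * (s * x) \<in> o_inv J'" using sub by (simp add: Lam_def)
      from o_module_minus[OF o_module_o_inv this]
      show "(z' - t * z / s) * (s * x) \<in> o_inv ((*) s ` J)" using s by (simp add: J' algebra_simps)
    qed
    ultimately show "J' = (*) s ` J \<and> s * t \<in> Units \<O> \<and> z' - t * z / s \<in> o_inv2 J'" using J' by blast
  }
  assume h: "J' = (*) s ` J \<and> s * t \<in> Units \<O> \<and> z' - t * z / s \<in> o_inv2 J'"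
  then have u: "algebraic_int (s * t)" "algebraic_int (inverse (s * t))" by (auto simp: Units_int_ring)
  have "(x, y) \<in> app (diag2 s t) ` Lam J z \<longleftrightarrow> (x, y) \<in> Lam J' (t * z / s)" for x y
  proof -
    have q: "q / t \<in> o_inv J \<longleftrightarrow> q \<in> o_inv J'" for q
    proof -
      have "s * q = (s * t) * (q / t)" "q / t = inverse (s * t) * (s * q)" using s by (auto simp: field_simps)
      then have "q / t \<in> o_inv J \<longleftrightarrow> s * q \<in> o_inv J"
        using u o_module_mult[OF o_module_o_inv] by metis
      then show ?thesis using h s by (simp add: o_inv_scale)
    qed
    have "y / t - z * (x / s) = (y - t * z / s * x) / t" using s by (simp add: field_simps)
    then show ?thesis unfolding img using q h mem by (simp add: Lam_def)
  qed
  then have "app (diag2 s t) ` Lam J z = Lam J' (t * z / s)" by auto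
  also have "\<dots> = Lam J' z'"
  proof (rule Lam_cong)
    have "z' - t * z / s \<in> o_inv2 J'" using h by blast
    from o_module_minus[OF o_module_o_inv2 this] show "t * z / s - z' \<in> o_inv2 J'" by simp
  qed
  finally show "app (diag2 s t) ` Lam J z = Lam J' z'" .
qed

end

section \<open>Side branches as residue rings\<close>

context prime_place
begin

text \<open>The vertex \<open>V k z\<close> with \<open>z\<close> a unit modulo \<open>P\<^sup>k\<close> corresponds to the residue class of
  \<open>unif\<^bsup>e - k\<^esup> z\<close> modulo \<open>P\<^sup>e\<close>.\<close>

definition vertex_residue :: "nat \<Rightarrow> 'k bt_vertex \<Rightarrow> 'k \<Rightarrow> bool" where
  "vertex_residue e v c \<longleftrightarrow> (\<exists>k z. v = V k z \<and> 0 \<le> k \<and> k \<le> int e \<and> padic_abs P z = 1 \<and>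
     padic_abs P (c - unif powi (int e - k) * z) \<le> 2 powi (- int e))"

lemma padic_abs_unif_powi: "padic_abs P (unif powi n) = 2 powi (- n)"
proof -
  have "has_ord n (unif powi n)" unfolding has_ord_def using one_notin_P by (intro exI[of _ 1]) auto
  then show ?thesis by (rule padic_abs_has_ord)
qed

lemma vertex_residue_side_branch: "vertex_residue e v c \<Longrightarrow> v \<in> side_branch P e"
  unfolding vertex_residue_def side_branch_eq by blast

text \<open>The level k is e minus the valuation of c, cut off at 0: a residue divisible by P^e
  belongs to the standard vertex.\<close>

lemma ex_vertex_residue:
  assumes "algebraic_int c"
  shows "\<exists>v. vertex_residue e v c"
proof (cases "padic_abs P c \<le> 2 powi (- int e)")
  case True
  then have "padic_abs P (c - unif powi (int e - 0) * 1) \<le> 2 powi (- int e)"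
    using padic_abs_diff[of c "unif powi (int e)"] padic_abs_unif_powi[of "int e"] by simp
  then show ?thesis unfolding vertex_residue_def
    by (intro exI[of _ "V 0 1"] exI[of _ 0] exI[of _ 1]) simp
next
  case False
  then have "c \<noteq> 0" by auto
  then obtain n where n: "has_ord n c" using ex_has_ord by blast
  have c: "padic_abs P c = 2 powi (- n)" using n by (rule padic_abs_has_ord)
  have "(2::real) powi (- n) \<le> 2 powi 0" using padic_abs_int[OF assms] c by simp
  then have "0 \<le> n" by (simp only: two_powi_le_iff)
  have "n < int e" using False c by simp
  define z where "z = c / unif powi n"
  have z: "unif powi n * z = c" using unif by (simp add: z_def)
  have "padic_abs P (unif powi n) * padic_abs P z = padic_abs P c" unfolding z[symmetric] padic_abs_mult ..
  then have "padic_abs P z = 1" by (simp add: c padic_abs_unif_powi)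
  then show ?thesis unfolding vertex_residue_def using z \<open>0 \<le> n\<close> \<open>n < int e\<close>
    by (intro exI[of _ "V (int e - n) z"] exI[of _ "int e - n"] exI[of _ z]) simp
qed

lemma ex_residue_vertex:
  assumes "v \<in> side_branch P e"
  shows "\<exists>c. algebraic_int c \<and> vertex_residue e v c"
proof -
  obtain k z where kz: "v = V k z" "0 \<le> k" "k \<le> int e" "padic_abs P z = 1"
    using assms unfolding side_branch_eq by (elim CollectE exE conjE)
  let ?x = "unif powi (int e - k) * z"
  have "padic_abs P ?x = 2 powi (k - int e)" by (simp add: padic_abs_mult padic_abs_unif_powi kz)
  also have "\<dots> \<le> 2 powi 0" using kz by (simp only: two_powi_le_iff)
  finally obtain c where c: "algebraic_int c" "padic_abs P (?x - c) \<le> 2 powi (- int e)"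
    using padic_abs_approx[of ?x e] by auto
  have "padic_abs P (c - ?x) \<le> 2 powi (- int e)" using c(2) by (metis minus_diff_eq padic_abs_minus)
  then show ?thesis using c(1) kz unfolding vertex_residue_def by blast
qed

lemma vertex_residue_cong:
  assumes "vertex_residue e v c" "padic_abs P (c' - c) \<le> 2 powi (- int e)"
  shows "vertex_residue e v c'"
proof -
  obtain k z where kz: "v = V k z" "0 \<le> k" "k \<le> int e" "padic_abs P z = 1"
     "padic_abs P (c - unif powi (int e - k) * z) \<le> 2 powi (- int e)"
    using assms(1) unfolding vertex_residue_def by (elim exE conjE)
  have "padic_abs P ((c' - c) + (c - unif powi (int e - k) * z)) \<le> 2 powi (- int e)"
    using padic_abs_add[of "c' - c" "c - unif powi (int e - k) * z"] assms(2) kz(5) by linarith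
  then have "padic_abs P (c' - unif powi (int e - k) * z) \<le> 2 powi (- int e)" by simp
  then show ?thesis using kz unfolding vertex_residue_def by blast
qed

text \<open>This makes the correspondence well defined, injective and equivariant at once. Residues
  pi^(e-k) z with different k have different absolute values, at least one of them above 2^-e, so
  they cannot be congruent. For equal k the congruence modulo P^e divides down to one between z' and
  u z modulo P^k, which is equality of balls.\<close>

lemma vertex_act_eq_iff_residue:
  assumes "vertex_residue e v c" "vertex_residue e v' c'" and u: "padic_abs P u = 1"
  shows "v' = vertex_act P (diag2 1 u) v \<longleftrightarrow> padic_abs P (c' - u * c) \<le> 2 powi (- int e)"
proof -
  obtain k z where kz: "v = V k z" "0 \<le> k" "k \<le> int e" "padic_abs P z = 1"
     "padic_abs P (c - unif powi (int e - k) * z) \<le> 2 powi (- int e)"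
    using assms(1) unfolding vertex_residue_def by (elim exE conjE)
  obtain k' z' where kz': "v' = V k' z'" "0 \<le> k'" "k' \<le> int e" "padic_abs P z' = 1"
     "padic_abs P (c' - unif powi (int e - k') * z') \<le> 2 powi (- int e)"
    using assms(2) unfolding vertex_residue_def by (elim exE conjE)
  let ?x = "unif powi (int e - k) * z" and ?x' = "unif powi (int e - k') * z'"
  have x: "padic_abs P (u * ?x) = 2 powi (k - int e)" "padic_abs P ?x' = 2 powi (k' - int e)"
    by (simp_all add: padic_abs_mult padic_abs_unif_powi kz kz' u)
  have d: "padic_abs P (u * c - u * ?x) \<le> 2 powi (- int e)"
    using kz(5) u by (simp add: padic_abs_mult flip: right_diff_distrib)
  have "padic_abs P (c' - u * c) \<le> 2 powi (- int e) \<longleftrightarrow> padic_abs P (?x' - u * ?x) \<le> 2 powi (- int e)"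
  proof -
    \<comment> \<open>The error made by replacing both residues by the exact values pi^(e-k) z; it
      is at most 2^-e.\<close>
    define d where "d = (u * c - u * ?x) - (c' - ?x')"
    have eq: "?x' - u * ?x = (c' - u * c) + d" "c' - u * c = (?x' - u * ?x) - d" by (simp_all add: d_def)
    have le: "padic_abs P d \<le> 2 powi (- int e)"
      unfolding d_def using padic_abs_diff[of "u * c - u * ?x" "c' - ?x'"] d kz'(5) by linarith
    show ?thesis
    proof
      assume "padic_abs P (c' - u * c) \<le> 2 powi (- int e)"
      then have "padic_abs P ((c' - u * c) + d) \<le> 2 powi (- int e)"
        using padic_abs_add[of "c' - u * c" d] le by linarith
      then show "padic_abs P (?x' - u * ?x) \<le> 2 powi (- int e)" by (simp only: eq(1))
    next
      assume "padic_abs P (?x' - u * ?x) \<le> 2 powi (- int e)"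
      then have "padic_abs P ((?x' - u * ?x) - d) \<le> 2 powi (- int e)"
        using padic_abs_diff[of "?x' - u * ?x" d] le by linarith
      then show "padic_abs P (c' - u * c) \<le> 2 powi (- int e)" by (simp only: eq(2))
    qed
  qed
  also have "\<dots> \<longleftrightarrow> k' = k \<and> padic_abs P (z' - u * z) \<le> 2 powi (- k)"
  proof (cases "k = k'")
    case True
    have "?x' - u * ?x = unif powi (int e - k) * (z' - u * z)" by (simp add: True algebra_simps)
    then have eq: "padic_abs P (?x' - u * ?x) = 2 powi (k - int e) * padic_abs P (z' - u * z)"
      by (simp only: padic_abs_mult padic_abs_unif_powi minus_diff_eq)
    have "(2::real) powi (- int e) = 2 powi (k - int e) * 2 powi (- k)" by (simp flip: power_int_add)
    then show ?thesis unfolding eq using True by simp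
  next
    case False
    have "\<not> padic_abs P (?x' - u * ?x) \<le> 2 powi (- int e)"
    proof
      assume le: "padic_abs P (?x' - u * ?x) \<le> 2 powi (- int e)"
      have "padic_abs P ?x' \<le> max (padic_abs P (?x' - u * ?x)) (padic_abs P (u * ?x))"
        using padic_abs_add[of "?x' - u * ?x" "u * ?x"] by simp
      also have "\<dots> \<le> max (2 powi (- int e)) (2 powi (k - int e))"
        unfolding x using le by (intro max.mono) simp_all
      finally have "2 powi (k' - int e) \<le> max ((2::real) powi (- int e)) (2 powi (k - int e))"
        unfolding x .
      moreover have "padic_abs P (u * ?x) \<le> max (padic_abs P ?x') (padic_abs P (?x' - u * ?x))"
        using padic_abs_diff[of ?x' "?x' - u * ?x"] by simp
      then have "padic_abs P (u * ?x) \<le> max (2 powi (k' - int e)) (2 powi (- int e))"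
        unfolding x using le by linarith
      then have "2 powi (k - int e) \<le> max ((2::real) powi (k' - int e)) (2 powi (- int e))"
        unfolding x .
      ultimately show False using False kz(2) kz'(2) by (auto simp: le_max_iff_disj)
    qed
    then show ?thesis using False by simp
  qed
  also have "\<dots> \<longleftrightarrow> v' = vertex_act P (diag2 1 u) v"
    unfolding kz(1) kz'(1) vertex_act_V[OF u] V_eq_iff by auto
  finally show ?thesis by blast
qed

lemma side_branch_act:
  assumes "v \<in> side_branch P e" "u \<in> Units \<O>" "w \<in> Units \<O>"
  shows "vertex_act P (diag2 1 u) v \<in> side_branch P e"
    "vertex_act P (diag2 1 (u * w)) v = vertex_act P (diag2 1 u) (vertex_act P (diag2 1 w) v)"
    "vertex_act P (diag2 1 1) v = v"
proof -
  obtain k z where kz: "v = V k z" "0 \<le> k" "k \<le> int e" "padic_abs P z = 1"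
    using assms unfolding side_branch_eq by (elim CollectE exE conjE)
  have uw: "padic_abs P u = 1" "padic_abs P w = 1" using assms padic_abs_unit by auto
  have "padic_abs P (u * z) = 1" "padic_abs P (u * w) = 1" by (simp_all add: padic_abs_mult uw kz)
  then show "vertex_act P (diag2 1 u) v \<in> side_branch P e"
    "vertex_act P (diag2 1 (u * w)) v = vertex_act P (diag2 1 u) (vertex_act P (diag2 1 w) v)"
    "vertex_act P (diag2 1 1) v = v"
    unfolding side_branch_eq kz(1) using kz(2,3) uw by (auto simp: vertex_act_V mult.assoc)
qed

end

lemma equiv_ideal_class_rel: "equiv (nonzero_ideals :: 'k::field_char_0 set set) ideal_class_rel"
proof (rule equivI)
  show "ideal_class_rel \<subseteq> (nonzero_ideals :: 'k set set) \<times> nonzero_ideals"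
    by (auto simp: ideal_class_rel_def)
  show "refl_on (nonzero_ideals :: 'k set set) ideal_class_rel"
    by (rule refl_onI) (auto simp: ideal_class_rel_def intro!: bexI[of _ 1])
  show "sym (ideal_class_rel :: ('k set \<times> 'k set) set)"
  proof (rule symI)
    fix I J :: "'k set" assume "(I, J) \<in> ideal_class_rel"
    then obtain c d where "I \<in> nonzero_ideals" "J \<in> nonzero_ideals" "c \<in> carrier \<O> - {0}" "d \<in> carrier \<O> - {0}"
      "(*) c ` I = (*) d ` J"
      unfolding ideal_class_rel_def by blast
    then show "(J, I) \<in> ideal_class_rel"
      unfolding ideal_class_rel_def mem_Collect_eq case_prod_conv
      by (intro conjI bexI[of _ d] bexI[of _ c]) (auto simp del: int_ring_simps)
  qed
  show "trans (ideal_class_rel :: ('k set \<times> 'k set) set)"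
  proof (rule transI)
    fix I J L :: "'k set" assume "(I, J) \<in> ideal_class_rel" "(J, L) \<in> ideal_class_rel"
    note rel = this
    obtain a b where ab: "I \<in> nonzero_ideals" "a \<in> carrier \<O> - {0}" "b \<in> carrier \<O> - {0}" "(*) a ` I = (*) b ` J"
      using rel(1) unfolding ideal_class_rel_def by blast
    obtain c d where cd: "L \<in> nonzero_ideals" "c \<in> carrier \<O> - {0}" "d \<in> carrier \<O> - {0}" "(*) c ` J = (*) d ` L"
      using rel(2) unfolding ideal_class_rel_def by blast
    note h = ab(1) cd(1) ab(2,3) cd(2,3) ab(4) cd(4)
    have scale: "(*) (x * y) ` M = (*) x ` (*) y ` M" for x y :: 'k and M by (simp add: image_image mult.assoc)
    have "(*) (c * a) ` I = (*) (c * b) ` J" by (simp only: scale h(7))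
    also have "\<dots> = (*) (b * d) ` L" by (simp only: mult.commute[of c b] scale h(8))
    finally have "(*) (c * a) ` I = (*) (b * d) ` L" .
    then show "(I, L) \<in> ideal_class_rel"
      unfolding ideal_class_rel_def mem_Collect_eq case_prod_conv using h(1-6)
      by (intro conjI bexI[of _ "c * a"] bexI[of _ "b * d"]) (auto intro: algebraic_int_mult)
  qed
qed

text \<open>The residue shared by a form and a branch point is not unique, so S and T are linked by
  a correspondence R and not by a map; compatible with both partitions, it induces a bijection
  between the sets of classes.\<close>

lemma card_image_eq_of_correspondence:
  assumes "\<And>x. x \<in> S \<Longrightarrow> \<exists>y\<in>T. R x y" "\<And>y. y \<in> T \<Longrightarrow> \<exists>x\<in>S. R x y"
    and "\<And>x y x' y'. x \<in> S \<Longrightarrow> y \<in> T \<Longrightarrow> x' \<in> S \<Longrightarrow> y' \<in> T \<Longrightarrow> R x y \<Longrightarrow> R x' y' \<Longrightarrow> f x = f x' \<longleftrightarrow> g y = g y'"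
  shows "card (f ` S) = card (g ` T)"
proof -
  define F where "F = (\<lambda>w. SOME v. \<exists>x\<in>S. \<exists>y\<in>T. R x y \<and> f x = w \<and> g y = v)"
  have F: "F (f x) = g y" if "x \<in> S" "y \<in> T" "R x y" for x y
  proof -
    have "\<exists>v. \<exists>x'\<in>S. \<exists>y\<in>T. R x' y \<and> f x' = f x \<and> g y = v" using that by blast
    from someI_ex[OF this] obtain x' y' where "x' \<in> S" "y' \<in> T" "R x' y'" "f x' = f x" "g y' = F (f x)"
      unfolding F_def by blast
    then show ?thesis using assms(3)[of x' y' x y] that by simp
  qed
  have "bij_betw F (f ` S) (g ` T)"
    unfolding bij_betw_def
  proof
    show "inj_on F (f ` S)"
    proof (rule inj_onI, elim imageE)
      fix w w' x x' assume h: "F w = F w'" "w = f x" "x \<in> S" "w' = f x'" "x' \<in> S"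
      obtain y where y: "y \<in> T" "R x y" using assms(1)[OF h(3)] by blast
      obtain y' where y': "y' \<in> T" "R x' y'" using assms(1)[OF h(5)] by blast
      show "w = w'" using F[OF h(3) y] F[OF h(5) y'] assms(3)[OF h(3) y(1) h(5) y'(1) y(2) y'(2)] h by simp
    qed
    show "F ` f ` S = g ` T"
    proof (intro equalityI subsetI)
      fix v assume "v \<in> F ` f ` S"
      then obtain x where "x \<in> S" "v = F (f x)" by auto
      moreover from this obtain y where "y \<in> T" "R x y" using assms(1) by blast
      ultimately show "v \<in> g ` T" using F by auto
    next
      fix v assume "v \<in> g ` T"
      then obtain y where "y \<in> T" "v = g y" by auto
      moreover from this obtain x where "x \<in> S" "R x y" using assms(2) by blast
      ultimately show "v \<in> F ` f ` S" using F by (metis image_eqI)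
    qed
  qed
  then show ?thesis by (rule bij_betw_same_card)
qed

text \<open>\<open>chi_cong\<close> says that all values of chi are congruent to 1 modulo a; it
  reduces stability under the whole group to the condition at the generator g0.\<close>

locale character_rep = number_field_type K for K :: "'k::field_char_0 itself" +
  fixes G :: "('g, 'm) monoid_scheme" and g0 :: 'g and chi :: "'g \<Rightarrow> 'k" and a :: 'k
  assumes group_G: "group G" and g0: "g0 \<in> carrier G"
    and chi_mult: "\<And>g h. g \<in> carrier G \<Longrightarrow> h \<in> carrier G \<Longrightarrow> chi (g \<otimes>\<^bsub>G\<^esub> h) = chi g * chi h"
    and chi_nonzero: "\<And>g. g \<in> carrier G \<Longrightarrow> chi g \<noteq> 0"
    and chi_int: "\<And>g. g \<in> carrier G \<Longrightarrow> algebraic_int (chi g)"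
    and chi_cong: "\<And>g. g \<in> carrier G \<Longrightarrow> \<exists>t. algebraic_int t \<and> 1 - chi g = a * t"
    and a_def: "a = 1 - chi g0" and a_nonzero: "a \<noteq> 0"
begin

sublocale G: group G by (rule group_G)

lemma a_int: "algebraic_int a"
  unfolding a_def using chi_int[OF g0] by (intro algebraic_int_diff) auto

abbreviation rho :: "'g \<Rightarrow> 'k^2^2" where "rho \<equiv> rep_of_char G chi"

lemma rho_eq: "g \<in> carrier G \<Longrightarrow> rho g = diag2 1 (chi g)"
  by (simp add: rep_of_char_def)

lemma rho_extensional: "rho \<in> extensional (carrier G)"
  by (simp add: rep_of_char_def)

lemma rho_invertible: "g \<in> carrier G \<Longrightarrow> invertible (rho g)"
  using diag2_inverse(1)[of 1 "chi g"] chi_nonzero by (simp add: rho_eq)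

lemma rho_mult: "g \<in> carrier G \<Longrightarrow> h \<in> carrier G \<Longrightarrow> rho (g \<otimes>\<^bsub>G\<^esub> h) = rho g ** rho h"
  by (simp add: rho_eq chi_mult mat2_eq_iff mat2_mult_nth)

lemma chi_one: "chi \<one>\<^bsub>G\<^esub> = 1"
  using chi_mult[of "\<one>\<^bsub>G\<^esub>" "\<one>\<^bsub>G\<^esub>"] chi_nonzero[of "\<one>\<^bsub>G\<^esub>"] by simp

lemma rho_one: "rho \<one>\<^bsub>G\<^esub> = mat 1"
  by (simp add: rho_eq chi_one mat2_eq_iff)

lemma conj_hom_diag:
  assumes "s \<noteq> 0" "t \<noteq> 0"
  shows "conj_hom G (diag2 s t) rho = rho"
  by (rule extensionalityI[OF conj_hom_extensional rho_extensional])
     (use assms in \<open>simp add: conj_hom_eq rho_eq diag2_inverse mat2_eq_iff mat2_mult_nth\<close>)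

text \<open>The identity behind it is chi y - z x = chi (y - z x) - (1 - chi) z x, where 1 - chi is
  a multiple of a. The reverse inclusion comes from the inverse of g.\<close>

lemma rho_Lam:
  assumes g: "g \<in> carrier G" and z: "a * z \<in> o_inv2 J"
  shows "app (rho g) ` Lam J z = Lam J z"
proof -
  have sub: "app (rho g) ` Lam J z \<subseteq> Lam J z" if g: "g \<in> carrier G" for g
  proof
    fix p assume "p \<in> app (rho g) ` Lam J z"
    then obtain x y where xy: "x \<in> J" "y - z * x \<in> o_inv J" "p = (x, chi g * y)"
      by (auto simp: Lam_def rho_eq[OF g] app_diag2)
    obtain t where t: "algebraic_int t" "1 - chi g = a * t" using chi_cong[OF g] by blast
    have "a * z * x \<in> o_inv J" using z xy(1) by (simp add: o_inv2_def)
    from o_module_diff[OF o_module_o_inv o_module_mult[OF o_module_o_inv chi_int[OF g] xy(2)]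
        o_module_mult[OF o_module_o_inv t(1) this]]
    have "chi g * (y - z * x) - t * (a * z * x) \<in> o_inv J" .
    also have "chi g * (y - z * x) - t * (a * z * x) = chi g * (y - z * x) - (1 - chi g) * (z * x)"
      unfolding t(2) by (simp add: mult_ac)
    also have "\<dots> = chi g * y - z * x" by (simp add: algebra_simps)
    finally show "p \<in> Lam J z" using xy by (simp add: Lam_def)
  qed
  have "Lam J z = app (rho g) ` app (rho (inv\<^bsub>G\<^esub> g)) ` Lam J z"
    unfolding app_mult_image[symmetric] using g by (simp add: rho_one flip: rho_mult)
  also have "\<dots> \<subseteq> app (rho g) ` Lam J z" using sub[of "inv\<^bsub>G\<^esub> g"] g by (intro image_mono) auto
  finally show ?thesis using sub[OF g] by blast
qed

text \<open>\<open>\<sigma>\<close> is the representation written in a basis of the lattice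
  \<open>Lam J z\<close>, with A as the coordinate map.\<close>

definition form_of :: "('g \<Rightarrow> 'k^2^2) \<Rightarrow> 'k set \<Rightarrow> 'k \<Rightarrow> bool" where
  "form_of \<sigma> J z \<longleftrightarrow> (\<exists>A. invertible A \<and> \<sigma> = conj_hom G A rho \<and> app A ` Lam J z = O2)"

lemma hom_conj_hom:
  fixes \<sigma> :: "'g \<Rightarrow> 'k^2^2"
  assumes "invertible A" and mult: "\<And>g h. g \<in> carrier G \<Longrightarrow> h \<in> carrier G \<Longrightarrow> \<sigma> (g \<otimes>\<^bsub>G\<^esub> h) = \<sigma> g ** \<sigma> h"
    and GL: "\<And>g. g \<in> carrier G \<Longrightarrow> A ** \<sigma> g ** matrix_inv A \<in> carrier (GL2 (carrier \<O>))"
  shows "conj_hom G A \<sigma> \<in> hom G (GL2 (carrier \<O>))"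
proof (rule homI)
  fix g h assume gh: "g \<in> carrier G" "h \<in> carrier G"
  show "conj_hom G A \<sigma> g \<in> carrier (GL2 (carrier \<O>))" using GL[OF gh(1)] gh by (simp add: conj_hom_eq)
  have "A ** \<sigma> g ** matrix_inv A ** (A ** \<sigma> h ** matrix_inv A) = A ** \<sigma> g ** (matrix_inv A ** A) ** \<sigma> h ** matrix_inv A"
    by (simp add: matrix_mul_assoc)
  then show "conj_hom G A \<sigma> (g \<otimes>\<^bsub>G\<^esub> h) = conj_hom G A \<sigma> g \<otimes>\<^bsub>GL2 (carrier \<O>)\<^esub> conj_hom G A \<sigma> h"
    using gh by (simp add: conj_hom_eq mult matrix_inv_mult[OF assms(1)] matrix_mul_assoc)
qed

lemma form_of_integral:
  assumes z: "a * z \<in> o_inv2 J" and \<sigma>: "form_of \<sigma> J z"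
  shows "\<sigma> \<in> integral_forms G rho"
proof -
  obtain A where A: "invertible A" "\<sigma> = conj_hom G A rho" "app A ` Lam J z = O2"
    using \<sigma> unfolding form_of_def by blast
  have "A ** rho g ** matrix_inv A \<in> carrier (GL2 (carrier \<O>))" if g: "g \<in> carrier G" for g
  proof -
    have "app (A ** rho g ** matrix_inv A) ` O2 = app A ` app (rho g) ` app (matrix_inv A) ` O2"
      by (simp only: app_mult_image)
    also have "app (matrix_inv A) ` O2 = Lam J z" using A app_image_eq_iff by metis
    also have "app A ` app (rho g) ` Lam J z = O2" using rho_Lam[OF g z] A by simp
    finally show ?thesis
      using A(1) rho_invertible[OF g] by (simp add: GL2_int_iff invertible_mult invertible_matrix_inv)
  qed
  then have "\<sigma> \<in> hom G (GL2 (carrier \<O>))"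
    unfolding A(2) by (intro hom_conj_hom A rho_mult)
  then show ?thesis using A by (auto simp: integral_forms_def GL2_UNIV_iff)
qed

lemma ex_form_of:
  assumes "o_ideal J" "J \<noteq> {0}"
  shows "\<exists>\<sigma>. form_of \<sigma> J z"
  using Lam_free[OF assms] unfolding form_of_def by blast

text \<open>Applying \<open>rho g0\<close> to (x, z x) changes it by (0, - a z x), which must again
  be in the lattice, so a z x lies in the inverse of J.\<close>

lemma form_of_imp_cong:
  assumes \<sigma>: "\<sigma> \<in> integral_forms G rho" "form_of \<sigma> J z"
  shows "a * z \<in> o_inv2 J"
proof -
  obtain A where A: "invertible A" "\<sigma> = conj_hom G A rho" "app A ` Lam J z = O2"
    using \<sigma> unfolding form_of_def by blast
  have "\<sigma> g0 \<in> carrier (GL2 (carrier \<O>))" using \<sigma>(1) g0 by (auto simp: integral_forms_def hom_def)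
  then have "app (\<sigma> g0) ` O2 = O2" by (simp add: GL2_int_iff)
  then have "app A ` app (rho g0) ` app (matrix_inv A) ` O2 = O2"
    using g0 by (simp only: A(2) conj_hom_eq app_mult_image)
  moreover have L: "app (matrix_inv A) ` O2 = Lam J z" using A app_image_eq_iff by metis
  ultimately have eq: "app (rho g0) ` Lam J z = Lam J z" using app_image_eq_iff[OF A(1)] by metis
  show ?thesis
    unfolding o_inv2_def
  proof safe
    fix x assume "x \<in> J"
    then have "(x, z * x) \<in> Lam J z" using o_module_0[OF o_module_o_inv] by (simp add: Lam_def)
    then have "(x, chi g0 * (z * x)) \<in> Lam J z" using eq app_diag2[of 1 "chi g0" x "z * x"] g0 rho_eq by force
    then have "chi g0 * (z * x) - z * x \<in> o_inv J" by (simp add: Lam_def)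
    from o_module_minus[OF o_module_o_inv this] show "a * z * x \<in> o_inv J"
      by (simp add: a_def algebra_simps)
  qed
qed

text \<open>The lattice is the image of O^2 under the inverse of A, and I is its projection to the
  first coordinate, scaled into O. Diagonal matrices commute with the representation, so every
  integral multiple J of I can be prescribed as the projection, the second coordinate being scaled
  to make the determinant 1.\<close>

lemma integral_form_ex_ideal:
  assumes "\<sigma> \<in> integral_forms G rho"
  shows "\<exists>I. o_ideal I \<and> I \<noteq> {0} \<and> (\<forall>J s. s \<noteq> 0 \<longrightarrow> o_ideal J \<longrightarrow> J = (*) s ` I \<longrightarrow> (\<exists>z. form_of \<sigma> J z))"
proof -
  obtain A where A: "invertible A" "\<sigma> = conj_hom G A rho"
    using assms by (auto simp: integral_forms_def GL2_UNIV_iff)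
  define B where "B = matrix_inv A"
  define d where "d = B $ 1 $ 1 * B $ 2 $ 2 - B $ 1 $ 2 * B $ 2 $ 1"
  have B: "invertible B" unfolding B_def using A(1) by (rule invertible_matrix_inv)
  then have d: "d \<noteq> 0" using invertible_det_nz[of B] by (simp add: det_2 d_def)
  have "\<exists>c. algebraic_int c \<and> c \<noteq> 0 \<and> algebraic_int (c * x)" for x :: 'k
  proof (cases "x = 0")
    case False
    then show ?thesis using quotient_of_integers[of x] by force
  qed (auto intro: exI[of _ 1])
  then obtain c1 c2 where c12: "algebraic_int c1" "c1 \<noteq> 0" "algebraic_int (c1 * B $ 1 $ 1)"
    "algebraic_int c2" "c2 \<noteq> 0" "algebraic_int (c2 * B $ 1 $ 2)" by metis
  define c where "c = c1 * c2"
  have c: "c \<noteq> 0" "algebraic_int (c * B $ 1 $ 1)" "algebraic_int (c * B $ 1 $ 2)"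
    using c12 algebraic_int_mult[of c2 "c1 * B $ 1 $ 1"] algebraic_int_mult[of c1 "c2 * B $ 1 $ 2"]
    by (auto simp: c_def mult_ac)
  define J0 where "J0 = {B $ 1 $ 1 * m + B $ 1 $ 2 * n | m n. algebraic_int m \<and> algebraic_int n}"
  have J0_scale: "(*) s ` J0 = {s * B $ 1 $ 1 * m + s * B $ 1 $ 2 * n | m n. algebraic_int m \<and> algebraic_int n}" for s
  proof (intro equalityI subsetI)
    fix x assume "x \<in> (*) s ` J0"
    then obtain m n where "algebraic_int m" "algebraic_int n" "x = s * (B $ 1 $ 1 * m + B $ 1 $ 2 * n)"
      unfolding J0_def by blast
    then show "x \<in> {s * B $ 1 $ 1 * m + s * B $ 1 $ 2 * n | m n. algebraic_int m \<and> algebraic_int n}"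
      by (intro CollectI exI[of _ m] exI[of _ n]) (simp add: distrib_left mult.assoc)
  next
    fix x assume "x \<in> {s * B $ 1 $ 1 * m + s * B $ 1 $ 2 * n | m n. algebraic_int m \<and> algebraic_int n}"
    then obtain m n where mn: "algebraic_int m" "algebraic_int n" "x = s * B $ 1 $ 1 * m + s * B $ 1 $ 2 * n"
      by blast
    then have "B $ 1 $ 1 * m + B $ 1 $ 2 * n \<in> J0" unfolding J0_def by blast
    moreover have "x = s * (B $ 1 $ 1 * m + B $ 1 $ 2 * n)" using mn by (simp add: distrib_left mult.assoc)
    ultimately show "x \<in> (*) s ` J0" by blast
  qed
  have J0_mod: "o_module J0"
    unfolding o_module_def
  proof (intro conjI ballI allI impI)
    show "0 \<in> J0" unfolding J0_def by (intro CollectI exI[of _ 0]) simp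
    fix x y assume "x \<in> J0" "y \<in> J0"
    then obtain m n m' n' where "x = B $ 1 $ 1 * m + B $ 1 $ 2 * n" "y = B $ 1 $ 1 * m' + B $ 1 $ 2 * n'"
      "algebraic_int m" "algebraic_int n" "algebraic_int m'" "algebraic_int n'"
      unfolding J0_def by blast
    then show "x + y \<in> J0" unfolding J0_def
      by (intro CollectI exI[of _ "m + m'"] exI[of _ "n + n'"]) (simp add: algebraic_int_add algebra_simps)
  next
    fix k x :: 'k assume k: "algebraic_int k" "x \<in> J0"
    then obtain m n where "x = B $ 1 $ 1 * m + B $ 1 $ 2 * n" "algebraic_int m" "algebraic_int n"
      unfolding J0_def by blast
    then show "k * x \<in> J0" unfolding J0_def using k(1)
      by (intro CollectI exI[of _ "k * m"] exI[of _ "k * n"]) (simp add: algebraic_int_mult algebra_simps)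
  qed
  have I: "o_ideal ((*) c ` J0)"
    unfolding o_ideal_def
  proof (intro conjI ballI o_module_scale J0_mod)
    fix x assume "x \<in> (*) c ` J0"
    then obtain m n where "algebraic_int m" "algebraic_int n" "x = c * B $ 1 $ 1 * m + c * B $ 1 $ 2 * n"
      unfolding J0_scale by blast
    then show "algebraic_int x" using c algebraic_int_add algebraic_int_mult by metis
  qed
  have nz: "(*) s ` J0 \<noteq> {0}" if "s \<noteq> 0" for s
  proof
    assume eq: "(*) s ` J0 = {0}"
    have "s * B $ 1 $ 1 \<in> (*) s ` J0" unfolding J0_scale by (intro CollectI exI[of _ 1] exI[of _ 0]) simp
    moreover have "s * B $ 1 $ 2 \<in> (*) s ` J0" unfolding J0_scale by (intro CollectI exI[of _ 0] exI[of _ 1]) simp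
    ultimately show False using eq that d by (auto simp: d_def)
  qed
  have "\<exists>z. form_of \<sigma> J z" if s: "s \<noteq> 0" and J: "o_ideal J" "J = (*) s ` (*) c ` J0" for J s
  proof -
    define s1 where "s1 = s * c"
    \<comment> \<open>Chosen to make the rescaled matrix unimodular, as
      \<open>unimodular_lattice_Lam\<close> requires.\<close>
    define t1 where "t1 = inverse (s1 * d)"
    have s1: "s1 \<noteq> 0" "t1 \<noteq> 0" using s c d by (auto simp: s1_def t1_def)
    have J': "J = (*) s1 ` J0" using J by (simp add: image_image s1_def mult.assoc)
    have inv: "o_invertible J" using o_ideal_invertible[OF J(1)] nz[OF s1(1)] J' by simp
    let ?B = "mat2 (s1 * B $ 1 $ 1) (s1 * B $ 1 $ 2) (t1 * B $ 2 $ 1) (t1 * B $ 2 $ 2)"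
    have B_eq: "?B = diag2 s1 t1 ** B" by (simp add: mat2_eq_iff mat2_mult_nth)
    have "s1 * B $ 1 $ 1 * (t1 * B $ 2 $ 2) - s1 * B $ 1 $ 2 * (t1 * B $ 2 $ 1) = t1 * (s1 * d)"
      by (simp add: d_def algebra_simps)
    also have "\<dots> = 1" unfolding t1_def using s1(1) d by (intro left_inverse) simp
    finally obtain z where z: "app ?B ` O2 = Lam J z"
      using unimodular_lattice_Lam[OF _ J'[unfolded J0_scale] inv] by blast
    let ?D = "diag2 s1 t1"
    have D: "invertible ?D" "matrix_inv ?D = diag2 (inverse s1) (inverse t1)" using diag2_inverse s1 by auto
    let ?A = "A ** matrix_inv ?D"
    have "invertible ?A" by (intro invertible_mult A(1) invertible_matrix_inv(1) D(1))
    moreover have "\<sigma> = conj_hom G ?A rho"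
      using conj_hom_mult[OF A(1) invertible_matrix_inv(1)[OF D(1)], of G rho] conj_hom_diag[of "inverse s1" "inverse t1"] s1
      by (simp add: A(2) D(2))
    moreover have "app ?A ` Lam J z = O2"
    proof -
      have "app ?A ` Lam J z = app (A ** (matrix_inv ?D ** ?D) ** B) ` O2"
        unfolding z[symmetric] B_eq by (simp only: app_mult_image)
      also have "\<dots> = O2" by (simp add: matrix_inv_mult[OF D(1)] matrix_inv_mult[OF A(1)] B_def)
      finally show ?thesis .
    qed
    ultimately show ?thesis unfolding form_of_def by blast
  qed
  then show ?thesis using I nz[OF c(1)] by blast
qed

text \<open>The two eigenvalues of \<open>rho g0\<close> differ by a \<noteq> 0, so its centralizer
  is diagonal.\<close>

lemma commute_rho_diag:
  assumes "D ** rho g0 = rho g0 ** D" "invertible D"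
  shows "\<exists>s t. s \<noteq> 0 \<and> t \<noteq> 0 \<and> D = diag2 s t"
proof -
  have "D $ 1 $ 2 * chi g0 = D $ 1 $ 2" "D $ 2 $ 1 = chi g0 * D $ 2 $ 1"
    using assms(1) g0 by (simp_all add: rho_eq mat2_eq_iff mat2_mult_nth)
  then have "a * D $ 1 $ 2 = 0" "a * D $ 2 $ 1 = 0" by (simp_all add: a_def algebra_simps)
  then have z: "D $ 1 $ 2 = 0" "D $ 2 $ 1 = 0" using a_nonzero by auto
  then have "D $ 1 $ 1 * D $ 2 $ 2 \<noteq> 0" using invertible_det_nz[of D] assms(2) by (simp add: det_2)
  then show ?thesis using z by (intro exI[of _ "D $ 1 $ 1"] exI[of _ "D $ 2 $ 2"]) (auto simp: mat2_eq_iff)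
qed

text \<open>Conjugate forms correspond to lattices mapped to each other by a matrix D that commutes
  with \<open>rho g0\<close>, hence by some diag (s, t). The unit is u = s t, so that t z / s
  becomes u z / s^2.\<close>

lemma form_of_conj_iff:
  assumes J: "o_ideal J" "J \<noteq> {0}" "o_ideal J'" "J' \<noteq> {0}"
    and "form_of \<sigma> J z" "form_of \<sigma>' J' z'"
  shows "(\<exists>h\<in>carrier (GL2 (carrier \<O>)). \<sigma>' = conj_hom G h \<sigma>) \<longleftrightarrow>
    (\<exists>s u. s \<noteq> 0 \<and> u \<in> Units \<O> \<and> J' = (*) s ` J \<and> z' - u * z / (s * s) \<in> o_inv2 J')"
proof
  obtain A where A: "invertible A" "\<sigma> = conj_hom G A rho" "app A ` Lam J z = O2"
    using assms unfolding form_of_def by blast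
  obtain A' where A': "invertible A'" "\<sigma>' = conj_hom G A' rho" "app A' ` Lam J' z' = O2"
    using assms unfolding form_of_def by blast
  have inv: "o_invertible J" "o_invertible J'" using J o_ideal_invertible by auto
  {
    assume "\<exists>h\<in>carrier (GL2 (carrier \<O>)). \<sigma>' = conj_hom G h \<sigma>"
    then obtain h where h: "invertible h" "app h ` O2 = O2" "\<sigma>' = conj_hom G h \<sigma>"
      by (auto simp: GL2_int_iff)
    define D where "D = matrix_inv A' ** h ** A"
    have D: "invertible D" unfolding D_def using A A' h by (simp add: invertible_mult invertible_matrix_inv)
    have "conj_hom G A' rho = conj_hom G (h ** A) rho"
      using h(3) A'(2) A(2) conj_hom_mult[OF h(1) A(1)] by metis
    then have "A' ** rho g0 ** matrix_inv A' = h ** A ** rho g0 ** matrix_inv (h ** A)"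
      using g0 conj_hom_eq by metis
    then have "matrix_inv A' ** (A' ** rho g0 ** matrix_inv A') ** (h ** A) =
      matrix_inv A' ** (h ** A ** rho g0 ** matrix_inv (h ** A)) ** (h ** A)" by simp
    moreover have "matrix_inv A' ** (A' ** rho g0 ** matrix_inv A') ** (h ** A) = (matrix_inv A' ** A') ** rho g0 ** D"
      by (simp add: D_def matrix_mul_assoc)
    moreover have "matrix_inv A' ** (h ** A ** rho g0 ** matrix_inv (h ** A)) ** (h ** A)
       = D ** rho g0 ** (matrix_inv (h ** A) ** (h ** A))" by (simp add: D_def matrix_mul_assoc)
    ultimately have "D ** rho g0 = rho g0 ** D"
      using A'(1) h(1) A(1) by (simp add: matrix_inv_mult invertible_mult)
    then obtain s t where st: "s \<noteq> 0" "t \<noteq> 0" "D = diag2 s t" using commute_rho_diag D by blast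
    have "app D ` Lam J z = app (matrix_inv A') ` app h ` app A ` Lam J z"
      by (simp only: D_def app_mult_image)
    also have "\<dots> = Lam J' z'" using A A' h app_image_eq_iff by metis
    finally have "app (diag2 s t) ` Lam J z = Lam J' z'" by (simp add: st)
    then have *: "J' = (*) s ` J" "s * t \<in> Units \<O>" "z' - t * z / s \<in> o_inv2 J'"
      using Lam_diag_image[OF st(1,2) inv] by auto
    moreover have "s * t * z / (s * s) = t * z / s" using st by simp
    ultimately show "\<exists>s u. s \<noteq> 0 \<and> u \<in> Units \<O> \<and> J' = (*) s ` J \<and> z' - u * z / (s * s) \<in> o_inv2 J'"
      using st(1) by (intro exI[of _ s] exI[of _ "s * t"]) simp
  }
  assume "\<exists>s u. s \<noteq> 0 \<and> u \<in> Units \<O> \<and> J' = (*) s ` J \<and> z' - u * z / (s * s) \<in> o_inv2 J'"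
  then obtain s u where su: "s \<noteq> 0" "u \<in> Units \<O>" "J' = (*) s ` J" "z' - u * z / (s * s) \<in> o_inv2 J'" by blast
  define t where "t = u / s"
  have t: "t \<noteq> 0" using su by (auto simp: t_def Units_int_ring)
  have "app (diag2 s t) ` Lam J z = Lam J' z'"
    using Lam_diag_image[OF su(1) t inv] su by (simp add: t_def)
  define h where "h = A' ** diag2 s t ** matrix_inv A"
  have hinv: "invertible h"
    unfolding h_def using A A' diag2_inverse(1)[OF su(1) t] by (simp add: invertible_mult invertible_matrix_inv)
  have "app h ` O2 = app A' ` app (diag2 s t) ` app (matrix_inv A) ` O2" by (simp only: h_def app_mult_image)
  also have "app (matrix_inv A) ` O2 = Lam J z" using A app_image_eq_iff by metis
  also have "app A' ` app (diag2 s t) ` Lam J z = O2" using A' \<open>app (diag2 s t) ` Lam J z = Lam J' z'\<close> by simp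
  finally have "h \<in> carrier (GL2 (carrier \<O>))" using hinv by (simp add: GL2_int_iff)
  moreover have "\<sigma>' = conj_hom G h \<sigma>"
  proof -
    have "h ** A = A' ** diag2 s t ** (matrix_inv A ** A)" by (simp only: h_def matrix_mul_assoc)
    then have "conj_hom G h \<sigma> = conj_hom G (A' ** diag2 s t) rho"
      unfolding A(2) conj_hom_mult[OF hinv A(1)] using A(1) by (simp add: matrix_inv_mult)
    also have "\<dots> = conj_hom G A' (conj_hom G (diag2 s t) rho)"
      by (rule conj_hom_mult[OF A'(1) diag2_inverse(1)[OF su(1) t], symmetric])
    finally show ?thesis using conj_hom_diag[OF su(1) t] A'(2) by simp
  qed
  ultimately show "\<exists>h\<in>carrier (GL2 (carrier \<O>)). \<sigma>' = conj_hom G h \<sigma>" by blast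
qed

end

section \<open>Counting\<close>

locale character_rep_primes = character_rep K G g0 chi a
  for K :: "'k::field_char_0 itself" and G :: "('g, 'm) monoid_scheme" and g0 chi a +
  fixes r :: nat and P :: "nat \<Rightarrow> 'k set" and e :: "nat \<Rightarrow> nat"
  assumes place: "\<And>i. i \<in> {1..r} \<Longrightarrow> prime_place K (P i)" and inj: "inj_on P {1..r}"
    and factorization: "(\<Otimes>\<^bsub>ideals_set \<O>\<^esub>i\<in>{1..r}. o_power (P i) (e i)) = {a * x |x. algebraic_int x}"
begin

sublocale prime_family K "{1..r}" P e
  by (intro prime_family.intro prime_family_axioms.intro number_field_type_axioms finite_atLeastAtMost place inj)

lemma mem_a_iff:
  assumes "algebraic_int y"
  shows "(\<exists>x. algebraic_int x \<and> y = a * x) \<longleftrightarrow> (\<forall>i\<in>{1..r}. padic_abs (P i) y \<le> 2 powi (- int (e i)))"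
  using mem_finprod_iff[OF factorization a_nonzero a_int] assms prime_place.mem_o_power_iff_abs[OF place]
  by auto

abbreviation branch_act :: "'k \<Rightarrow> (nat \<Rightarrow> 'k bt_vertex) \<Rightarrow> nat \<Rightarrow> 'k bt_vertex" where
  "branch_act \<equiv> \<lambda>u. \<lambda>x\<in>branch_product r P e. \<lambda>i\<in>{1..r}. vertex_act (P i) (diag2 1 u) (x i)"

definition branch_residue :: "(nat \<Rightarrow> 'k bt_vertex) \<Rightarrow> 'k \<Rightarrow> bool" where
  "branch_residue x c \<longleftrightarrow> x \<in> branch_product r P e \<and> algebraic_int c \<and>
     (\<forall>i\<in>{1..r}. prime_place.vertex_residue (P i) (e i) (x i) c)"

lemma branch_product_iff:
  "x \<in> branch_product r P e \<longleftrightarrow> x \<in> extensional {1..r} \<and> (\<forall>i\<in>{1..r}. x i \<in> side_branch (P i) (e i))"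
  by (auto simp: branch_product_def PiE_iff)

lemma ex_branch_of_residue:
  assumes "algebraic_int c"
  shows "\<exists>x. branch_residue x c"
proof -
  have "\<exists>v. prime_place.vertex_residue (P i) (e i) v c" if "i \<in> {1..r}" for i
    using prime_place.ex_vertex_residue[OF place[OF that] assms] .
  then obtain x where x: "\<And>i. i \<in> {1..r} \<Longrightarrow> prime_place.vertex_residue (P i) (e i) (x i) c" by metis
  have "x i \<in> side_branch (P i) (e i)" if "i \<in> {1..r}" for i
    using prime_place.vertex_residue_side_branch[OF place[OF that] x[OF that]] .
  then have "branch_residue (restrict x {1..r}) c"
    unfolding branch_residue_def branch_product_iff using assms x by simp
  then show ?thesis by blast
qed

lemma ex_residue_of_branch:
  assumes x: "x \<in> branch_product r P e"
  shows "\<exists>c. branch_residue x c"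
proof -
  have "\<exists>c. algebraic_int c \<and> prime_place.vertex_residue (P i) (e i) (x i) c" if "i \<in> {1..r}" for i
    using prime_place.ex_residue_vertex[OF place[OF that]] x that unfolding branch_product_iff by blast
  then obtain z where z: "\<And>i. i \<in> {1..r} \<Longrightarrow> algebraic_int (z i)"
    "\<And>i. i \<in> {1..r} \<Longrightarrow> prime_place.vertex_residue (P i) (e i) (x i) (z i)" by metis
  have "\<exists>c. algebraic_int c \<and> (\<forall>i\<in>{1..r}. c - z i \<in> o_power (P i) (e i))"
    using z(1) by (rule chinese_remainder)
  then obtain c where c: "algebraic_int c" "\<And>i. i \<in> {1..r} \<Longrightarrow> c - z i \<in> o_power (P i) (e i)"
    by (elim exE conjE) (simp only: Ball_def)
  have "prime_place.vertex_residue (P i) (e i) (x i) c" if i: "i \<in> {1..r}" for i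
  proof (rule prime_place.vertex_residue_cong[OF place[OF i] z(2)[OF i]])
    show "padic_abs (P i) (c - z i) \<le> 2 powi (- int (e i))"
      using prime_place.mem_o_power_iff_abs[OF place[OF i] algebraic_int_diff[OF c(1) z(1)[OF i]]] c(2)[OF i] by simp
  qed
  then show ?thesis using c(1) x unfolding branch_residue_def by blast
qed

lemma group_units: "group (units_of (\<O> :: 'k ring))"
proof -
  interpret cring "\<O> :: 'k ring" by (rule cring_int_ring)
  show ?thesis by (rule units_group)
qed

text \<open>One unit acts in all coordinates, so the local congruences combine, through the
  factorization of a, into a single congruence modulo a.\<close>

lemma branch_orbit_eq_iff:
  assumes x: "branch_residue x c" and x': "branch_residue x' c'"
  shows "orbit (units_of \<O>) branch_act x = orbit (units_of \<O>) branch_act x' \<longleftrightarrow>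
    (\<exists>u\<in>Units \<O>. \<exists>t. algebraic_int t \<and> c' - u * c = a * t)"
proof -
  have act_in: "branch_act u x \<in> branch_product r P e" if u: "u \<in> Units \<O>" and x: "x \<in> branch_product r P e" for u x
    using prime_place.side_branch_act(1)[OF place _ u u] x by (auto simp: branch_product_iff)
  have ext: "y = y'" if "y \<in> branch_product r P e" "y' \<in> branch_product r P e" "\<And>i. i \<in> {1..r} \<Longrightarrow> y i = y' i" for y y'
    using that unfolding branch_product_iff by (metis extensionalityI)
  have BP: "x \<in> branch_product r P e" "x' \<in> branch_product r P e" using x x' by (auto simp: branch_residue_def)
  interpret U: group "units_of (\<O> :: 'k ring)" by (rule group_units)
  have mult: "u * w \<in> Units \<O>" if "u \<in> Units \<O>" "w \<in> Units \<O>" for u w :: 'k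
    using U.m_closed[of u w] that by (simp add: units_of_carrier units_of_mult)
  have one: "1 \<in> Units (\<O> :: 'k ring)" using U.one_closed by (simp add: units_of_carrier units_of_one)
  have "orbit (units_of \<O>) branch_act x = orbit (units_of \<O>) branch_act x' \<longleftrightarrow>
    (\<exists>u\<in>carrier (units_of \<O>). x' = branch_act u x)"
  proof (rule orbit_eq_iff[OF group_units, where E = "branch_product r P e"])
    fix u w y assume h: "u \<in> carrier (units_of (\<O> :: 'k ring))" "w \<in> carrier (units_of (\<O> :: 'k ring))" "y \<in> branch_product r P e"
    then have uw: "u \<in> Units \<O>" "w \<in> Units \<O>" by (simp_all add: units_of_carrier)
    show "branch_act (u \<otimes>\<^bsub>units_of \<O>\<^esub> w) y = branch_act u (branch_act w y)"
    proof (rule ext)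
      fix i assume i: "i \<in> {1..r}"
      then have "y i \<in> side_branch (P i) (e i)" using h by (simp add: branch_product_iff)
      from prime_place.side_branch_act(2)[OF place[OF i] this uw]
      show "branch_act (u \<otimes>\<^bsub>units_of \<O>\<^esub> w) y i = branch_act u (branch_act w y) i"
        using act_in[OF uw(2) h(3)] h(3) i by (simp add: units_of_mult)
    qed (use act_in mult uw h(3) in \<open>simp_all only: units_of_mult int_ring_simps\<close>)
  next
    fix y assume y: "y \<in> branch_product r P e"
    show "branch_act \<one>\<^bsub>units_of \<O>\<^esub> y = y"
    proof (rule ext)
      fix i assume i: "i \<in> {1..r}"
      then have "y i \<in> side_branch (P i) (e i)" using y by (simp add: branch_product_iff)
      from prime_place.side_branch_act(3)[OF place[OF i] this one one]
      show "branch_act \<one>\<^bsub>units_of \<O>\<^esub> y i = y i" using y i by (simp add: units_of_one)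
    qed (use act_in one y in \<open>simp_all only: units_of_one int_ring_simps\<close>)
  qed (use act_in BP in \<open>simp_all only: units_of_carrier\<close>)
  also have "\<dots> \<longleftrightarrow> (\<exists>u\<in>Units \<O>. \<exists>t. algebraic_int t \<and> c' - u * c = a * t)"
    unfolding units_of_carrier
  proof (rule bex_cong[OF refl])
    fix u :: 'k assume u: "u \<in> Units \<O>"
    have cint: "algebraic_int (c' - u * c)"
      using x x' u by (auto simp: branch_residue_def Units_int_ring intro!: algebraic_int_diff algebraic_int_mult)
    have "x' = branch_act u x \<longleftrightarrow> (\<forall>i\<in>{1..r}. x' i = vertex_act (P i) (diag2 1 u) (x i))"
      using ext[OF BP(2) act_in[OF u BP(1)]] BP by auto
    also have "\<dots> \<longleftrightarrow> (\<forall>i\<in>{1..r}. padic_abs (P i) (c' - u * c) \<le> 2 powi (- int (e i)))"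
    proof (rule ball_cong[OF refl])
      fix i assume i: "i \<in> {1..r}"
      show "x' i = vertex_act (P i) (diag2 1 u) (x i) \<longleftrightarrow> padic_abs (P i) (c' - u * c) \<le> 2 powi (- int (e i))"
        using prime_place.vertex_act_eq_iff_residue[OF place[OF i] _ _ prime_place.padic_abs_unit[OF place[OF i] u]]
          x x' i unfolding branch_residue_def by blast
    qed
    also have "\<dots> \<longleftrightarrow> (\<exists>t. algebraic_int t \<and> c' - u * c = a * t)" using mem_a_iff[OF cint] by simp
    finally show "x' = branch_act u x \<longleftrightarrow> (\<exists>t. algebraic_int t \<and> c' - u * c = a * t)" .
  qed
  finally show ?thesis .
qed

section \<open>Fixed representatives of the ideal classes\<close>

abbreviation ideal_class :: "'k set \<Rightarrow> 'k set set" where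
  "ideal_class I \<equiv> ideal_class_rel `` {I}"

text \<open>The choice depends on the class as a set, so ideals of the same class get equal
  representatives, not merely equivalent ones.\<close>

definition class_rep :: "'k set \<Rightarrow> 'k set" where
  "class_rep I = (SOME J. J \<in> ideal_class I)"

lemma nonzero_ideals_iff: "(I :: 'k set) \<in> nonzero_ideals \<longleftrightarrow> o_ideal I \<and> I \<noteq> {0}"
  by (simp add: nonzero_ideals_def ideal_iff_o_ideal)

lemma class_rep:
  assumes "I \<in> nonzero_ideals"
  shows "(I, class_rep I) \<in> ideal_class_rel" "class_rep I \<in> nonzero_ideals"
proof -
  have "(I, I) \<in> ideal_class_rel" using assms equiv_ideal_class_rel by (auto simp: equiv_def refl_on_def)
  then have "\<exists>J. J \<in> ideal_class I" by blast
  from someI_ex[OF this] show "(I, class_rep I) \<in> ideal_class_rel" by (simp add: class_rep_def)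
  then show "class_rep I \<in> nonzero_ideals" by (simp add: ideal_class_rel_def)
qed

lemma ideal_class_rel_iff:
  assumes "I \<in> nonzero_ideals" "(J :: 'k set) \<in> nonzero_ideals"
  shows "(I, J) \<in> ideal_class_rel \<longleftrightarrow> (\<exists>s. s \<noteq> 0 \<and> J = (*) s ` I)"
proof
  assume "(I, J) \<in> ideal_class_rel"
  then obtain b c :: 'k where bc: "b \<noteq> 0" "c \<noteq> 0" "(*) b ` I = (*) c ` J" by (auto simp: ideal_class_rel_def)
  have "J = (*) (inverse c) ` (*) c ` J" using bc by (simp add: image_image mult.assoc[symmetric])
  also have "\<dots> = (*) (inverse c * b) ` I" unfolding bc(3)[symmetric] by (simp add: image_image mult.assoc)
  finally show "\<exists>s. s \<noteq> 0 \<and> J = (*) s ` I" using bc by (intro exI[of _ "inverse c * b"]) simp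
next
  assume "\<exists>s. s \<noteq> 0 \<and> J = (*) s ` I"
  then obtain s where s: "s \<noteq> 0" "J = (*) s ` I" by blast
  then obtain b c where bc: "algebraic_int b" "b \<noteq> 0" "algebraic_int c" "c \<noteq> 0" "s = b / c"
    using quotient_of_integers by metis
  have "(*) c ` J = (*) b ` I" unfolding s(2) image_image using bc by (simp add: mult.assoc[symmetric])
  then show "(I, J) \<in> ideal_class_rel"
    unfolding ideal_class_rel_def mem_Collect_eq case_prod_conv using assms bc
    by (intro conjI bexI[of _ b] bexI[of _ c]) simp_all
qed

lemma class_rep_eq_iff:
  assumes "I \<in> nonzero_ideals" "J \<in> nonzero_ideals"
  shows "ideal_class I = ideal_class J \<longleftrightarrow> (\<exists>s. s \<noteq> 0 \<and> class_rep J = (*) s ` class_rep I)"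
proof -
  have cl: "ideal_class I = ideal_class (class_rep I)" if "I \<in> nonzero_ideals" for I
    using equiv_class_eq[OF equiv_ideal_class_rel class_rep(1)[OF that]] .
  have "ideal_class I = ideal_class J \<longleftrightarrow> (class_rep I, class_rep J) \<in> ideal_class_rel"
    unfolding cl[OF assms(1)] cl[OF assms(2)]
    by (rule eq_equiv_class_iff[OF equiv_ideal_class_rel class_rep(2)[OF assms(1)] class_rep(2)[OF assms(2)]])
  also have "\<dots> \<longleftrightarrow> (\<exists>s. s \<noteq> 0 \<and> class_rep J = (*) s ` class_rep I)"
    by (rule ideal_class_rel_iff[OF class_rep(2)[OF assms(1)] class_rep(2)[OF assms(2)]])
  finally show ?thesis .
qed

text \<open>Multiplication by \<open>generator J\<close> identifies \<open>\<O> / a\<close> with \<open>J\<^sup>-\<^sup>2 / a J\<^sup>-\<^sup>2\<close>.\<close>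

definition generator :: "'k set \<Rightarrow> 'k" where
  "generator J = (SOME g. g \<in> o_inv2 J \<and> (\<exists>t s. t \<in> o_inv (o_inv2 J) \<and> algebraic_int s \<and> g * t + a * s = 1))"

lemma generator:
  assumes "o_invertible J"
  shows "generator J \<in> o_inv2 J"
    "\<exists>t s. t \<in> o_inv (o_inv2 J) \<and> algebraic_int s \<and> generator J * t + a * s = 1"
proof -
  have "\<exists>g. g \<in> o_inv2 J \<and> (\<exists>t s. t \<in> o_inv (o_inv2 J) \<and> algebraic_int s \<and> g * t + a * s = 1)"
    using generator_modulo[OF o_invertible_o_inv2[OF assms] a_int a_nonzero] by metis
  from someI_ex[OF this] show "generator J \<in> o_inv2 J"
    "\<exists>t s. t \<in> o_inv (o_inv2 J) \<and> algebraic_int s \<and> generator J * t + a * s = 1"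
    unfolding generator_def by auto
qed

text \<open>Surjectivity: with 1 = g t + a s, an element y equals (y t) g up to a (y s).\<close>

lemma generator_ex:
  assumes J: "o_invertible J" and y: "y \<in> o_inv2 J"
  shows "\<exists>c. algebraic_int c \<and> (y - c * generator J) / a \<in> o_inv2 J"
proof -
  obtain t s where ts: "t \<in> o_inv (o_inv2 J)" "algebraic_int s" "generator J * t + a * s = 1"
    using generator[OF J] by blast
  have "y - y * t * generator J = y * (1 - generator J * t)" by (simp add: algebra_simps)
  also have "1 - generator J * t = a * s" using ts(3) by (simp add: algebra_simps)
  finally have "(y - y * t * generator J) / a = y * s" using a_nonzero by simp
  moreover have "y * s \<in> o_inv2 J" using y ts by (intro o_module_mult'[OF o_module_o_inv2])
  moreover have "algebraic_int (y * t)" using ts(1) y by (auto simp: o_inv_def mult.commute)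
  ultimately show ?thesis by (intro exI[of _ "y * t"]) simp
qed

text \<open>Injectivity: multiplying c g / a by t recovers c / a up to the integer c s.\<close>

lemma generator_dvd_iff:
  assumes J: "o_invertible J" and c: "algebraic_int c"
  shows "c * generator J / a \<in> o_inv2 J \<longleftrightarrow> (\<exists>t. algebraic_int t \<and> c = a * t)"
proof
  assume h: "c * generator J / a \<in> o_inv2 J"
  obtain t s where ts: "t \<in> o_inv (o_inv2 J)" "algebraic_int s" "generator J * t + a * s = 1"
    using generator[OF J] by blast
  have "algebraic_int (c * generator J / a * t)" using h ts(1) by (auto simp: o_inv_def mult.commute)
  then have "algebraic_int (c * generator J / a * t + c * s)" using c ts by (intro algebraic_int_add algebraic_int_mult[of c])
  moreover have "c = a * (c * generator J / a * t + c * s)"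
  proof -
    have "c = c * (generator J * t + a * s)" by (simp add: ts)
    then show ?thesis using a_nonzero by (simp add: algebra_simps)
  qed
  ultimately show "\<exists>t. algebraic_int t \<and> c = a * t" by blast
next
  assume "\<exists>t. algebraic_int t \<and> c = a * t"
  then obtain t where "algebraic_int t" "c = a * t" by blast
  then show "c * generator J / a \<in> o_inv2 J"
    using a_nonzero o_module_mult[OF o_module_o_inv2 _ generator(1)[OF J], of t] by simp
qed

text \<open>Division by a turns the multiples c g of the generator, with c in O/a, into the
  admissible z modulo J^-2.\<close>

definition form_residue :: "('g \<Rightarrow> 'k^2^2) \<Rightarrow> 'k \<Rightarrow> 'k set \<Rightarrow> bool" where
  "form_residue \<sigma> c I \<longleftrightarrow> form_of \<sigma> (class_rep I) (c * generator (class_rep I) / a)"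

lemma class_rep_ideal:
  assumes "I \<in> nonzero_ideals"
  shows "o_ideal (class_rep I)" "class_rep I \<noteq> {0}" "o_invertible (class_rep I)"
  using class_rep(2)[OF assms] o_ideal_invertible by (auto simp: nonzero_ideals_iff)

lemma ex_form_residue:
  assumes c: "algebraic_int c" and I: "I \<in> nonzero_ideals"
  shows "\<exists>\<sigma>\<in>integral_forms G rho. form_residue \<sigma> c I"
proof -
  let ?J = "class_rep I"
  have "c * generator ?J \<in> o_inv2 ?J"
    using generator(1)[OF class_rep_ideal(3)[OF I]] c by (intro o_module_mult[OF o_module_o_inv2])
  then have "a * (c * generator ?J / a) \<in> o_inv2 ?J" using a_nonzero by simp
  then show ?thesis
    using ex_form_of[OF class_rep_ideal(1,2)[OF I]] form_of_integral unfolding form_residue_def by blast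
qed

lemma form_of_cong: "z - z' \<in> o_inv2 J \<Longrightarrow> form_of \<sigma> J z \<longleftrightarrow> form_of \<sigma> J z'"
  unfolding form_of_def using Lam_cong by simp

lemma ex_residue_of_form:
  assumes \<sigma>: "\<sigma> \<in> integral_forms G rho"
  shows "\<exists>c I. algebraic_int c \<and> I \<in> nonzero_ideals \<and> form_residue \<sigma> c I"
proof -
  obtain I where I: "o_ideal I" "I \<noteq> {0}"
    "\<And>J s. s \<noteq> 0 \<Longrightarrow> o_ideal J \<Longrightarrow> J = (*) s ` I \<Longrightarrow> \<exists>z. form_of \<sigma> J z"
    using integral_form_ex_ideal[OF \<sigma>] by blast
  then have In: "I \<in> nonzero_ideals" by (simp add: nonzero_ideals_iff)
  let ?J = "class_rep I"
  obtain s where "s \<noteq> 0" "?J = (*) s ` I"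
    using ideal_class_rel_iff[OF In class_rep(2)[OF In]] class_rep(1)[OF In] by blast
  then obtain z where z: "form_of \<sigma> ?J z" using I(3) class_rep_ideal(1)[OF In] by blast
  have "a * z \<in> o_inv2 ?J" using form_of_imp_cong[OF \<sigma> z] .
  then obtain c where c: "algebraic_int c" "(a * z - c * generator ?J) / a \<in> o_inv2 ?J"
    using generator_ex[OF class_rep_ideal(3)[OF In]] by blast
  have "(a * z - c * generator ?J) / a = z - c * generator ?J / a" using a_nonzero by (simp add: field_simps)
  then have "form_residue \<sigma> c I" unfolding form_residue_def using z c(2) form_of_cong by metis
  then show ?thesis using c(1) In by blast
qed

lemma integral_forms_conj:
  assumes h: "h \<in> carrier (GL2 (carrier \<O>))" and \<sigma>: "\<sigma> \<in> integral_forms G rho"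
  shows "conj_hom G h \<sigma> \<in> integral_forms G rho"
proof -
  interpret GL: group "GL2 (carrier (\<O> :: 'k ring))" using group_GL2_int by simp
  obtain A where A: "invertible A" "\<sigma> = conj_hom G A rho"
    using \<sigma> by (auto simp: integral_forms_def GL2_UNIV_iff)
  have hinv: "invertible h" using h by (simp add: GL2_int_iff)
  have hi: "matrix_inv h \<in> carrier (GL2 (carrier \<O>))"
    using h app_image_eq_iff[of h O2 O2] by (auto simp: GL2_int_iff invertible_matrix_inv)
  have \<sigma>_hom: "\<sigma> \<in> hom G (GL2 (carrier \<O>))" using \<sigma> by (simp add: integral_forms_def)
  have "conj_hom G h \<sigma> \<in> hom G (GL2 (carrier \<O>))"
  proof (rule hom_conj_hom[OF hinv])
    fix g k assume g: "g \<in> carrier G" "k \<in> carrier G"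
    show "\<sigma> (g \<otimes>\<^bsub>G\<^esub> k) = \<sigma> g ** \<sigma> k" using hom_mult[OF \<sigma>_hom g] by simp
  next
    fix g assume g: "g \<in> carrier G"
    have "\<sigma> g \<in> carrier (GL2 (carrier \<O>))" using hom_in_carrier[OF \<sigma>_hom g] .
    then have "h \<otimes>\<^bsub>GL2 (carrier \<O>)\<^esub> \<sigma> g \<otimes>\<^bsub>GL2 (carrier \<O>)\<^esub> matrix_inv h \<in> carrier (GL2 (carrier \<O>))"
      using h hi by (intro GL.m_closed)
    then show "h ** \<sigma> g ** matrix_inv h \<in> carrier (GL2 (carrier \<O>))" by simp
  qed
  then show ?thesis
    using conj_hom_mult[OF hinv A(1), of G rho] invertible_mult[OF hinv A(1)] A(2)
    by (auto simp: integral_forms_def GL2_UNIV_iff)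
qed

abbreviation form_act :: "'k^2^2 \<Rightarrow> ('g \<Rightarrow> 'k^2^2) \<Rightarrow> 'g \<Rightarrow> 'k^2^2" where
  "form_act \<equiv> \<lambda>A. \<lambda>\<sigma>\<in>integral_forms G rho. conj_hom G A \<sigma>"

lemma form_orbit_eq_iff:
  assumes "\<sigma> \<in> integral_forms G rho" "\<sigma>' \<in> integral_forms G rho"
  shows "orbit (GL2 (carrier \<O>)) form_act \<sigma> = orbit (GL2 (carrier \<O>)) form_act \<sigma>' \<longleftrightarrow>
    (\<exists>h\<in>carrier (GL2 (carrier \<O>)). \<sigma>' = conj_hom G h \<sigma>)"
proof -
  have inv: "invertible h" if "h \<in> carrier (GL2 (carrier \<O>))" for h :: "'k^2^2"
    using that by (simp add: GL2_int_iff)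
  have "orbit (GL2 (carrier \<O>)) form_act \<sigma> = orbit (GL2 (carrier \<O>)) form_act \<sigma>' \<longleftrightarrow>
    (\<exists>h\<in>carrier (GL2 (carrier \<O>)). \<sigma>' = form_act h \<sigma>)"
  proof (rule orbit_eq_iff[where E = "integral_forms G rho"])
    show "group (GL2 (carrier (\<O> :: 'k ring)))" using group_GL2_int by simp
    fix \<tau> assume \<tau>: "\<tau> \<in> integral_forms G rho"
    then have "\<tau> \<in> extensional (carrier G)" by (auto simp: integral_forms_def conj_hom_extensional)
    then show "form_act \<one>\<^bsub>GL2 (carrier \<O>)\<^esub> \<tau> = \<tau>" using \<tau> by (simp add: conj_hom_one)
    fix h assume h: "h \<in> carrier (GL2 (carrier (\<O> :: 'k ring)))"
    show "form_act h \<tau> \<in> integral_forms G rho" using integral_forms_conj[OF h \<tau>] \<tau> by simp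
    fix h' assume h': "h' \<in> carrier (GL2 (carrier (\<O> :: 'k ring)))"
    show "form_act (h' \<otimes>\<^bsub>GL2 (carrier \<O>)\<^esub> h) \<tau> = form_act h' (form_act h \<tau>)"
      using integral_forms_conj[OF h \<tau>] \<tau> conj_hom_mult[OF inv[OF h'] inv[OF h], of G \<tau>] by simp
  qed (use assms in auto)
  then show ?thesis using assms(1) by simp
qed

text \<open>Here the ideal class splits off. Equal classes have equal representatives, so a scaling
  by s between them preserves J and s is a unit; replacing u by u s^-2 removes it from the
  criterion. Conversely s = 1 serves.\<close>

lemma form_residue_orbit_eq_iff:
  assumes \<sigma>: "\<sigma> \<in> integral_forms G rho" "\<sigma>' \<in> integral_forms G rho"
    and c: "algebraic_int c" "algebraic_int c'" and I: "I \<in> nonzero_ideals" "I' \<in> nonzero_ideals"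
    and res: "form_residue \<sigma> c I" "form_residue \<sigma>' c' I'"
  shows "orbit (GL2 (carrier \<O>)) form_act \<sigma> = orbit (GL2 (carrier \<O>)) form_act \<sigma>' \<longleftrightarrow>
    ideal_class I = ideal_class I' \<and> (\<exists>u\<in>Units \<O>. \<exists>t. algebraic_int t \<and> c' - u * c = a * t)"
proof -
  let ?J = "class_rep I" and ?J' = "class_rep I'"
  let ?z = "c * generator ?J / a" and ?z' = "c' * generator ?J' / a"
  interpret U: group "units_of (\<O> :: 'k ring)" by (rule group_units)
  have mult: "u * w \<in> Units \<O>" if "u \<in> Units \<O>" "w \<in> Units \<O>" for u w :: 'k
    using U.m_closed[of u w] that by (simp add: units_of_carrier units_of_mult)
  have inv: "inverse u \<in> Units \<O>" if "u \<in> Units \<O>" for u :: 'k using that by (simp add: Units_int_ring)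
  have key: "c' * generator ?J / a - u * (c * generator ?J / a) \<in> o_inv2 ?J \<longleftrightarrow>
    (\<exists>t. algebraic_int t \<and> c' - u * c = a * t)" if u: "u \<in> Units \<O>" for u
  proof -
    have "c' * generator ?J / a - u * (c * generator ?J / a) = (c' - u * c) * generator ?J / a"
      by (simp add: diff_divide_distrib left_diff_distrib mult.assoc)
    moreover have "algebraic_int (c' - u * c)"
      using u c by (auto simp: Units_int_ring intro!: algebraic_int_diff algebraic_int_mult)
    ultimately show ?thesis using generator_dvd_iff[OF class_rep_ideal(3)[OF I(1)]] by simp
  qed
  have "orbit (GL2 (carrier \<O>)) form_act \<sigma> = orbit (GL2 (carrier \<O>)) form_act \<sigma>' \<longleftrightarrow>
    (\<exists>s u. s \<noteq> 0 \<and> u \<in> Units \<O> \<and> ?J' = (*) s ` ?J \<and> ?z' - u * ?z / (s * s) \<in> o_inv2 ?J')"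
    unfolding form_orbit_eq_iff[OF \<sigma>]
    by (rule form_of_conj_iff) (use class_rep_ideal I res in \<open>simp_all add: form_residue_def\<close>)
  also have "\<dots> \<longleftrightarrow> ideal_class I = ideal_class I' \<and> (\<exists>u\<in>Units \<O>. \<exists>t. algebraic_int t \<and> c' - u * c = a * t)"
  proof
    assume "\<exists>s u. s \<noteq> 0 \<and> u \<in> Units \<O> \<and> ?J' = (*) s ` ?J \<and> ?z' - u * ?z / (s * s) \<in> o_inv2 ?J'"
    then obtain s u where su: "s \<noteq> 0" "u \<in> Units \<O>" "?J' = (*) s ` ?J" "?z' - u * ?z / (s * s) \<in> o_inv2 ?J'" by blast
    have cl: "ideal_class I = ideal_class I'" using class_rep_eq_iff[OF I] su by blast
    then have J: "?J' = ?J" by (simp add: class_rep_def)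
    have s: "s \<in> Units \<O>" using su(1,3) J by (intro stabilizer_unit[OF class_rep_ideal(3)[OF I(1)]]) simp_all
    let ?u = "u * inverse (s * s)"
    have u: "?u \<in> Units \<O>" using s su(2) by (intro mult inv)
    have "u * ?z / (s * s) = ?u * (c * generator ?J / a)" by (simp only: divide_inverse mult_ac)
    then have "c' * generator ?J / a - ?u * (c * generator ?J / a) \<in> o_inv2 ?J" using su(4) J by simp
    then show "ideal_class I = ideal_class I' \<and> (\<exists>u\<in>Units \<O>. \<exists>t. algebraic_int t \<and> c' - u * c = a * t)"
      using key[OF u] u cl by blast
  next
    assume h: "ideal_class I = ideal_class I' \<and> (\<exists>u\<in>Units \<O>. \<exists>t. algebraic_int t \<and> c' - u * c = a * t)"
    then obtain u where u: "u \<in> Units \<O>" "\<exists>t. algebraic_int t \<and> c' - u * c = a * t" by blast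
    have J: "?J' = ?J" using h by (simp add: class_rep_def)
    show "\<exists>s u. s \<noteq> 0 \<and> u \<in> Units \<O> \<and> ?J' = (*) s ` ?J \<and> ?z' - u * ?z / (s * s) \<in> o_inv2 ?J'"
      using u key[OF u(1)] unfolding J by (intro exI[of _ 1] exI[of _ u]) simp
  qed
  finally show ?thesis .
qed

lemma card_integral_conj_classes:
  "card (integral_conj_classes G rho) = card (branch_orbits r P e) * class_number K"
proof -
  define f where "f = orbit (GL2 (carrier (\<O> :: 'k ring))) form_act"
  define g where "g = (\<lambda>(x, I). (orbit (units_of (\<O> :: 'k ring)) branch_act x, ideal_class I))"
  let ?Y = "branch_product r P e \<times> (nonzero_ideals :: 'k set set)"
  \<comment> \<open>A form corresponds to a point of the branches together with an ideal when both
    have the same integer c as residue.\<close>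
  define R where "R = (\<lambda>\<sigma> (x, I). \<exists>c. algebraic_int c \<and> branch_residue x c \<and> form_residue \<sigma> c I)"
  have "card (f ` integral_forms G rho) = card (g ` ?Y)"
  proof (rule card_image_eq_of_correspondence[where R = R])
    fix \<sigma> assume "\<sigma> \<in> integral_forms G rho"
    then obtain c I where c: "algebraic_int c" "I \<in> nonzero_ideals" "form_residue \<sigma> c I"
      using ex_residue_of_form by blast
    obtain x where "branch_residue x c" using ex_branch_of_residue[OF c(1)] by blast
    then show "\<exists>y\<in>?Y. R \<sigma> y"
      using c by (intro bexI[of _ "(x, I)"]) (auto simp: R_def branch_residue_def)
  next
    fix y assume "y \<in> ?Y"
    then obtain x I where y: "y = (x, I)" "x \<in> branch_product r P e" "I \<in> nonzero_ideals" by auto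
    obtain c where c: "branch_residue x c" using ex_residue_of_branch[OF y(2)] by blast
    then have "algebraic_int c" by (simp add: branch_residue_def)
    then show "\<exists>\<sigma>\<in>integral_forms G rho. R \<sigma> y" using ex_form_residue[OF _ y(3)] c y(1) by (auto simp: R_def)
  next
    fix \<sigma> y \<sigma>' y' assume h: "\<sigma> \<in> integral_forms G rho" "y \<in> ?Y" "\<sigma>' \<in> integral_forms G rho" "y' \<in> ?Y" "R \<sigma> y" "R \<sigma>' y'"
    obtain x I x' I' where y: "y = (x, I)" "y' = (x', I')" by (cases y, cases y')
    obtain c where c: "algebraic_int c" "branch_residue x c" "form_residue \<sigma> c I" using h(5) by (auto simp: R_def y)
    obtain c' where c': "algebraic_int c'" "branch_residue x' c'" "form_residue \<sigma>' c' I'" using h(6) by (auto simp: R_def y)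
    have I: "I \<in> nonzero_ideals" "I' \<in> nonzero_ideals" using h y by auto
    show "f \<sigma> = f \<sigma>' \<longleftrightarrow> g y = g y'"
      unfolding f_def g_def y
      using form_residue_orbit_eq_iff[OF h(1,3) c(1) c'(1) I c(3) c'(3)] branch_orbit_eq_iff[OF c(2) c'(2)]
      by auto
  qed
  moreover have "f ` integral_forms G rho = integral_conj_classes G rho"
    by (auto simp: integral_conj_classes_def orbits_def f_def)
  moreover have "g ` ?Y = branch_orbits r P e \<times> (nonzero_ideals // ideal_class_rel)"
    by (auto simp: branch_orbits_def orbits_def g_def quotient_def image_iff)
  ultimately show ?thesis by (simp add: card_cartesian_product class_number_def)
qed

end

theorem theorem5:
  fixes G :: "('g, 'm) monoid_scheme" and g0 :: 'g
    and chi :: "'g \<Rightarrow> 'k::field_char_0"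
    and p m r :: nat and P :: "nat \<Rightarrow> 'k set" and e :: "nat \<Rightarrow> nat"
  assumes "group G" and "finite (carrier G)"
    and "g0 \<in> carrier G" and "carrier G = generate G {g0}"
    and "number_field TYPE('k)"
    and "chi \<in> hom G (units_of (cring_class_ops :: 'k ring))"
    and "Factorial_Ring.prime p" and "m \<ge> 1"
    and "group.ord (units_of cring_class_ops) (chi g0) = p ^ m"
    and "\<forall>i\<in>{1..r}. primeideal (P i) \<O> \<and> e i \<ge> 1"
    and "inj_on P {1..r}"
    and "PIdl\<^bsub>\<O>\<^esub> (1 - chi g0) =
           (\<Otimes>\<^bsub>ideals_set \<O>\<^esub> i\<in>{1..r}. P i [^]\<^bsub>ideals_set \<O>\<^esub> e i)"
  shows "card (integral_conj_classes G (rep_of_char G chi)) =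
           card (branch_orbits r P e) * class_number TYPE('k)"
proof -
  interpret G: group G by fact
  interpret N: number_field_type "TYPE('k)" by unfold_locales fact
  interpret F: group "units_of (cring_class_ops :: 'k ring)" by (rule cring_class.units_group)
  define z where "z = chi g0"
  define a where "a = 1 - z"
  have Units: "u \<in> Units (cring_class_ops :: 'k ring) \<longleftrightarrow> u \<noteq> 0" for u
  proof
    assume "u \<noteq> 0"
    then have "inverse u * u = 1" "u * inverse u = 1" by simp_all
    then show "u \<in> Units (cring_class_ops :: 'k ring)"
      unfolding Units_def mem_Collect_eq
      by (intro conjI bexI[of _ "inverse u"]) (simp_all add: class_simps)
  qed (auto simp: Units_def class_simps)
  have chi_nz: "chi g \<noteq> 0" if "g \<in> carrier G" for g
    using hom_in_carrier[OF assms(6) that] by (simp add: units_of_carrier Units)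
  have chi_mult: "chi (g \<otimes>\<^bsub>G\<^esub> h) = chi g * chi h" if "g \<in> carrier G" "h \<in> carrier G" for g h
    using hom_mult[OF assms(6) that] by (simp add: units_of_mult class_simps)
  have chi_one: "chi \<one>\<^bsub>G\<^esub> = 1"
    using chi_mult[of "\<one>\<^bsub>G\<^esub>" "\<one>\<^bsub>G\<^esub>"] chi_nz[of "\<one>\<^bsub>G\<^esub>"] by simp
  have zF: "z \<in> carrier (units_of (cring_class_ops :: 'k ring))"
    unfolding z_def using hom_in_carrier[OF assms(6,3)] .
  have pow: "z [^]\<^bsub>units_of (cring_class_ops :: 'k ring)\<^esub> n = z ^ n" for n :: nat
    by (induction n) (simp_all add: units_of_mult units_of_one class_simps mult.commute)
  have "p ^ m \<noteq> 1" using prime_gt_1_nat[OF assms(7)] assms(8) by simp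
  moreover have "z ^ (p ^ m) = 1"
    using F.pow_ord_eq_1[OF zF] assms(9) by (simp add: pow z_def[symmetric] units_of_one class_simps)
  moreover have "p ^ m > 0" using prime_gt_0_nat[OF assms(7)] by simp
  moreover have "F.ord z = p ^ m" using assms(9) by (simp add: z_def)
  \<comment> \<open>So z is a root of unity, hence integral together with its inverse, and it
    differs from 1, which will make a nonzero.\<close>
  ultimately obtain n where n: "n > 0" "z ^ n = 1" "F.ord z \<noteq> 1" using that[of "p ^ m"] by simp
  have root_int: "algebraic_int x" if "x ^ n = 1" for x :: 'k
  proof (rule power_in_span_imp_algebraic_int)
    \<comment> \<open>The power x^n equals x^0, which is among the lower powers because n >
      0.\<close>
    have "x ^ 0 \<in> Zmod.span ((^) x ` {..<n})" using n(1) by (intro Zmod.span_base imageI) simp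
    then show "x ^ n \<in> Zmod.span ((^) x ` {..<n})" using that by simp
  qed
  have z_int: "algebraic_int z" "algebraic_int (inverse z)"
    using root_int n(2) by (simp_all add: power_inverse)
  have "z \<noteq> 1"
  proof
    assume "z = 1"
    then have "F.ord z = 1" using F.ord_eq_1[OF zF] by (simp add: units_of_one class_simps)
    then show False using n(3) by simp
  qed
  then have a_nz: "a \<noteq> 0" by (simp add: a_def)
  have z_nz: "z \<noteq> 0" unfolding z_def using chi_nz assms(3) .
  \<comment> \<open>Induction over the group generated by g0: congruence to 1 modulo a passes to
    products and to inverses.\<close>
  have chi: "algebraic_int (chi g) \<and> (\<exists>t. algebraic_int t \<and> 1 - chi g = a * t)" if "g \<in> carrier G" for g
    using that unfolding assms(4)
  proof (induction rule: generate.induct)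
    case one
    then show ?case using chi_one by (auto intro!: exI[of _ 0])
  next
    case (incl h)
    then show ?case using z_int by (auto simp: a_def z_def intro!: exI[of _ 1])
  next
    case (inv h)
    then have h: "h = g0" by simp
    have "chi (inv\<^bsub>G\<^esub> g0) * z = 1"
      unfolding z_def using chi_mult[of "inv\<^bsub>G\<^esub> g0" g0] assms(3) chi_one by simp
    then have "chi (inv\<^bsub>G\<^esub> g0) = inverse z" using z_nz by (simp add: field_simps)
    moreover have "1 - inverse z = a * (- inverse z)" using z_nz by (simp add: a_def field_simps)
    ultimately show ?case using z_int h by auto
  next
    case (eng h k)
    then obtain s t where st: "algebraic_int s" "1 - chi h = a * s" "algebraic_int t" "1 - chi k = a * t" by blast
    have hk: "h \<in> carrier G" "k \<in> carrier G" using eng(1,2) assms(4) by auto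
    have "1 - chi (h \<otimes>\<^bsub>G\<^esub> k) = (1 - chi h) + chi h * (1 - chi k)"
      by (simp add: chi_mult[OF hk] algebra_simps)
    also have "\<dots> = a * (s + chi h * t)" unfolding st(2,4) by (simp add: algebra_simps)
    finally show ?case
      using eng st chi_mult[OF hk] by (auto intro!: algebraic_int_mult algebraic_int_add)
  qed
  interpret character_rep "TYPE('k)" G g0 chi a
    by unfold_locales (use assms(1,3) chi_mult chi_nz chi a_nz in \<open>auto simp: a_def z_def\<close>)
  have factorized: "(\<Otimes>\<^bsub>ideals_set \<O>\<^esub>i\<in>{1..r}. o_power (P i) (e i)) = {a * x |x. algebraic_int x}"
    using assms(12) unfolding cgenideal_int_ring o_power_def a_def z_def by simp
  have P_prime: "o_prime (P i)" if "i \<in> {1..r}" for i using assms(10) that primeideal_imp_o_prime by blast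
  \<comment> \<open>\<open>primeideal\<close> admits the zero ideal; with a positive exponent it
    would make the whole product zero, but the product contains a.\<close>
  have P_nonzero: "P i \<noteq> {0}" if i: "i \<in> {1..r}" for i
  proof
    assume "P i = {0}"
    have "o_power {0::'k} (Suc k) \<subseteq> {0}" for k
    proof
      fix x :: 'k assume "x \<in> o_power {0} (Suc k)"
      then have "x \<in> ideal_prod \<O> (o_power {0} k) {0}" by (simp add: o_power_Suc)
      then show "x \<in> {0}" by (induction rule: ideal_prod.induct) auto
    qed
    moreover have "e i = Suc (e i - 1)" using assms(10) i by force
    ultimately have "o_power (P i) (e i) \<subseteq> {0}" using \<open>P i = {0}\<close> by metis
    moreover have "(\<Otimes>\<^bsub>ideals_set \<O>\<^esub>i\<in>{1..r}. o_power (P i) (e i)) \<subseteq> o_power (P i) (e i)"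
    proof (rule o_ideal_finprod(3)[OF _ _ i])
      fix j assume "j \<in> {1..r}"
      then show "o_ideal (o_power (P j) (e j))" using P_prime by (intro o_ideal_o_power) (simp add: o_prime_def)
    qed simp
    moreover have "a \<in> {a * x |x. algebraic_int x}" by (intro CollectI exI[of _ 1]) simp
    ultimately show False using a_nz unfolding factorized by blast
  qed
  interpret character_rep_primes "TYPE('k)" G g0 chi a r P e
    by unfold_locales (fact P_prime P_nonzero assms(11) factorized)+
  show ?thesis by (rule card_integral_conj_classes)
qed

end
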